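(* Let $0 < \alpha < 0.005$ and $0 < \varepsilon < 0.05$ be real numbers. There exists $n_0 = n_0(\alpha,\varepsilon)$ such that for every $n \geq n_0$ the following holds. Let $T$ be a tree on $n$ vertices with maximum degree $\Delta(T) \leq n^{\varepsilon}$. Then for every positive integer $b \leq n^{\alpha}$, Maker (whether he plays as the first or the second player) has a strategy to win the $(1 : b)$ Maker-Breaker tree embedding game $\mathcal{T}_n$ within $n + o(n)$ moves.
   Context: In the $(p:q)$ Maker-Breaker game $(X,\mathcal{F})$, where $X$ is a finite set (the board) and $\mathcal{F} \subseteq 2^X$ (the winning sets), two players, Maker and Breaker, alternately claim previously unclaimed elements of $X$; Maker claims $p$ elements per turn and Breaker claims $q$. Maker wins as soon as he has claimed all elements of some winning set; Breaker wins if this never happens by the time all elements are claimed. Given a tree $T$ on $n$ vertices, the tree embedding game $\mathcal{T}_n$ is the Maker-Breaker game whose board is the edge set $E(K_n)$ of the complete graph on $n$ vertices and whose winning sets are the edge sets of the copies of $T$ in $K_n$. The $o(n)$ term is as $n \to \infty$. *)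

theory Defs
  imports Complex_Main "HOL-Library.Landau_Symbols"
begin

section \<open>Maker-Breaker games\<close>

text \<open>
  A game is given by a finite board \<open>A\<close> and a family \<open>F\<close> of winning sets. The players move
  alternately; \<open>X t\<close> is the set of elements claimed in turn \<open>t\<close> (counted from 0).
  Plays are infinite sequences: once the board is exhausted, the only legal move is \<open>{}\<close>.
\<close>

datatype player = Maker | Breaker

definition mover :: "player \<Rightarrow> nat \<Rightarrow> player" where
  "mover first t = (if even t then first else if first = Maker then Breaker else Maker)"

definition claimed :: "(nat \<Rightarrow> 'a set) \<Rightarrow> nat \<Rightarrow> 'a set" where
  "claimed X t = (\<Union>s<t. X s)"

text \<open>
  A player with bias \<open>k\<close> claims exactly \<open>k\<close> free elements per turn, or all of the free
  elements if fewer than \<open>k\<close> are left.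
\<close>

definition legal_move :: "'a set \<Rightarrow> nat \<Rightarrow> (nat \<Rightarrow> 'a set) \<Rightarrow> nat \<Rightarrow> bool" where
  "legal_move A k X t \<longleftrightarrow>
     X t \<subseteq> A - claimed X t \<and> card (X t) = min k (card (A - claimed X t))"

text \<open>A strategy maps the list of all previous moves, of both players, to the next move.\<close>

type_synonym 'a strategy = "'a set list \<Rightarrow> 'a set"

definition maker_follows :: "player \<Rightarrow> 'a strategy \<Rightarrow> (nat \<Rightarrow> 'a set) \<Rightarrow> bool" where
  "maker_follows first \<sigma> X \<longleftrightarrow>
     (\<forall>t. mover first t = Maker \<longrightarrow> X t = \<sigma> (map X [0..<t]))"

definition breaker_legal :: "player \<Rightarrow> 'a set \<Rightarrow> nat \<Rightarrow> (nat \<Rightarrow> 'a set) \<Rightarrow> bool" where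
  "breaker_legal first A q X \<longleftrightarrow> (\<forall>t. mover first t = Breaker \<longrightarrow> legal_move A q X t)"

definition maker_legal :: "player \<Rightarrow> 'a set \<Rightarrow> nat \<Rightarrow> (nat \<Rightarrow> 'a set) \<Rightarrow> bool" where
  "maker_legal first A p X \<longleftrightarrow> (\<forall>t. mover first t = Maker \<longrightarrow> legal_move A p X t)"

text \<open>
  Whoever starts, the turns in which Maker makes his first \<open>m\<close> moves are exactly those of his
  turns that lie among the first \<open>2 * m\<close> turns of the play.
\<close>

definition maker_claimed :: "player \<Rightarrow> (nat \<Rightarrow> 'a set) \<Rightarrow> nat \<Rightarrow> 'a set" where
  "maker_claimed first X m = (\<Union>t\<in>{t. t < 2 * m \<and> mover first t = Maker}. X t)"

text \<open>
  In the \<open>(p:q)\<close> game, \<open>\<sigma>\<close> wins for Maker within \<open>m\<close> of his moves: however Breaker plays,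
  \<open>\<sigma>\<close> makes legal moves and Maker owns a winning set after at most \<open>m\<close> moves. (As the set of
  Maker's elements only grows, it is harmless to let the play go on after he has won.)
\<close>

definition maker_wins_within ::
  "nat \<Rightarrow> nat \<Rightarrow> 'a set \<Rightarrow> 'a set set \<Rightarrow> player \<Rightarrow> 'a strategy \<Rightarrow> nat \<Rightarrow> bool" where
  "maker_wins_within p q A F first \<sigma> m \<longleftrightarrow>
     (\<forall>X. maker_follows first \<sigma> X \<and> breaker_legal first A q X \<longrightarrow>
          maker_legal first A p X \<and> (\<exists>W\<in>F. W \<subseteq> maker_claimed first X m))"

section \<open>Graphs and trees\<close>

text \<open>
  A finite simple graph is given by its vertex set \<open>V\<close> and its set \<open>E\<close> of edges, which are
  two-element subsets of \<open>V\<close>. (The notion \<open>tree\<close> in the AFP entry Graph Theory is not usable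
  here, as its acyclicity part is about directed cycles: an undirected edge, represented by a
  pair of opposite arcs, already is one.)
\<close>

definition complete_edges :: "'v set \<Rightarrow> 'v set set" where
  "complete_edges V = {e. e \<subseteq> V \<and> card e = 2}"

definition simple_graph :: "'v set \<Rightarrow> 'v set set \<Rightarrow> bool" where
  "simple_graph V E \<longleftrightarrow> finite V \<and> E \<subseteq> complete_edges V"

definition connected_graph :: "'v set \<Rightarrow> 'v set set \<Rightarrow> bool" where
  "connected_graph V E \<longleftrightarrow> V \<noteq> {} \<and> (\<forall>u\<in>V. \<forall>v\<in>V. (u, v) \<in> {(x, y). {x, y} \<in> E}\<^sup>*)"

definition is_cycle :: "'v set set \<Rightarrow> 'v list \<Rightarrow> bool" where
  "is_cycle E c \<longleftrightarrow> length c \<ge> 3 \<and> distinct c \<and>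
     (\<forall>i<length c. {c ! i, c ! (Suc i mod length c)} \<in> E)"

definition tree_graph :: "'v set \<Rightarrow> 'v set set \<Rightarrow> bool" where
  "tree_graph V E \<longleftrightarrow> simple_graph V E \<and> connected_graph V E \<and> (\<nexists>c. is_cycle E c)"

definition degree :: "'v set set \<Rightarrow> 'v \<Rightarrow> nat" where
  "degree E v = card {e\<in>E. v \<in> e}"

definition max_degree :: "'v set \<Rightarrow> 'v set set \<Rightarrow> nat" where
  "max_degree V E = Max (degree E ` V)"

text \<open>The edge sets of the copies of the graph \<open>(V, E)\<close> in the complete graph on \<open>U\<close>.\<close>

definition copies :: "'u set \<Rightarrow> 'v set \<Rightarrow> 'v set set \<Rightarrow> 'u set set set" where
  "copies U V E = {(\<lambda>e. f ` e) ` E | f. inj_on f V \<and> f ` V \<subseteq> U}"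

section \<open>The tree embedding game\<close>

text \<open>
  Played on \<open>K\<^sub>n\<close> with vertex set \<open>{0, \<dots>, n - 1}\<close>, where \<open>n\<close> is the number of vertices of the
  tree.
\<close>

definition tree_game_wins_within ::
  "nat \<Rightarrow> nat \<Rightarrow> 'v set \<Rightarrow> 'v set set \<Rightarrow> player \<Rightarrow> nat set strategy \<Rightarrow> nat \<Rightarrow> bool" where
  "tree_game_wins_within p q V E first \<sigma> m \<longleftrightarrow>
     maker_wins_within p q (complete_edges {..<card V}) (copies {..<card V} V E) first \<sigma> m"

end

theory Submission
  imports Defs "HOL-Analysis.Convex" "HOL-Real_Asymp.Real_Asymp"
begin

text \<open>
  Root the tree. Either it has many vertices with a leaf child, or it has few leaves and hence many disjoint
  vertical paths of length \<open>2b + 5\<close> all of whose vertices have one child. In both cases, Maker places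
  about \<open>n powr 0.9\<close> of these pieces as gadgets with a hole: structures that can absorb any free vertex without Breaker edges
  to the gadget. In the leaf case the hole is the leaf. In the path case the gadget is a path with chords from
  its second vertex to more than \<open>b\<close> later ones; joining the new vertex to the first vertex of the path
  leaves Maker more than \<open>b\<close> ways to complete the detour, which Breaker cannot all block.

  Maker places the tree top-down, with one move for each vertex. Whenever a vertex that is still needed reaches Breaker degree
  \<open>n powr 0.7\<close>, he stops to take care of it: he places its children, fills its gadget, or places it into the tree (if it is
  blocked from the tree directly, as a grandchild of a suitable new vertex, reached through a star of \<open>b + 1\<close> Maker edges).
  As Breaker owns at most about \<open>bn\<close> edges, this happens rarely enough to keep all relevant degrees at \<open>O(n powr 0.7)\<close>.

  In the end the free vertices are as many as the holes. Hall's theorem distributes them over blocks of about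
  \<open>n powr 0.05\<close> gadgets so that no Breaker edge lies inside a block. On the union of the blocks, which has \<open>o(n)\<close>
  pairs, the Erdos-Selfridge-Beck potential argument lets Maker hit every obstruction to Hall's condition, and
  the resulting perfect matchings fill all holes.
\<close>

section \<open>Forcing in Maker-Breaker games\<close>

text \<open>The obstacle is the end of the embedding: among few free vertices, Breaker could cut one
  off from every role still to be placed. A hole is a placed role that occupies no vertex, so the
  holes keep a reserve of free vertices, and each greedy choice is made among about
  \<open>n powr 0.9\<close> candidates against Breaker degrees of order \<open>n powr 0.7\<close>.
  Only the last stage has no slack; there a matching takes the place of greedy choices.

  A vertex can be endangered in three stages of its life: while it is free, while it belongs to an
  unfilled gadget, and while a child of its role is missing. It leaves each stage once, so the
  responses number at most three times the vertices of high degree, of which Breaker can create only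
  about \<open>b * n / n powr 0.7\<close>.

  Blocks are needed because playing on all pairs of free vertices and holes could take about
  \<open>n powr 1.8\<close> moves. For the potential argument a block only has to be a large
  multiple of \<open>b * ln n\<close>. Absorbing a vertex takes two moves, so the game on pairs is
  played against bias \<open>2 * b\<close>.\<close>

locale game =
  fixes K :: "'a set" and b :: nat
  assumes fin_K: "finite K"
begin

text \<open>A strategy tree as an inductive predicate, with Maker to move. Strategies then compose
  by \<open>force_trans\<close>, and a function on histories is extracted only once, in
  \<open>strategy_of_force\<close>. Breaker is allowed fewer than \<open>b\<close> elements, so his
  last, incomplete move needs no separate treatment.\<close>

inductive force :: "('a set \<Rightarrow> 'a set \<Rightarrow> bool) \<Rightarrow> 'a set \<Rightarrow> 'a set \<Rightarrow> bool"
  for Q :: "'a set \<Rightarrow> 'a set \<Rightarrow> bool" where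
  stop: "Q M B \<Longrightarrow> force Q M B"
| move: "e \<in> K - (M \<union> B) \<Longrightarrow>
    (\<And>Y. Y \<subseteq> K - (insert e M \<union> B) \<Longrightarrow> card Y \<le> b \<Longrightarrow> force Q (insert e M) (B \<union> Y)) \<Longrightarrow>
    force Q M B"

lemma force_trans:
  assumes "force P M B" and "\<And>M B. P M B \<Longrightarrow> force Q M B"
  shows "force Q M B"
  using assms(1)
proof induction
  case (stop M B)
  then show ?case by (rule assms(2))
next
  case (move e M B)
  then show ?case by (blast intro: force.move)
qed

lemma force_mono:
  assumes "force P M B" and "\<And>M B. P M B \<Longrightarrow> Q M B"
  shows "force Q M B"
  using assms(1) by (rule force_trans) (blast intro: stop assms(2))

section \<open>Positions and move budgets\<close>

text \<open>The summand 1 pays for a Breaker move made before Maker's first one.\<close>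

definition pos :: "'a set \<Rightarrow> 'a set \<Rightarrow> bool" where
  "pos M B \<longleftrightarrow> M \<subseteq> K \<and> B \<subseteq> K \<and> M \<inter> B = {} \<and> card B \<le> b * (card M + 1)"

text \<open>Only upper bounds for the effect of \<open>i\<close> moves are recorded, so that budgets
  add up and can be relaxed.\<close>

definition adv :: "nat \<Rightarrow> 'a set \<Rightarrow> 'a set \<Rightarrow> 'a set \<Rightarrow> 'a set \<Rightarrow> bool" where
  "adv i M B M' B' \<longleftrightarrow> pos M' B' \<and> M \<subseteq> M' \<and> B \<subseteq> B' \<and> card M' \<le> card M + i \<and> card (B' - B) \<le> b * i"

lemma pos_finite: "pos M B \<Longrightarrow> finite M \<and> finite B"
  unfolding pos_def using fin_K finite_subset by blast

lemma adv_refl: "pos M B \<Longrightarrow> adv i M B M B"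
  by (simp add: adv_def)

lemma adv_pos: "adv i M B M' B' \<Longrightarrow> pos M' B'"
  by (simp add: adv_def)

lemma adv_subset: "adv i M B M' B' \<Longrightarrow> M \<subseteq> M'"
  by (simp add: adv_def)

lemma adv_trans:
  assumes "adv i M B M1 B1" "adv j M1 B1 M2 B2"
  shows "adv (i + j) M B M2 B2"
proof -
  have fin: "finite B2" using assms(2) pos_finite adv_pos by blast
  have "card (B2 - B) \<le> card ((B2 - B1) \<union> (B1 - B))"
    using fin assms by (intro card_mono) (auto simp: adv_def intro: finite_subset)
  also have "\<dots> \<le> card (B2 - B1) + card (B1 - B)" by (rule card_Un_le)
  also have "\<dots> \<le> b * (i + j)" using assms by (auto simp: adv_def algebra_simps)
  finally show ?thesis using assms by (auto simp: adv_def)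
qed

lemma adv_weaken: "adv i M B M' B' \<Longrightarrow> i \<le> j \<Longrightarrow> adv j M B M' B'"
  unfolding adv_def by (meson add_le_mono1 le_trans mult_le_mono2 nat_add_left_cancel_le)

lemma force_claim:
  assumes "pos M B" "e \<in> K" "e \<notin> B"
  shows "force (\<lambda>M' B'. adv 1 M B M' B' \<and> e \<in> M') M B"
proof (cases "e \<in> M")
  case True
  then show ?thesis using assms adv_refl by (intro force.stop) auto
next
  case False
  note fin = pos_finite[OF assms(1)]
  show ?thesis
  proof (rule force.move)
    show "e \<in> K - (M \<union> B)" using False assms by auto
  next
    fix Y assume Y: "Y \<subseteq> K - (insert e M \<union> B)" "card Y \<le> b"
    have finY: "finite Y" using Y fin_K finite_subset by blast
    have "card (B \<union> Y) \<le> card B + card Y" by (rule card_Un_le)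
    also have "\<dots> \<le> b * (card (insert e M) + 1)"
      using assms Y False fin by (auto simp: pos_def)
    finally have "pos (insert e M) (B \<union> Y)"
      using assms Y by (auto simp: pos_def)
    moreover have "card (B \<union> Y - B) \<le> b"
      using Y finY by (metis Diff_subset_conv card_mono le_trans subset_refl)
    ultimately show "force (\<lambda>M' B'. adv 1 M B M' B' \<and> e \<in> M') (insert e M) (B \<union> Y)"
      using fin False by (intro force.stop) (auto simp: adv_def)
  qed
qed

section \<open>From forcing to a strategy\<close>

text \<open>Follow the play in which Breaker always claims nothing: Maker's set grows until
  \<open>Q\<close> holds. This turns a bound on Maker's set inside \<open>Q\<close> into a bound on
  the number of his moves.\<close>

lemma force_reach:
  "force Q M B \<Longrightarrow> M \<subseteq> K \<Longrightarrow> Q M B \<or> (\<exists>M' B'. Q M' B' \<and> card M < card M')"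
proof (induction rule: force.induct)
  case (stop M B)
  then show ?case by blast
next
  case (move e M B)
  have "finite M" using move.prems fin_K finite_subset by blast
  then have *: "card M < card (insert e M)" using move.hyps by (simp add: card_insert_if)
  have "Q (insert e M) (B \<union> {}) \<or> (\<exists>M' B'. Q M' B' \<and> card (insert e M) < card M')"
    using move.hyps move.prems by (intro move.IH) auto
  then show ?case using * by (meson less_trans)
qed

text \<open>The strategy picks a move after which forcing persists, if there is one. Otherwise it
  takes any free element, because it has to stay legal after the win until the board is
  exhausted.\<close>

lemma strategy_of_force:
  fixes F :: "'a set set" and m :: nat
  defines "Q \<equiv> \<lambda>M (B :: 'a set). (\<exists>W\<in>F. W \<subseteq> M) \<and> card M \<le> m"
  assumes start: "\<And>B. B \<subseteq> K \<Longrightarrow> card B \<le> b \<Longrightarrow> force Q {} B"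
  shows "\<exists>\<sigma>. maker_wins_within 1 b K F first \<sigma> m"
proof -
  define ofp where "ofp p hs = \<Union>{hs ! t | t. t < length hs \<and> mover first t = p}"
    for p and hs :: "'a set list"
  define good where "good M B e \<longleftrightarrow> e \<in> K - (M \<union> B) \<and>
    (\<forall>Y. Y \<subseteq> K - (insert e M \<union> B) \<longrightarrow> card Y \<le> b \<longrightarrow> force Q (insert e M) (B \<union> Y))" for M B e
  define \<sigma> where "\<sigma> hs = (let M = ofp Maker hs; B = ofp Breaker hs in
    if \<exists>e. good M B e then {SOME e. good M B e}
    else if K - (M \<union> B) = {} then {} else {SOME e. e \<in> K - (M \<union> B)})" for hs
  have good_ex: "\<exists>e. good M B e" if "force Q M B" "\<not> Q M B" for M B
    using that by cases (auto simp: good_def)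
  show ?thesis
  proof (intro exI[of _ \<sigma>], unfold maker_wins_within_def, intro allI impI)
    fix X assume X: "maker_follows first \<sigma> X \<and> breaker_legal first K b X"
    define Mt where "Mt t = (\<Union>s\<in>{s. s < t \<and> mover first s = Maker}. X s)" for t
    define Bt where "Bt t = (\<Union>s\<in>{s. s < t \<and> mover first s = Breaker}. X s)" for t
    have ofp: "ofp Maker (map X [0..<t]) = Mt t" "ofp Breaker (map X [0..<t]) = Bt t" for t
      by (auto simp: ofp_def Mt_def Bt_def)
    have mv: "mover first s = Maker \<or> mover first s = Breaker" for s
      by (cases "mover first s") auto
    have cl: "claimed X t = Mt t \<union> Bt t" for t
      using mv by (auto simp: claimed_def Mt_def Bt_def)
    have mk: "X t = (if \<exists>e. good (Mt t) (Bt t) e then {SOME e. good (Mt t) (Bt t) e}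
        else if K - (Mt t \<union> Bt t) = {} then {} else {SOME e. e \<in> K - (Mt t \<union> Bt t)})"
      if "mover first t = Maker" for t
      using X that unfolding maker_follows_def \<sigma>_def ofp Let_def by metis
    have mk_good: "X t = {SOME e. good (Mt t) (Bt t) e} \<and> good (Mt t) (Bt t) (SOME e. good (Mt t) (Bt t) e)"
      if "mover first t = Maker" "\<exists>e. good (Mt t) (Bt t) e" for t
      using mk[OF that(1)] that(2) by (auto intro: someI)
    have legal: "maker_legal first K 1 X"
      unfolding maker_legal_def legal_move_def cl
    proof (intro allI impI)
      fix t assume t: "mover first t = Maker"
      have finf: "finite (K - (Mt t \<union> Bt t))" using fin_K by auto
      consider (a) "\<exists>e. good (Mt t) (Bt t) e" | (b) "\<not> (\<exists>e. good (Mt t) (Bt t) e)" "K - (Mt t \<union> Bt t) = {}"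
        | (c) "\<not> (\<exists>e. good (Mt t) (Bt t) e)" "K - (Mt t \<union> Bt t) \<noteq> {}" by blast
      then show "X t \<subseteq> K - (Mt t \<union> Bt t) \<and> card (X t) = min 1 (card (K - (Mt t \<union> Bt t)))"
      proof cases
        case a
        define e where "e = (SOME e. good (Mt t) (Bt t) e)"
        have e: "X t = {e}" "e \<in> K - (Mt t \<union> Bt t)"
          using mk_good[OF t a] unfolding e_def good_def by auto
        have "card (K - (Mt t \<union> Bt t)) \<ge> 1"
          using e finf by (metis One_nat_def Suc_leI card_gt_0_iff empty_iff)
        then show ?thesis using e by auto
      next
        case b
        have "X t = {}" using mk[OF t] unfolding if_not_P[OF b(1)] if_P[OF b(2)] .
        then show ?thesis unfolding b(2) by simp
      next
        case c
        define e where "e = (SOME e. e \<in> K - (Mt t \<union> Bt t))"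
        have e: "X t = {e}" using mk[OF t] c(2) unfolding if_not_P[OF c(1)] e_def by (simp only: if_False)
        have e2: "e \<in> K - (Mt t \<union> Bt t)" unfolding e_def by (rule someI_ex) (use c(2) in blast)
        have "card (K - (Mt t \<union> Bt t)) \<ge> 1"
          using e2 finf by (metis One_nat_def Suc_leI card_gt_0_iff empty_iff)
        then show ?thesis using e e2 by auto
      qed
    qed
    have br: "X t \<subseteq> K - (Mt t \<union> Bt t)" "card (X t) \<le> b" if "mover first t = Breaker" for t
      using X that unfolding breaker_legal_def legal_move_def cl by auto
    \<comment> \<open>\<open>T j\<close> is the turn of Maker's move number \<open>j\<close>,
      counted from 0.\<close>
    define T :: "nat \<Rightarrow> nat" where "T j = (if first = Maker then 2 * j else 2 * j + 1)" for j
    have mT: "mover first (T j) = Maker" for j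
      by (cases first) (auto simp: T_def mover_def)
    have mT': "mover first (Suc (T j)) = Breaker" for j
      by (cases first) (auto simp: T_def mover_def)
    have TS: "T (Suc j) = Suc (Suc (T j))" for j by (simp add: T_def)
    have MtS: "Mt (Suc t) = Mt t \<union> (if mover first t = Maker then X t else {})" for t
      by (auto simp: Mt_def less_Suc_eq)
    have BtS: "Bt (Suc t) = Bt t \<union> (if mover first t = Breaker then X t else {})" for t
      by (auto simp: Bt_def less_Suc_eq)
    \<comment> \<open>Either the goal has been met at one of Maker's turns so far, or forcing has
      survived with exactly \<open>j\<close> Maker elements.\<close>
    have inv: "(\<exists>i\<le>j. Q (Mt (T i)) (Bt (T i))) \<or>
      (force Q (Mt (T j)) (Bt (T j)) \<and> Mt (T j) \<subseteq> K \<and> card (Mt (T j)) = j)" for j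
    proof (induction j)
      case 0
      have M0: "Mt (T 0) = {}" by (cases first) (auto simp: T_def Mt_def mover_def)
      have "Bt (T 0) \<subseteq> K \<and> card (Bt (T 0)) \<le> b"
      proof (cases first)
        case Maker
        then show ?thesis by (simp add: T_def Bt_def)
      next
        case Breaker
        then have "Bt (T 0) = X 0" by (auto simp: T_def Bt_def mover_def)
        then show ?thesis using br[of 0] Breaker by (auto simp: mover_def)
      qed
      then show ?case using start M0 by auto
    next
      case (Suc j)
      show ?case
      proof (cases "\<exists>i\<le>j. Q (Mt (T i)) (Bt (T i))")
        case True
        then show ?thesis using le_SucI by blast
      next
        case False
        define M where "M = Mt (T j)"
        define B where "B = Bt (T j)"
        have IH: "force Q M B" "M \<subseteq> K" "card M = j" using Suc False by (auto simp: M_def B_def)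
        have "\<not> Q M B" using False by (auto simp: M_def B_def)
        then have ex: "\<exists>e. good M B e" using good_ex IH(1) by blast
        define e where "e = (SOME e. good M B e)"
        have e: "X (T j) = {e}" "good M B e"
          using mk_good[OF mT] ex unfolding e_def M_def B_def by auto
        have eK: "e \<in> K" "e \<notin> M" "e \<notin> B" using e(2) by (auto simp: good_def)
        have M': "Mt (T (Suc j)) = insert e M"
          using e(1) mT mT' by (auto simp: TS MtS M_def)
        have B': "Bt (T (Suc j)) = B \<union> X (Suc (T j))"
          using mT mT' by (auto simp: TS BtS B_def)
        have "X (Suc (T j)) \<subseteq> K - (insert e M \<union> B)"
          using br(1)[OF mT'[of j]] e(1) mT mT' by (auto simp: MtS BtS M_def B_def)
        then have "force Q (insert e M) (B \<union> X (Suc (T j)))"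
          using e(2) br(2)[OF mT'[of j]] by (auto simp: good_def)
        moreover have "card (insert e M) = Suc j"
          using IH eK fin_K finite_subset[of M K] by auto
        ultimately show ?thesis using M' B' IH(2) eK by auto
      qed
    qed
    obtain i where i: "i \<le> m" "Q (Mt (T i)) (Bt (T i))"
    proof (cases "\<exists>i\<le>m. Q (Mt (T i)) (Bt (T i))")
      case True
      then show ?thesis using that by blast
    next
      case False
      then have "force Q (Mt (T m)) (Bt (T m))" "Mt (T m) \<subseteq> K" "card (Mt (T m)) = m"
        using inv[of m] by auto
      \<comment> \<open>Maker owns \<open>m\<close> elements and \<open>Q\<close> allows no more, so
        it cannot be reached later and must hold now.\<close>
      then have "Q (Mt (T m)) (Bt (T m))"
        using force_reach[of Q "Mt (T m)" "Bt (T m)"] unfolding Q_def by auto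
      then show ?thesis using that by blast
    qed
    have "Mt (T i) \<subseteq> maker_claimed first X m"
    proof
      fix v assume "v \<in> Mt (T i)"
      then obtain s where s: "s < T i" "mover first s = Maker" "v \<in> X s" by (auto simp: Mt_def)
      \<comment> \<open>If Breaker starts, \<open>T i\<close> may be \<open>2 * m + 1\<close>, but
        then Maker's turns are odd and \<open>2 * m\<close> is not one of them.\<close>
      have "s < 2 * m"
        using s(1,2) i(1) by (cases first) (auto simp: T_def mover_def split: if_splits; presburger)+
      then show "v \<in> maker_claimed first X m" using s by (auto simp: maker_claimed_def)
    qed
    then have "\<exists>W\<in>F. W \<subseteq> maker_claimed first X m" using i(2) unfolding Q_def by blast
    then show "maker_legal first K 1 X \<and> (\<exists>W\<in>F. W \<subseteq> maker_claimed first X m)" using legal by blast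
  qed
qed

end

section \<open>Systems of distinct representatives and the potential method\<close>

text \<open>The argument of Halmos and Vaughan: if some nonempty proper subfamily is tight,
  represent it inside its union and the rest outside; if none is, any single choice leaves Hall's
  condition intact.\<close>

theorem hall:
  fixes S :: "'i \<Rightarrow> 'a set"
  assumes "finite I" "\<And>i. i \<in> I \<Longrightarrow> finite (S i)"
    and "\<And>J. J \<subseteq> I \<Longrightarrow> card J \<le> card (\<Union>i\<in>J. S i)"
  shows "\<exists>f. inj_on f I \<and> (\<forall>i\<in>I. f i \<in> S i)"
  using assms
proof (induction "card I" arbitrary: I S rule: less_induct)
  case less
  note finS = less.prems(2) and cond = less.prems(3)
  show ?case
  proof (cases "I = {}")
    case True
    then show ?thesis by simp
  next
    case False
    show ?thesis
    proof (cases "\<exists>J. J \<subset> I \<and> J \<noteq> {} \<and> card (\<Union>i\<in>J. S i) = card J")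
      case True
      then obtain J where J: "J \<subset> I" "J \<noteq> {}" "card (\<Union>i\<in>J. S i) = card J" by blast
      have finJ: "finite J" using J(1) less.prems(1) by (meson finite_subset psubset_imp_subset)
      have "card J < card I" using J(1) less.prems(1) by (simp add: psubset_card_mono)
      then have "\<exists>f. inj_on f J \<and> (\<forall>i\<in>J. f i \<in> S i)"
        using J(1) finJ finS cond by (intro less.hyps) auto
      then obtain f where f: "inj_on f J" "\<And>i. i \<in> J \<Longrightarrow> f i \<in> S i" by blast
      define U where "U = (\<Union>i\<in>J. S i)"
      have finU: "finite U" unfolding U_def using finJ finS J(1) by auto
      have "card (I - J) < card I"
        using J less.prems(1) by (intro psubset_card_mono) auto
      moreover have "card J' \<le> card (\<Union>i\<in>J'. S i - U)" if J': "J' \<subseteq> I - J" for J'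
      proof -
        have fin': "finite J'" using J' less.prems(1) finite_subset by blast
        have "card J' + card J = card (J' \<union> J)"
          using J' fin' finJ by (subst card_Un_disjoint) auto
        also have "\<dots> \<le> card (\<Union>i\<in>J' \<union> J. S i)" using J J' by (intro cond) auto
        also have "(\<Union>i\<in>J' \<union> J. S i) = (\<Union>i\<in>J'. S i - U) \<union> U" by (auto simp: U_def)
        also have "card \<dots> \<le> card (\<Union>i\<in>J'. S i - U) + card U" by (rule card_Un_le)
        finally show ?thesis using J(3) by (simp add: U_def)
      qed
      ultimately have "\<exists>g. inj_on g (I - J) \<and> (\<forall>i\<in>I - J. g i \<in> S i - U)"
        using less.prems(1) finS by (intro less.hyps) auto
      then obtain g where g: "inj_on g (I - J)" "\<And>i. i \<in> I - J \<Longrightarrow> g i \<in> S i - U" by blast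
      define h where "h i = (if i \<in> J then f i else g i)" for i
      have "inj_on h I"
      proof (rule inj_onI)
        fix i j assume ij: "i \<in> I" "j \<in> I" "h i = h j"
        have fU: "f i \<in> U" if "i \<in> J" for i using f(2) that by (auto simp: U_def)
        consider "i \<in> J" "j \<in> J" | "i \<in> J" "j \<notin> J" | "i \<notin> J" "j \<in> J" | "i \<notin> J" "j \<notin> J"
          by blast
        then show "i = j"
        proof cases
          case 1
          then show ?thesis using ij inj_onD[OF f(1)] by (simp add: h_def)
        next
          case 2
          then have "f i = g j" using ij by (simp add: h_def)
          then show ?thesis using fU[OF 2(1)] g(2)[of j] 2 ij by auto
        next
          case 3
          then have "g i = f j" using ij by (simp add: h_def)
          then show ?thesis using fU[OF 3(2)] g(2)[of i] 3 ij by auto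
        next
          case 4
          then show ?thesis using ij inj_onD[OF g(1)] by (simp add: h_def)
        qed
      qed
      moreover have "\<forall>i\<in>I. h i \<in> S i" using f(2) g(2) by (auto simp: h_def)
      ultimately show ?thesis by blast
    next
      case noJ: False
      obtain i0 where i0: "i0 \<in> I" using False by blast
      have "card {i0} \<le> card (\<Union>i\<in>{i0}. S i)" using i0 by (intro cond) auto
      then have "S i0 \<noteq> {}" by auto
      then obtain a where a: "a \<in> S i0" by blast
      have "card J' \<le> card (\<Union>i\<in>J'. S i - {a})" if J': "J' \<subseteq> I - {i0}" for J'
      proof (cases "J' = {}")
        case False
        have "J' \<subset> I" using J' i0 by auto
        then have "card (\<Union>i\<in>J'. S i) \<noteq> card J'" using noJ False by blast
        moreover have "card J' \<le> card (\<Union>i\<in>J'. S i)" using J' by (intro cond) blast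
        moreover have "(\<Union>i\<in>J'. S i - {a}) = (\<Union>i\<in>J'. S i) - {a}" by auto
        moreover have "finite (\<Union>i\<in>J'. S i)"
        proof (rule finite_UN_I)
          show "finite J'" using J' less.prems(1) finite_subset by blast
          show "finite (S i)" if "i \<in> J'" for i using that J' finS by blast
        qed
        ultimately show ?thesis by (auto simp: card_Diff_singleton_if)
      qed simp
      moreover have "card (I - {i0}) < card I"
        using i0 less.prems(1) by (meson card_Diff1_less)
      ultimately have "\<exists>g. inj_on g (I - {i0}) \<and> (\<forall>i\<in>I - {i0}. g i \<in> S i - {a})"
        using less.prems(1) finS by (intro less.hyps) auto
      then obtain g where g: "inj_on g (I - {i0})" "\<And>i. i \<in> I - {i0} \<Longrightarrow> g i \<in> S i - {a}" by blast
      have "inj_on (g(i0 := a)) I"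
        using g by (auto simp: inj_on_def)
      moreover have "\<forall>i\<in>I. (g(i0 := a)) i \<in> S i" using g a by auto
      ultimately show ?thesis by blast
    qed
  qed
qed

text \<open>Suppose the neighbours of \<open>J\<close> miss some \<open>a\<close>. Then
  \<open>J\<close> consists of non-neighbours of \<open>a\<close> and is smaller than half of
  \<open>A\<close>, while a single member of \<open>J\<close> already has half of \<open>A\<close>
  as neighbours.\<close>

lemma perfect_matching_of_degrees:
  assumes fin: "finite W" "finite A" and card: "card W = card A"
    and W: "\<And>w. w \<in> W \<Longrightarrow> 2 * card {a \<in> A. \<not> R w a} \<le> card A"
    and A: "\<And>a. a \<in> A \<Longrightarrow> 2 * card {w \<in> W. \<not> R w a} < card A"
  shows "\<exists>f. bij_betw f W A \<and> (\<forall>w\<in>W. R w (f w))"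
proof -
  define S where "S w = {a \<in> A. R w a}" for w
  have cS: "card A \<le> 2 * card (S w)" if "w \<in> W" for w
  proof -
    have "card A = card (S w) + card {a \<in> A. \<not> R w a}"
      unfolding S_def using fin by (subst card_Un_disjoint[symmetric]) (auto intro: arg_cong[where f=card])
    then show ?thesis using W[OF that] by simp
  qed
  have "card J \<le> card (\<Union>w\<in>J. S w)" if J: "J \<subseteq> W" for J
  proof (cases "A \<subseteq> (\<Union>w\<in>J. S w)")
    case True
    have "card J \<le> card W" using J fin card_mono by blast
    also have "\<dots> \<le> card (\<Union>w\<in>J. S w)" unfolding card
      using True fin J by (intro card_mono) (auto intro: finite_subset simp: S_def)
    finally show ?thesis .
  next
    case False
    then obtain a where a: "a \<in> A" "a \<notin> (\<Union>w\<in>J. S w)" by blast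
    then have "J \<subseteq> {w \<in> W. \<not> R w a}" using J by (auto simp: S_def)
    then have "card J \<le> card {w \<in> W. \<not> R w a}" using fin by (intro card_mono) auto
    then have J2: "2 * card J < card A" using A[OF a(1)] by simp
    show ?thesis
    proof (cases "J = {}")
      case False
      then obtain w where w: "w \<in> J" by blast
      have "card (S w) \<le> card (\<Union>w\<in>J. S w)"
        using fin J w by (intro card_mono) (auto intro: finite_subset simp: S_def)
      moreover have "card A \<le> 2 * card (S w)" using cS w J by blast
      ultimately show ?thesis using J2 by linarith
    qed simp
  qed
  then obtain f where f: "inj_on f W" "\<forall>w\<in>W. f w \<in> S w"
    using hall[of W S] fin by (auto simp: S_def)
  have "f ` W = A"
    using f fin card by (intro card_subset_eq) (auto simp: S_def card_image)
  then show ?thesis using f by (auto simp: bij_betw_def S_def)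
qed

text \<open>Blocks of size \<open>m\<close> are split off while at least \<open>2 * m\<close>
  elements remain; what is left is the last block. Shifting the old labels by \<open>Suc\<close>
  frees the label 0.\<close>

lemma partition_blocks:
  assumes "finite A" "m > 0" "card A \<ge> m"
  shows "\<exists>blk :: 'a \<Rightarrow> nat. \<forall>a\<in>A. m \<le> card {x \<in> A. blk x = blk a} \<and> card {x \<in> A. blk x = blk a} < 2 * m"
  using assms
proof (induction "card A" arbitrary: A rule: less_induct)
  case less
  show ?case
  proof (cases "card A < 2 * m")
    case True
    then show ?thesis using less.prems by (intro exI[of _ "\<lambda>_. 0"]) auto
  next
    case False
    obtain C where C: "C \<subseteq> A" "card C = m" using less.prems(3) by (meson obtain_subset_with_card_n)
    have finC: "finite C" using C less.prems(1) finite_subset by blast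
    have cd: "card (A - C) = card A - m" using C finC by (simp add: card_Diff_subset)
    have "card (A - C) < card A" "m \<le> card (A - C)" using cd False less.prems by auto
    then have "\<exists>blk :: 'a \<Rightarrow> nat. \<forall>a\<in>A - C. m \<le> card {x \<in> A - C. blk x = blk a} \<and>
        card {x \<in> A - C. blk x = blk a} < 2 * m"
      using less.prems by (intro less.hyps) auto
    then obtain blk :: "'a \<Rightarrow> nat" where blk: "\<forall>a\<in>A - C. m \<le> card {x \<in> A - C. blk x = blk a} \<and>
        card {x \<in> A - C. blk x = blk a} < 2 * m" by blast
    define blk' where "blk' x = (if x \<in> C then 0 else Suc (blk x))" for x
    have "{x \<in> A. blk' x = blk' a} = (if a \<in> C then C else {x \<in> A - C. blk x = blk a})" if "a \<in> A" for a
      using that C(1) by (auto simp: blk'_def)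
    then have "\<forall>a\<in>A. m \<le> card {x \<in> A. blk' x = blk' a} \<and> card {x \<in> A. blk' x = blk' a} < 2 * m"
      using blk C(2) less.prems(2) by auto
    then show ?thesis by blast
  qed
qed

section \<open>Beck's potential for hitting sets\<close>

text \<open>Beck's danger function, with Maker in the role of the player who has to hit every set,
  one element per turn, against bias \<open>q\<close>. A set that is fully blocked but not hit
  weighs 1, so a value below 1 excludes such sets.\<close>

definition potential :: "nat \<Rightarrow> 'i set \<Rightarrow> ('i \<Rightarrow> 'e set) \<Rightarrow> 'e set \<Rightarrow> 'e set \<Rightarrow> real" where
  "potential q I G Mk Bk = (\<Sum>i\<in>{i\<in>I. G i \<inter> Mk = {}}. 2 powr (- real (card (G i - Bk)) / real q))"

text \<open>The chord of the convex function \<open>exp\<close> between 0 and \<open>ln 2\<close>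
  lies above the graph.\<close>

lemma two_powr_le:
  fixes t :: real
  assumes "0 \<le> t" "t \<le> 1"
  shows "2 powr t \<le> 1 + t"
proof -
  have "exp ((1 - t) *\<^sub>R 0 + t *\<^sub>R ln 2) \<le> (1 - t) * exp 0 + t * exp (ln (2 :: real))"
    using assms by (intro convex_onD[OF exp_convex]) auto
  then show ?thesis by (simp add: powr_def)
qed

text \<open>
  Maker's element of maximal danger: the sets through it lose at least as much weight as
  Breaker's \<open>q\<close> elements can restore, by the inequality \<open>2 powr t \<le> 1 + t\<close> on the unit interval.
\<close>

lemma potential_step:
  assumes fin: "finite I" "\<And>i. i \<in> I \<Longrightarrow> finite (G i)" and q: "q > 0"
    and lt: "potential q I G Mk Bk < 1" and i0: "i0 \<in> I" "G i0 \<inter> Mk = {}"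
  shows "\<exists>e. e \<in> (\<Union>i\<in>I. G i) - Mk - Bk \<and>
    (\<forall>Bk'. Bk \<subseteq> Bk' \<longrightarrow> finite (Bk' - Bk) \<longrightarrow> card (Bk' - Bk) \<le> q \<longrightarrow> potential q I G (insert e Mk) Bk' \<le> potential q I G Mk Bk)"
proof -
  define L where "L = {i\<in>I. G i \<inter> Mk = {}}"
  define wt where "wt i = 2 powr (- real (card (G i - Bk)) / real q)" for i
  define \<phi> where "\<phi> e = (\<Sum>i\<in>{i\<in>L. e \<in> G i}. wt i)" for e
  define Fr where "Fr = (\<Union>i\<in>I. G i) - Mk - Bk"
  have finL: "finite L" and finFr: "finite Fr" using fin by (auto simp: L_def Fr_def)
  have wt0: "wt i \<ge> 0" for i by (simp add: wt_def)
  have pot: "potential q I G Mk Bk = (\<Sum>i\<in>L. wt i)" by (simp add: potential_def L_def wt_def)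
  \<comment> \<open>Otherwise the unhit set \<open>G i0\<close> would be fully blocked and weigh 1
    by itself.\<close>
  have "Fr \<noteq> {}"
  proof
    assume "Fr = {}"
    then have "G i0 - Bk = {}" using i0 by (auto simp: Fr_def)
    then have "card (G i0 - Bk) = 0" by (simp only: card.empty)
    then have "wt i0 = 1" by (simp add: wt_def)
    moreover have "wt i0 \<le> (\<Sum>i\<in>L. wt i)"
      using i0 finL wt0 by (intro member_le_sum) (auto simp: L_def)
    ultimately show False using lt pot by simp
  qed
  then have "Max (\<phi> ` Fr) \<in> \<phi> ` Fr" using finFr by (intro Max_in) auto
  then obtain e where e: "e \<in> Fr" "\<phi> e = Max (\<phi> ` Fr)" by auto
  have e_max: "\<phi> y \<le> \<phi> e" if "y \<in> Fr" for y
    unfolding e(2) using finFr that by (intro Max_ge) auto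
  have "potential q I G (insert e Mk) Bk' \<le> potential q I G Mk Bk"
    if Bk': "Bk \<subseteq> Bk'" "finite (Bk' - Bk)" "card (Bk' - Bk) \<le> q" for Bk'
  proof -
    define L' where "L' = {i\<in>L. e \<notin> G i}"
    define Y where "Y = Bk' - Bk"
    have finL': "finite L'" using finL by (simp add: L'_def)
    have "potential q I G (insert e Mk) Bk' = (\<Sum>i\<in>L'. 2 powr (- real (card (G i - Bk')) / real q))"
      unfolding potential_def by (intro sum.cong) (auto simp: L'_def L_def)
    also have "\<dots> \<le> (\<Sum>i\<in>L'. wt i * (1 + real (card (G i \<inter> Y)) / real q))"
    proof (rule sum_mono)
      fix i assume i: "i \<in> L'"
      then have finG: "finite (G i)" using fin by (auto simp: L'_def L_def)
      have "G i - Bk = (G i - Bk') \<union> (G i \<inter> Y)" using Bk'(1) by (auto simp: Y_def)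
      then have "card (G i - Bk) = card (G i - Bk') + card (G i \<inter> Y)"
        using finG by (auto simp: Y_def intro: card_Un_disjoint)
      then have "- real (card (G i - Bk')) / real q
          = - real (card (G i - Bk)) / real q + real (card (G i \<inter> Y)) / real q"
        by (simp add: add_divide_distrib[symmetric])
      then have "2 powr (- real (card (G i - Bk')) / real q) = wt i * 2 powr (real (card (G i \<inter> Y)) / real q)"
        by (simp only: powr_add wt_def)
      also have "\<dots> \<le> wt i * (1 + real (card (G i \<inter> Y)) / real q)"
      proof (intro mult_left_mono two_powr_le)
        have "card (G i \<inter> Y) \<le> card Y" using Bk'(2) by (intro card_mono) (auto simp: Y_def)
        then show "real (card (G i \<inter> Y)) / real q \<le> 1" using Bk'(3) q by (simp add: Y_def)
      qed (auto simp: wt0)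
      finally show "2 powr (- real (card (G i - Bk')) / real q) \<le> wt i * (1 + real (card (G i \<inter> Y)) / real q)" .
    qed
    also have "\<dots> = (\<Sum>i\<in>L'. wt i) + (\<Sum>i\<in>L'. wt i * real (card (G i \<inter> Y))) / real q"
      by (simp add: distrib_left sum.distrib sum_divide_distrib)
    \<comment> \<open>Double counting: the gain is a sum of dangers \<open>\<phi> y\<close> over
      Breaker's new elements, each at most \<open>\<phi> e\<close>, and \<open>\<phi> e\<close> is
      exactly the weight that Maker removes.\<close>
    also have "(\<Sum>i\<in>L'. wt i * real (card (G i \<inter> Y))) \<le> real q * \<phi> e"
    proof -
      have "(\<Sum>i\<in>L'. wt i * real (card (G i \<inter> Y))) \<le> (\<Sum>i\<in>L. wt i * real (card (G i \<inter> Y)))"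
        using finL wt0 by (intro sum_mono2) (auto simp: L'_def)
      also have "\<dots> = (\<Sum>i\<in>L. \<Sum>y\<in>Y. if y \<in> G i then wt i else 0)"
      proof (rule sum.cong)
        fix i
        have "(\<Sum>y\<in>Y. if y \<in> G i then wt i else 0) = (\<Sum>y\<in>Y \<inter> G i. wt i)"
          using Bk'(2) by (subst sum.inter_restrict) (auto simp: Y_def)
        then show "wt i * real (card (G i \<inter> Y)) = (\<Sum>y\<in>Y. if y \<in> G i then wt i else 0)"
          by (simp add: Int_commute mult.commute)
      qed simp
      also have "\<dots> = (\<Sum>y\<in>Y. \<phi> y)"
        unfolding \<phi>_def using finL by (subst sum.swap) (simp add: sum.inter_filter)
      also have "\<dots> \<le> (\<Sum>y\<in>Y. \<phi> e)"
      proof (rule sum_mono)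
        fix y assume y: "y \<in> Y"
        show "\<phi> y \<le> \<phi> e"
        proof (cases "y \<in> Fr")
          case True
          then show ?thesis by (rule e_max)
        next
          case False
          \<comment> \<open>Such a \<open>y\<close> lies in no set at all or belongs to Maker, and
            the sets indexed by \<open>L\<close> avoid his elements.\<close>
          then have "{i\<in>L. y \<in> G i} = {}" using y by (auto simp: Fr_def L_def Y_def)
          then have "\<phi> y = 0" unfolding \<phi>_def by (simp only: sum.empty)
          then show ?thesis using wt0 by (simp add: \<phi>_def sum_nonneg)
        qed
      qed
      also have "\<dots> \<le> real q * \<phi> e"
        using Bk'(3) wt0 by (simp add: Y_def \<phi>_def sum_nonneg mult_right_mono)
      finally show ?thesis .
    qed
    then have "(\<Sum>i\<in>L'. wt i) + (\<Sum>i\<in>L'. wt i * real (card (G i \<inter> Y))) / real q \<le> (\<Sum>i\<in>L'. wt i) + \<phi> e"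
      using q by (simp add: divide_le_eq mult.commute)
    also have "\<dots> = (\<Sum>i\<in>L. wt i)"
      unfolding \<phi>_def L'_def using finL
      by (subst sum.union_disjoint[symmetric]) (auto intro: sum.cong)
    finally show ?thesis using pot by simp
  qed
  then show ?thesis using e(1) unfolding Fr_def by blast
qed

section \<open>Total weight of the obstructions to Hall's condition\<close>

lemma binomial_le_power: "n choose r \<le> n ^ r"
  by (cases "r \<le> n") (auto intro: binomial_le_pow simp: binomial_eq_0)

text \<open>By the symmetry of binomial coefficients, both are at most \<open>\<mu> ^ s\<close> for
  \<open>s\<close> the smaller of the two sizes, while the product of the sizes is at least
  \<open>s * \<mu> / 2\<close>. So the term is at most the \<open>s\<close>-th power of the bound,
  which is at most 1.\<close>

lemma binomials_weight_le:
  fixes \<mu> x q :: nat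
  assumes x: "1 \<le> x" "x \<le> \<mu>" and q: "q > 0"
    and small: "real \<mu> ^ 2 * 2 powr (- real \<mu> / (2 * real q)) \<le> 1"
  shows "real (\<mu> choose x) * real (\<mu> choose (\<mu> + 1 - x)) * 2 powr (- real (x * (\<mu> + 1 - x)) / real q)
    \<le> real \<mu> ^ 2 * 2 powr (- real \<mu> / (2 * real q))"
proof -
  define s where "s = min x (\<mu> + 1 - x)"
  have s: "1 \<le> s" "s \<le> \<mu>" using x by (auto simp: s_def)
  have mono: "\<mu> ^ a \<le> \<mu> ^ b" if "a \<le> b" for a b using that x by (intro power_increasing) auto
  have b1: "\<mu> choose x \<le> \<mu> ^ s"
  proof (cases "x \<le> \<mu> + 1 - x")
    case True
    then show ?thesis using binomial_le_power by (simp add: s_def)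
  next
    case False
    have "\<mu> choose x = \<mu> choose (\<mu> - x)" using x by (intro binomial_symmetric) auto
    also have "\<dots> \<le> \<mu> ^ (\<mu> - x)" by (rule binomial_le_power)
    also have "\<dots> \<le> \<mu> ^ s" using False by (intro mono) (auto simp: s_def)
    finally show ?thesis .
  qed
  have b2: "\<mu> choose (\<mu> + 1 - x) \<le> \<mu> ^ s"
  proof (cases "x \<le> \<mu> + 1 - x")
    case False
    then show ?thesis using binomial_le_power by (simp add: s_def min_def)
  next
    case True
    have "\<mu> choose (\<mu> + 1 - x) = \<mu> choose (\<mu> - (\<mu> + 1 - x))" using x by (intro binomial_symmetric) auto
    also have "\<dots> \<le> \<mu> ^ (\<mu> - (\<mu> + 1 - x))" by (rule binomial_le_power)
    also have "\<dots> \<le> \<mu> ^ s" using True x by (intro mono) (auto simp: s_def)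
    finally show ?thesis .
  qed
  have ex: "real (x * (\<mu> + 1 - x)) \<ge> real s * (real \<mu> / 2)"
  proof -
    have "x * (\<mu> + 1 - x) = s * (\<mu> + 1 - s)" using x by (auto simp: s_def min_def)
    moreover have "2 * (\<mu> + 1 - s) \<ge> \<mu>" using x by (auto simp: s_def)
    then have "2 * (s * (\<mu> + 1 - s)) \<ge> s * \<mu>" by (metis mult.left_commute mult_le_mono2)
    ultimately have "s * \<mu> \<le> 2 * (x * (\<mu> + 1 - x))" by simp
    then have "real (s * \<mu>) \<le> real (2 * (x * (\<mu> + 1 - x)))" by (rule of_nat_mono)
    then show ?thesis by simp
  qed
  have "real (\<mu> choose x) * real (\<mu> choose (\<mu> + 1 - x)) \<le> real (\<mu> ^ s) * real (\<mu> ^ s)"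
    using b1 b2 by (intro mult_mono) auto
  also have "\<dots> = (real \<mu> ^ 2) ^ s" by (simp add: power_mult_distrib power2_eq_square)
  finally have f1: "real (\<mu> choose x) * real (\<mu> choose (\<mu> + 1 - x)) \<le> (real \<mu> ^ 2) ^ s" .
  have "2 powr (- real (x * (\<mu> + 1 - x)) / real q) \<le> 2 powr (real s * (- real \<mu> / (2 * real q)))"
  proof -
    have "- real (x * (\<mu> + 1 - x)) / real q \<le> - (real s * (real \<mu> / 2)) / real q"
      using ex q by (intro divide_right_mono) auto
    also have "\<dots> = real s * (- real \<mu> / (2 * real q))" by simp
    finally show ?thesis by simp
  qed
  also have "\<dots> = (2 powr (- real \<mu> / (2 * real q))) ^ s"
    by (simp add: powr_realpow[symmetric] powr_powr mult.commute)
  finally have f2: "2 powr (- real (x * (\<mu> + 1 - x)) / real q) \<le> (2 powr (- real \<mu> / (2 * real q))) ^ s" .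
  have "real (\<mu> choose x) * real (\<mu> choose (\<mu> + 1 - x)) * 2 powr (- real (x * (\<mu> + 1 - x)) / real q)
    \<le> (real \<mu> ^ 2) ^ s * (2 powr (- real \<mu> / (2 * real q))) ^ s"
    using f1 f2 by (intro mult_mono) auto
  also have "\<dots> = (real \<mu> ^ 2 * 2 powr (- real \<mu> / (2 * real q))) ^ s" by (simp only: power_mult_distrib)
  also have "\<dots> \<le> (real \<mu> ^ 2 * 2 powr (- real \<mu> / (2 * real q))) ^ 1"
    using s small by (intro power_decreasing) auto
  finally show ?thesis by simp
qed

text \<open>For \<open>U\<close> and \<open>Z\<close> of equal size, a relation that meets
  \<open>X \<times> Y\<close> for all these pairs satisfies Hall's condition: a set \<open>X\<close>
  with fewer than \<open>card X\<close> partners leaves at least \<open>card Z + 1 - card X\<close>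
  elements of \<open>Z\<close> that are unrelated to it, enough for a \<open>Y\<close>.\<close>

definition obstructions :: "'a set \<Rightarrow> 'b set \<Rightarrow> ('a set \<times> 'b set) set" where
  "obstructions U Z = {(X, Y). X \<subseteq> U \<and> Y \<subseteq> Z \<and> X \<noteq> {} \<and> card X + card Y = card Z + 1}"

lemma finite_obstructions: "finite U \<Longrightarrow> finite Z \<Longrightarrow> finite (obstructions U Z)"
  unfolding obstructions_def by (rule finite_subset[of _ "Pow U \<times> Pow Z"]) auto

text \<open>Sort the pairs by \<open>card X\<close>, which ranges from 1 to \<open>\<mu>\<close>;
  the pairs of each size together weigh at most the bound of
  \<open>binomials_weight_le\<close>.\<close>

lemma obstructions_weight_le:
  assumes fin: "finite U" "finite Z" and card: "card U = \<mu>" "card Z = \<mu>" and q: "q > 0"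
    and small: "real \<mu> ^ 2 * 2 powr (- real \<mu> / (2 * real q)) \<le> 1"
  shows "(\<Sum>(X, Y)\<in>obstructions U Z. 2 powr (- real (card (X \<times> Y)) / real q))
    \<le> real \<mu> * (real \<mu> ^ 2 * 2 powr (- real \<mu> / (2 * real q)))"
proof -
  define T where "T x = {X. X \<subseteq> U \<and> card X = x} \<times> {Y. Y \<subseteq> Z \<and> card Y = \<mu> + 1 - x}" for x
  have finT: "finite (T x)" for x using fin by (simp add: T_def)
  have ob: "obstructions U Z = (\<Union>x\<in>{1..\<mu>}. T x)"
  proof (intro set_eqI iffI)
    fix p assume "p \<in> obstructions U Z"
    then obtain X Y where p: "p = (X, Y)" "X \<subseteq> U" "Y \<subseteq> Z" "X \<noteq> {}" "card X + card Y = card Z + 1"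
      by (auto simp: obstructions_def)
    have "finite X" using p fin finite_subset by blast
    then have "card X \<noteq> 0" using p(4) by simp
    moreover have "card X \<le> \<mu>" using card_mono[OF fin(1) p(2)] card by simp
    ultimately show "p \<in> (\<Union>x\<in>{1..\<mu>}. T x)" using p card by (auto simp: T_def intro!: bexI[of _ "card X"])
  next
    fix p assume "p \<in> (\<Union>x\<in>{1..\<mu>}. T x)"
    then show "p \<in> obstructions U Z" using card by (auto simp: T_def obstructions_def)
  qed
  have "(\<Sum>(X, Y)\<in>obstructions U Z. 2 powr (- real (card (X \<times> Y)) / real q))
    = (\<Sum>x\<in>{1..\<mu>}. \<Sum>(X, Y)\<in>T x. 2 powr (- real (card (X \<times> Y)) / real q))"
    unfolding ob using finT by (intro sum.UNION_disjoint) (auto simp: T_def)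
  also have "\<dots> = (\<Sum>x\<in>{1..\<mu>}. real (\<mu> choose x) * real (\<mu> choose (\<mu> + 1 - x)) * 2 powr (- real (x * (\<mu> + 1 - x)) / real q))"
  proof (rule sum.cong)
    fix x assume "x \<in> {1..\<mu>}"
    have "(\<Sum>(X, Y)\<in>T x. 2 powr (- real (card (X \<times> Y)) / real q)) = (\<Sum>(X, Y)\<in>T x. 2 powr (- real (x * (\<mu> + 1 - x)) / real q))"
      by (intro sum.cong) (auto simp: T_def card_cartesian_product)
    also have "\<dots> = real (card (T x)) * 2 powr (- real (x * (\<mu> + 1 - x)) / real q)"
      by (simp add: case_prod_unfold)
    also have "card (T x) = (\<mu> choose x) * (\<mu> choose (\<mu> + 1 - x))"
      unfolding T_def card_cartesian_product using n_subsets[OF fin(1)] n_subsets[OF fin(2)] card by simp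
    finally show "(\<Sum>(X, Y)\<in>T x. 2 powr (- real (card (X \<times> Y)) / real q)) =
      real (\<mu> choose x) * real (\<mu> choose (\<mu> + 1 - x)) * 2 powr (- real (x * (\<mu> + 1 - x)) / real q)" by simp
  qed simp
  also have "\<dots> \<le> (\<Sum>x\<in>{1..\<mu>}. real \<mu> ^ 2 * 2 powr (- real \<mu> / (2 * real q)))"
    using q small by (intro sum_mono binomials_weight_le) auto
  finally show ?thesis by simp
qed

section \<open>Rooted trees\<close>

text \<open>The rank \<open>h\<close> only serves to make the parent relation well-founded.\<close>

locale rooted_tree =
  fixes V :: "'v set" and E :: "'v set set" and root :: 'v and par :: "'v \<Rightarrow> 'v" and h :: "'v \<Rightarrow> nat"
  assumes finV: "finite V" and rootV: "root \<in> V"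
    and parV: "r \<in> V \<Longrightarrow> r \<noteq> root \<Longrightarrow> par r \<in> V"
    and par_less: "r \<in> V \<Longrightarrow> r \<noteq> root \<Longrightarrow> h (par r) < h r"
    and E_eq: "E = (\<lambda>r. {r, par r}) ` (V - {root})"
begin

definition ch :: "'v \<Rightarrow> 'v set" where
  "ch r = {r' \<in> V - {root}. par r' = r}"

lemma ch_iff: "r' \<in> ch r \<longleftrightarrow> r' \<in> V \<and> r' \<noteq> root \<and> par r' = r"
  by (auto simp: ch_def)

lemma ch_subset: "ch r \<subseteq> V"
  by (auto simp: ch_def)

lemma fin_ch: "finite (ch r)"
  using finV by (simp add: ch_def)

lemma card_ch_le: "card (ch r) \<le> degree E r"
proof -
  have "inj_on (\<lambda>r'. {r', r}) (ch r)" by (auto simp: inj_on_def doubleton_eq_iff)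
  then have "card (ch r) = card ((\<lambda>r'. {r', r}) ` ch r)" by (simp add: card_image)
  also have "\<dots> \<le> card {e \<in> E. r \<in> e}"
    using finV by (intro card_mono) (auto simp: E_eq ch_def)
  finally show ?thesis by (simp add: degree_def)
qed

lemma sum_card_ch: "(\<Sum>r\<in>V. card (ch r)) = card V - 1"
proof -
  have "(\<Sum>r\<in>V. card (ch r)) = card (\<Union>r\<in>V. ch r)"
    using finV fin_ch by (intro card_UN_disjoint[symmetric]) (auto simp: ch_iff)
  also have "(\<Union>r\<in>V. ch r) = V - {root}" using parV by (fastforce simp: ch_iff)
  finally show ?thesis using finV rootV by simp
qed

text \<open>The numbers of children add up to less than \<open>card V\<close>, so on average a
  vertex has less than one child, and the vertices with two or more are at most as many as the
  leaves.\<close>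

lemma card_not_one_child: "card {r \<in> V. card (ch r) \<noteq> 1} \<le> 2 * card {r \<in> V. ch r = {}}"
proof -
  define L where "L = {r \<in> V. ch r = {}}"
  define O1 where "O1 = {r \<in> V. card (ch r) = 1}"
  define O2 where "O2 = {r \<in> V. card (ch r) \<ge> 2}"
  have fin: "finite L" "finite O1" "finite O2" using finV by (auto simp: L_def O1_def O2_def)
  have cz: "card (ch r) = 0 \<longleftrightarrow> ch r = {}" for r using fin_ch by simp
  have ge: "card (ch r) \<ge> 2 \<longleftrightarrow> card (ch r) \<noteq> 0 \<and> card (ch r) \<noteq> 1" for r by linarith
  have un: "V = L \<union> O1 \<union> O2" unfolding L_def O1_def O2_def cz[symmetric] ge by auto
  have dj: "L \<inter> O1 = {}" "(L \<union> O1) \<inter> O2 = {}"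
    unfolding L_def O1_def O2_def cz[symmetric] by auto
  have cV: "card V = card L + card O1 + card O2"
    using un dj fin by (metis card_Un_disjoint finite_UnI)
  have "card O1 + 2 * card O2 \<le> (\<Sum>r\<in>O1. card (ch r)) + (\<Sum>r\<in>O2. card (ch r))"
    using sum_bounded_below[of O2 2 "\<lambda>r. card (ch r)"] by (simp add: O1_def O2_def)
  also have "\<dots> \<le> (\<Sum>r\<in>V. card (ch r))"
    using fin dj un finV by (subst sum.union_disjoint[symmetric]) (auto intro!: sum_mono2)
  also have "\<dots> \<le> card V" using sum_card_ch by simp
  finally have "card O2 \<le> card L" using cV by simp
  moreover have "{r \<in> V. card (ch r) \<noteq> 1} = L \<union> O2"
    unfolding L_def O2_def cz[symmetric] ge by auto
  ultimately show ?thesis using card_Un_le[of L O2] unfolding L_def by simp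
qed

text \<open>
  The vertices of the tree are called roles, to distinguish them from the vertices of the board that play
  them. The role \<open>ro j 1\<close> of a chain is the one that will be left open.
\<close>

definition gadget_chains :: "nat \<Rightarrow> 'v set \<Rightarrow> ('v \<Rightarrow> nat \<Rightarrow> 'v) \<Rightarrow> bool" where
  "gadget_chains k J ro \<longleftrightarrow> J \<subseteq> V - {root} \<and> (\<forall>j\<in>J. ro j 0 = j \<and> (\<forall>i. Suc i < k \<longrightarrow> ro j (Suc i) \<in> ch (ro j i)))
     \<and> (\<forall>j\<in>J. \<forall>j'\<in>J. \<forall>i<k. \<forall>i'<k. ro j i = ro j' i' \<longrightarrow> j = j' \<and> i = i')"

text \<open>Each parent of a leaf is the top of a gadget, with one of its leaves as hole, and
  accounts for at most \<Delta> leaves. The two ones pay for the root, which may be a parent of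
  leaves that is dropped from \<open>J\<close>, or be a leaf itself.\<close>

lemma leaf_gadgets:
  assumes D: "\<And>r. r \<in> V \<Longrightarrow> card (ch r) \<le> \<Delta>"
  shows "\<exists>J ro. gadget_chains 2 J ro \<and> (\<forall>j\<in>J. ch (ro j 1) = {}) \<and>
    card {r \<in> V. ch r = {}} \<le> \<Delta> * (card J + 1) + 1"
proof -
  define L where "L = {r \<in> V. ch r = {}}"
  define P where "P = par ` (L - {root})"
  define J where "J = P - {root}"
  define ro where "ro j i = (if i = 0 then j else (SOME l. l \<in> L \<inter> ch j))" for j :: 'v and i :: nat
  have finL: "finite L" using finV by (simp add: L_def)
  have finP: "finite P" using finL by (simp add: P_def)
  have ro1: "ro j 1 \<in> L \<inter> ch j" if "j \<in> J" for j
  proof -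
    have "\<exists>l. l \<in> L \<inter> ch j" using that by (auto simp: J_def P_def ch_iff L_def)
    then have "(SOME l. l \<in> L \<inter> ch j) \<in> L \<inter> ch j" by (rule someI_ex)
    then show ?thesis unfolding ro_def by simp
  qed
  have JL: "j \<notin> L" if "j \<in> J" for j using ro1[OF that] by (auto simp: L_def)
  have "gadget_chains 2 J ro"
    unfolding gadget_chains_def
  proof (intro conjI ballI allI impI)
    show "J \<subseteq> V - {root}" using parV by (auto simp: J_def P_def L_def)
    fix j assume j: "j \<in> J"
    show "ro j 0 = j" by (simp add: ro_def)
    show "ro j (Suc i) \<in> ch (ro j i)" if "Suc i < 2" for i
      using that ro1[OF j] by (simp add: ro_def)
    fix j' i i' assume j': "j' \<in> J" and i: "i < (2::nat)" "i' < (2::nat)" and eq: "ro j i = ro j' i'"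
    have r0: "ro j 0 = j" "ro j' 0 = j'" by (auto simp: ro_def)
    note r1 = ro1[OF j] ro1[OF j']
    have ne: "j \<noteq> ro j' 1" "ro j 1 \<noteq> j'" using r1 JL[OF j] JL[OF j'] by auto
    have p1: "par (ro j 1) = j" "par (ro j' 1) = j'" using r1 by (auto simp: ch_iff)
    consider "i = 0" "i' = 0" | "i = 0" "i' = 1" | "i = 1" "i' = 0" | "i = 1" "i' = 1"
      using i by linarith
    then have "j = j' \<and> i = i'"
    proof cases
      case 1
      then show ?thesis using eq r0 by simp
    next
      case 2
      then show ?thesis using eq r0 ne by simp
    next
      case 3
      then show ?thesis using eq r0 ne by simp
    next
      case 4
      then have "ro j 1 = ro j' 1" using eq by simp
      then have "j = j'" using p1 by metis
      then show ?thesis using 4 by simp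
    qed
    then show "j = j'" "i = i'" by auto
  qed
  moreover have "\<forall>j\<in>J. ch (ro j 1) = {}" using ro1 by (auto simp: L_def)
  moreover have "card L \<le> \<Delta> * (card J + 1) + 1"
  proof -
    have "L - {root} \<subseteq> (\<Union>p\<in>P. ch p)" by (auto simp: P_def ch_iff L_def)
    then have "card (L - {root}) \<le> card (\<Union>p\<in>P. ch p)"
      using finP fin_ch by (intro card_mono) auto
    also have "\<dots> \<le> (\<Sum>p\<in>P. card (ch p))" using finP by (rule card_UN_le)
    also have "\<dots> \<le> card P * \<Delta>"
      using sum_bounded_above[of P "\<lambda>p. card (ch p)" \<Delta>] D parV by (auto simp: P_def L_def)
    also have "card P \<le> card J + 1" unfolding J_def using finP
      by (auto simp: card_Diff_singleton_if)
    finally have "card (L - {root}) \<le> \<Delta> * (card J + 1)" by (simp add: mult.commute)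
    then show ?thesis using finL by (simp add: card_Diff_singleton_if split: if_splits)
  qed
  ultimately show ?thesis unfolding L_def by blast
qed

text \<open>Here \<open>nx\<close> walks down while there is exactly one child, and
  \<open>ds\<close> is the distance to the next vertex of \<open>X\<close>, a leaf or a branching.
  Cut where \<open>k\<close> divides \<open>ds\<close>. A cut outside \<open>X\<close> has at least
  \<open>k\<close> single-child vertices from itself downwards and is the top of a chain; the cuts
  in \<open>X\<close> are few by \<open>card_not_one_child\<close>.\<close>

lemma path_gadgets:
  assumes k: "k > 0"
  shows "\<exists>J ro. gadget_chains k J ro \<and> (\<forall>j\<in>J. \<forall>i. Suc i < k \<longrightarrow> ch (ro j i) = {ro j (Suc i)}) \<and>
    card V \<le> k * (card J + 1 + 2 * card {r \<in> V. ch r = {}})"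
proof -
  define X where "X = {r \<in> V. card (ch r) \<noteq> 1}"
  define nx where "nx r = (THE c. ch r = {c})" for r
  have nx: "ch r = {nx r}" if "r \<in> V" "r \<notin> X" for r
  proof -
    have "\<exists>c. ch r = {c}" using that by (auto simp: X_def card_1_singleton_iff)
    then show ?thesis unfolding nx_def by auto
  qed
  have nx': "nx r \<in> V" "par (nx r) = r" "nx r \<noteq> root" "h r < h (nx r)" if "r \<in> V" "r \<notin> X" for r
  proof -
    have "nx r \<in> ch r" using nx[OF that] by simp
    then show "nx r \<in> V" "par (nx r) = r" "nx r \<noteq> root" "h r < h (nx r)"
      using par_less[of "nx r"] by (auto simp: ch_iff)
  qed
  have ex: "\<exists>i. (nx ^^ i) r \<in> X" if "r \<in> V" for r
    using that
  proof (induction "Max (h ` V) - h r" arbitrary: r rule: less_induct)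
    case less
    show ?case
    proof (cases "r \<in> X")
      case True
      then show ?thesis by (intro exI[of _ 0]) simp
    next
      case False
      note n = nx'[OF less.prems False]
      have "h (nx r) \<le> Max (h ` V)" using finV n(1) by simp
      then obtain i where "(nx ^^ i) (nx r) \<in> X"
        using less.hyps[of "nx r"] n by (meson diff_less_mono2 less_le_trans)
      then have "(nx ^^ Suc i) r \<in> X" by (simp add: funpow_Suc_right del: funpow.simps)
      then show ?thesis by blast
    qed
  qed
  define ds where "ds r = (LEAST i. (nx ^^ i) r \<in> X)" for r
  have ds_in: "(nx ^^ ds r) r \<in> X" if "r \<in> V" for r
    unfolding ds_def using ex[OF that] by (rule LeastI_ex)
  have ds_not: "(nx ^^ i) r \<notin> X" if "i < ds r" for r i
    using that not_less_Least unfolding ds_def by blast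
  have it: "(nx ^^ i) r \<in> V \<and> (par ^^ i) ((nx ^^ i) r) = r \<and> ds ((nx ^^ i) r) = ds r - i"
    if "r \<in> V" "i \<le> ds r" for r i
    using that(2)
  proof (induction i)
    case 0
    then show ?case using that(1) by simp
  next
    case (Suc i)
    then have IH: "(nx ^^ i) r \<in> V" "(par ^^ i) ((nx ^^ i) r) = r" "ds ((nx ^^ i) r) = ds r - i" by auto
    have nX: "(nx ^^ i) r \<notin> X" using ds_not Suc.prems by simp
    note n = nx'[OF IH(1) nX]
    have "ds ((nx ^^ Suc i) r) = ds r - Suc i"
      unfolding ds_def[of "(nx ^^ Suc i) r"]
    proof (rule Least_equality)
      show "(nx ^^ (ds r - Suc i)) ((nx ^^ Suc i) r) \<in> X"
        using ds_in[OF that(1)] Suc.prems unfolding comp_apply[symmetric, of "nx ^^ _" "nx ^^ _"] funpow_add[symmetric]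
        by simp
      fix y assume "(nx ^^ y) ((nx ^^ Suc i) r) \<in> X"
      then have "(nx ^^ (y + Suc i)) r \<in> X" by (simp only: funpow_add comp_apply)
      then show "ds r - Suc i \<le> y" using ds_not[of "y + Suc i" r] by linarith
    qed
    moreover have "(par ^^ Suc i) ((nx ^^ Suc i) r) = r"
      using IH(2) n(2) by (simp add: funpow_swap1)
    ultimately show ?case using n(1) by simp
  qed
  define Z where "Z = {r \<in> V. ds r mod k = 0}"
  define T where "T = {r \<in> Z. ds r \<noteq> 0}"
  have ds0: "ds r = 0 \<longleftrightarrow> r \<in> X" if "r \<in> V" for r
    using ds_in[OF that] ds_not[of 0 r] by auto
  have finZ: "finite Z" and finT: "finite T" and finX: "finite X"
    using finV by (auto simp: Z_def T_def X_def)
  \<comment> \<open>A vertex is determined by the first cut below it and the distance to that cut,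
    since \<open>par\<close> undoes \<open>nx\<close>.\<close>
  have "card V \<le> card (Z \<times> {..<k})"
  proof (rule card_inj_on_le)
    show "inj_on (\<lambda>r. ((nx ^^ (ds r mod k)) r, ds r mod k)) V"
    proof (rule inj_onI)
      fix r s assume rs: "r \<in> V" "s \<in> V" "((nx ^^ (ds r mod k)) r, ds r mod k) = ((nx ^^ (ds s mod k)) s, ds s mod k)"
      have "(par ^^ (ds r mod k)) ((nx ^^ (ds r mod k)) r) = r" using it rs(1) by simp
      moreover have "(par ^^ (ds s mod k)) ((nx ^^ (ds s mod k)) s) = s" using it rs(2) by simp
      ultimately show "r = s" using rs(3) unfolding prod.inject by metis
    qed
    show "(\<lambda>r. ((nx ^^ (ds r mod k)) r, ds r mod k)) ` V \<subseteq> Z \<times> {..<k}"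
      using it k by (auto simp: Z_def minus_mod_eq_mult_div)
  qed (use finZ in auto)
  then have cV: "card V \<le> k * card Z" by (simp add: card_cartesian_product mult.commute)
  have "Z \<subseteq> T \<union> X" using ds0 by (auto simp: Z_def T_def)
  then have cZ: "card Z \<le> card T + card X"
    using finT finX by (meson card_Un_le card_mono finite_UnI le_trans)
  define J where "J = T - {root}"
  define ro where "ro j i = (nx ^^ i) j" for j i
  have dsk: "ds j \<ge> k" "ds j mod k = 0" "j \<in> V" if "j \<in> J" for j
    using that by (auto simp: J_def T_def Z_def)
  have st: "ch (ro j i) = {ro j (Suc i)}" if "j \<in> J" "Suc i < k" for j i
    using nx[of "(nx ^^ i) j"] it[of j i] ds_not[of i j] dsk[OF that(1)] that(2) by (auto simp: ro_def)
  have "gadget_chains k J ro"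
    unfolding gadget_chains_def
  proof (intro conjI ballI allI impI)
    show "J \<subseteq> V - {root}" by (auto simp: J_def T_def Z_def)
    fix j assume j: "j \<in> J"
    show "ro j 0 = j" by (simp add: ro_def)
    show "ro j (Suc i) \<in> ch (ro j i)" if "Suc i < k" for i using st[OF j that] by simp
    fix j' i i' assume j': "j' \<in> J" and i: "i < k" "i' < k" and eq: "ro j i = ro j' i'"
    have e1: "ds (ro j i) = ds j - i" "(par ^^ i) (ro j i) = j"
      using it[of j i] dsk[OF j] i by (auto simp: ro_def)
    have e2: "ds (ro j' i') = ds j' - i'" "(par ^^ i') (ro j' i') = j'"
      using it[of j' i'] dsk[OF j'] i by (auto simp: ro_def)
    \<comment> \<open>Along a chain \<open>ds\<close> drops by one per step, so its residue modulo
      \<open>k\<close> reveals the index, and \<open>par\<close> then leads back to the top.\<close>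
    have "ds j - i = ds j' - i'" using e1 e2 eq by simp
    then have "ds j + i' = ds j' + i" using dsk[OF j] dsk[OF j'] i by linarith
    then have "(ds j + i') mod k = (ds j' + i) mod k" by simp
    moreover have "(ds j + i') mod k = i'"
      using i(2) dsk(2)[OF j] mod_add_left_eq[of "ds j" k i'] by (simp only: add_0 mod_less)
    moreover have "(ds j' + i) mod k = i"
      using i(1) dsk(2)[OF j'] mod_add_left_eq[of "ds j'" k i] by (simp only: add_0 mod_less)
    ultimately have ii: "i = i'" by (simp only:)
    then show "i = i'" .
    have "j = (par ^^ i) (ro j i)" using e1(2) by (simp only:)
    also have "\<dots> = (par ^^ i') (ro j' i')" using eq ii by (simp only:)
    also have "\<dots> = j'" by (rule e2(2))
    finally show "j = j'" .
  qed
  moreover have "card V \<le> k * (card J + 1 + 2 * card {r \<in> V. ch r = {}})"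
  proof -
    have "card T \<le> card J + 1" unfolding J_def using finT by (auto simp: card_Diff_singleton_if)
    then have "card Z \<le> card J + 1 + 2 * card {r \<in> V. ch r = {}}"
      using cZ card_not_one_child unfolding X_def by linarith
    then show ?thesis using cV by (meson le_trans mult_le_mono2)
  qed
  ultimately show ?thesis using st by blast
qed

end

section \<open>Rooting a connected acyclic graph\<close>

definition path_in :: "'v set set \<Rightarrow> 'v set \<Rightarrow> 'v list \<Rightarrow> bool" where
  "path_in E S p \<longleftrightarrow> p \<noteq> [] \<and> distinct p \<and> set p \<subseteq> S \<and> (\<forall>i. Suc i < length p \<longrightarrow> {p ! i, p ! Suc i} \<in> E)"

text \<open>The rooted tree grows by one vertex at a time, together with paths joining any two
  vertices inside it. Connectivity provides an edge that leaves the current set, and the absence of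
  cycles makes it the only one to the new vertex.\<close>

lemma rooted_treeI_tree_graph:
  assumes T: "tree_graph V E"
  shows "\<exists>root par h. rooted_tree V E root par (h :: 'v \<Rightarrow> nat)"
proof -
  have fV: "finite V" and EV: "E \<subseteq> complete_edges V" and con: "connected_graph V E"
    and acyc: "\<And>c. \<not> is_cycle E c"
    using T by (auto simp: tree_graph_def simple_graph_def)
  obtain root where root: "root \<in> V" using con by (auto simp: connected_graph_def)
  have edge: "\<exists>u v. e = {u, v} \<and> u \<noteq> v \<and> u \<in> V \<and> v \<in> V" if "e \<in> E" for e
  proof -
    have "e \<subseteq> V" "card e = 2" using that EV by (auto simp: complete_edges_def)
    then obtain u v where "e = {u, v}" "u \<noteq> v" by (meson card_2_iff)
    then show ?thesis using \<open>e \<subseteq> V\<close> by blast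
  qed
  have "\<exists>S par h. card S = Suc k \<and> S \<subseteq> V \<and> rooted_tree S {e \<in> E. e \<subseteq> S} root par (h :: 'v \<Rightarrow> nat) \<and>
      (\<forall>x\<in>S. \<forall>y\<in>S. \<exists>p. path_in E S p \<and> hd p = x \<and> last p = y)" if "Suc k \<le> card V" for k
    using that
  proof (induction k)
    case 0
    have "rooted_tree {root} {e \<in> E. e \<subseteq> {root}} root id (\<lambda>_. 0)"
      by unfold_locales (use edge in \<open>auto simp: subset_singleton_iff dest!: edge\<close>)
    moreover have "path_in E {root} [root]" by (simp add: path_in_def)
    ultimately show ?case using root
      by (intro exI[of _ "{root}"] exI[of _ "id :: 'v \<Rightarrow> 'v"] exI[of _ "\<lambda>_. 0"]) (auto intro!: exI[of _ "[root]"] simp del: id_apply)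
  next
    case (Suc k)
    then obtain S par and h :: "'v \<Rightarrow> nat" where S: "card S = Suc k" "S \<subseteq> V"
      and rt: "rooted_tree S {e \<in> E. e \<subseteq> S} root par h"
      and pth: "\<And>x y. x \<in> S \<Longrightarrow> y \<in> S \<Longrightarrow> \<exists>p. path_in E S p \<and> hd p = x \<and> last p = y" by auto
    interpret S: rooted_tree S "{e \<in> E. e \<subseteq> S}" root par h by (rule rt)
    have "S \<noteq> V" using S Suc.prems by auto
    then obtain z where z: "z \<in> V" "z \<notin> S" using S(2) by auto
    have "(root, z) \<in> {(x, y). {x, y} \<in> E}\<^sup>*" using con root z by (auto simp: connected_graph_def)
    then have "z \<in> S \<or> (\<exists>x y. x \<in> S \<and> y \<notin> S \<and> {x, y} \<in> E)"
    proof (induction rule: rtrancl_induct)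
      case base
      then show ?case using S.rootV by simp
    qed auto
    then obtain x y where xy: "x \<in> S" "y \<notin> S" "{x, y} \<in> E" using z by blast
    have yV: "y \<in> V" using edge[OF xy(3)] by (metis insertCI doubleton_eq_iff)
    \<comment> \<open>A second neighbour \<open>x'\<close> would close a cycle: the path from
      \<open>x\<close> to \<open>x'\<close> inside \<open>S\<close>, followed by
      \<open>y\<close>.\<close>
    have uniq: "x' = x" if x': "x' \<in> S" "{x', y} \<in> E" for x'
    proof (rule ccontr)
      assume "x' \<noteq> x"
      obtain p where p: "path_in E S p" "hd p = x" "last p = x'" using pth xy x' by blast
      have pne: "p \<noteq> []" using p by (simp add: path_in_def)
      have len: "length p \<ge> 2"
      proof (rule ccontr)
        assume "\<not> length p \<ge> 2"
        then have "length p = 1" using pne length_greater_0_conv[of p] by linarith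
        then have "hd p = last p" by (cases p) auto
        then show False using p \<open>x' \<noteq> x\<close> by simp
      qed
      have "is_cycle E (p @ [y])"
        unfolding is_cycle_def
      proof (intro conjI allI impI)
        show "3 \<le> length (p @ [y])" using len by simp
        show "distinct (p @ [y])" using p xy by (auto simp: path_in_def)
        fix i assume i: "i < length (p @ [y])"
        consider "Suc i < length p" | "Suc i = length p" | "i = length p" using i by fastforce
        then show "{(p @ [y]) ! i, (p @ [y]) ! (Suc i mod length (p @ [y]))} \<in> E"
        proof cases
          case 1
          then show ?thesis using p by (auto simp: path_in_def nth_append)
        next
          case 2
          then have "i = length p - 1" by simp
          then have "(p @ [y]) ! i = x'" using 2 p pne by (simp add: nth_append last_conv_nth)
          then show ?thesis using 2 x' by (simp add: nth_append)
        next
          case 3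
          then have "(p @ [y]) ! (Suc i mod length (p @ [y])) = x"
            using p pne by (simp add: nth_append hd_conv_nth)
          then show ?thesis using 3 xy by (simp add: insert_commute)
        qed
      qed
      then show False using acyc by blast
    qed
    define par' where "par' = par(y := x)"
    define h' where "h' = h(y := Suc (h x))"
    have yr: "y \<noteq> root" using xy S.rootV by auto
    have eqE: "{e \<in> E. e \<subseteq> insert y S} = insert {y, x} {e \<in> E. e \<subseteq> S}"
    proof (intro set_eqI iffI)
      fix e assume e: "e \<in> {e \<in> E. e \<subseteq> insert y S}"
      show "e \<in> insert {y, x} {e \<in> E. e \<subseteq> S}"
      proof (cases "y \<in> e")
        case True
        then obtain x' where x': "e = {x', y}" "x' \<noteq> y"
          using edge[of e] e by (metis (no_types, lifting) doubleton_eq_iff insertE mem_Collect_eq singletonD)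
        then have "x' \<in> S" using e by auto
        then have "x' = x" using uniq x' e by auto
        then show ?thesis using x' by (simp add: insert_commute)
      qed (use e in auto)
    qed (use xy in \<open>auto simp: insert_commute\<close>)
    have "rooted_tree (insert y S) {e \<in> E. e \<subseteq> insert y S} root par' h'"
    proof
      show "finite (insert y S)" using S.finV by simp
      show "root \<in> insert y S" using S.rootV by simp
      show "par' r \<in> insert y S" if "r \<in> insert y S" "r \<noteq> root" for r
        using that S.parV xy by (auto simp: par'_def)
      show "h' (par' r) < h' r" if "r \<in> insert y S" "r \<noteq> root" for r
      proof (cases "r = y")
        case True
        then show ?thesis using xy by (auto simp: par'_def h'_def)
      next
        case False
        then show ?thesis using that S.parV[of r] S.par_less[of r] xy by (auto simp: par'_def h'_def)
      qed
      have "{e \<in> E. e \<subseteq> S} = (\<lambda>r. {r, par r}) ` (S - {root})" by (rule S.E_eq)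
      also have "\<dots> = (\<lambda>r. {r, par' r}) ` (S - {root})" using xy by (intro image_cong) (auto simp: par'_def)
      finally show "{e \<in> E. e \<subseteq> insert y S} = (\<lambda>r. {r, par' r}) ` (insert y S - {root})"
        using eqE xy yr by (auto simp: par'_def insert_Diff_if)
    qed
    moreover have "\<exists>p. path_in E (insert y S) p \<and> hd p = u \<and> last p = v"
      if uv: "u \<in> insert y S" "v \<in> insert y S" for u v
    proof -
      have mono: "path_in E (insert y S) p" if "path_in E S p" for p
        using that by (auto simp: path_in_def)
      consider "u = y" "v = y" | "u = y" "v \<in> S" | "u \<in> S" "v = y" | "u \<in> S" "v \<in> S" using uv by blast
      then show ?thesis
      proof cases
        case 1
        then show ?thesis by (intro exI[of _ "[y]"]) (simp add: path_in_def)
      next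
        case 2
        obtain p where p: "path_in E S p" "hd p = x" "last p = v" using pth xy 2 by blast
        have "path_in E (insert y S) (y # p)"
          unfolding path_in_def
        proof (intro conjI allI impI)
          fix i assume "Suc i < length (y # p)"
          then show "{(y # p) ! i, (y # p) ! Suc i} \<in> E"
            using p xy by (cases i) (auto simp: path_in_def hd_conv_nth insert_commute)
        qed (use p xy in \<open>auto simp: path_in_def\<close>)
        then show ?thesis using 2 p by (intro exI[of _ "y # p"]) (auto simp: path_in_def)
      next
        case 3
        obtain p where p: "path_in E S p" "hd p = u" "last p = x" using pth xy 3 by blast
        have "path_in E (insert y S) (p @ [y])"
          unfolding path_in_def
        proof (intro conjI allI impI)
          fix i assume i: "Suc i < length (p @ [y])"
          show "{(p @ [y]) ! i, (p @ [y]) ! Suc i} \<in> E"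
          proof (cases "Suc i < length p")
            case True
            then show ?thesis using p by (auto simp: path_in_def nth_append)
          next
            case False
            then have "Suc i = length p" using i by simp
            moreover from this have "i = length p - 1" by simp
            ultimately have "(p @ [y]) ! i = x" "(p @ [y]) ! Suc i = y"
              using p by (auto simp: nth_append last_conv_nth path_in_def)
            then show ?thesis using xy by simp
          qed
        qed (use p xy in \<open>auto simp: path_in_def\<close>)
        then show ?thesis using 3 p by (intro exI[of _ "p @ [y]"]) (auto simp: path_in_def)
      next
        case 4
        then show ?thesis using pth mono by blast
      qed
    qed
    moreover have "card (insert y S) = Suc (Suc k)" using S xy S.finV by simp
    moreover have "insert y S \<subseteq> V" using S yV by simp
    ultimately show ?case by blast
  qed
  moreover have "card V > 0" using fV root card_gt_0_iff by blast
  ultimately obtain S par and h :: "'v \<Rightarrow> nat" where S: "card S = card V" "S \<subseteq> V" "rooted_tree S {e \<in> E. e \<subseteq> S} root par h"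
    by (metis Suc_pred le_refl)
  have "S = V" using S fV card_subset_eq by blast
  moreover have "{e \<in> E. e \<subseteq> V} = E" using EV by (auto simp: complete_edges_def)
  ultimately show ?thesis using S(3) by auto
qed

section \<open>Building gadgets\<close>

lemma edge_in_complete: "{u, v} \<in> complete_edges V \<longleftrightarrow> u \<in> V \<and> v \<in> V \<and> u \<noteq> v"
  by (auto simp: complete_edges_def card_insert_if)

lemma finite_complete_edges: "finite V \<Longrightarrow> finite (complete_edges V)"
  unfolding complete_edges_def by (rule finite_subset[of _ "Pow V"]) auto

lemma card_nbs_le: "finite B \<Longrightarrow> finite {u. {u, v} \<in> B} \<and> card {u. {u, v} \<in> B} \<le> degree B v"
proof -
  assume fin: "finite B"
  have inj: "inj_on (\<lambda>u. {u, v}) {u. {u, v} \<in> B}" by (auto simp: inj_on_def doubleton_eq_iff)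
  have sub: "(\<lambda>u. {u, v}) ` {u. {u, v} \<in> B} \<subseteq> {e \<in> B. v \<in> e}" by auto
  have fin2: "finite {e \<in> B. v \<in> e}" using fin by simp
  show ?thesis
    unfolding degree_def using card_inj_on_le[OF inj sub fin2] inj_on_finite[OF inj sub fin2] by blast
qed

lemma exists_nonadjacent:
  assumes "finite B" "finite Z" "finite X" and d: "\<And>z. z \<in> Z \<Longrightarrow> degree B z \<le> d"
    and c: "card Z * d + card X < card F"
  shows "\<exists>u\<in>F - X. \<forall>z\<in>Z. {u, z} \<notin> B"
proof (rule ccontr)
  assume "\<not> ?thesis"
  then have "\<And>u. u \<in> F \<Longrightarrow> u \<notin> X \<Longrightarrow> \<exists>z\<in>Z. {u, z} \<in> B" by blast
  then have sub: "F \<subseteq> (\<Union>z\<in>Z. {u. {u, z} \<in> B}) \<union> X" by blast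
  have fin: "finite (\<Union>z\<in>Z. {u. {u, z} \<in> B})"
    using assms(2) card_nbs_le[OF assms(1)] by (intro finite_UN_I) auto
  have "card F \<le> card ((\<Union>z\<in>Z. {u. {u, z} \<in> B}) \<union> X)" using sub fin assms by (intro card_mono) auto
  also have "\<dots> \<le> card (\<Union>z\<in>Z. {u. {u, z} \<in> B}) + card X" by (rule card_Un_le)
  also have "card (\<Union>z\<in>Z. {u. {u, z} \<in> B}) \<le> (\<Sum>z\<in>Z. card {u. {u, z} \<in> B})"
    using assms(2) by (rule card_UN_le)
  also have "\<dots> \<le> (\<Sum>z\<in>Z. d)"
    using card_nbs_le[OF assms(1)] d by (intro sum_mono) (meson le_trans)
  finally show False using c by simp
qed

section \<open>Short forced connections\<close>

locale clique_game = game "complete_edges {..<n}" b for n b :: nat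
begin

lemma adv_degree:
  assumes "adv i M B M' B'"
  shows "degree B' v \<le> degree B v + b * i"
proof -
  have fin: "finite B'" using assms adv_pos pos_finite by blast
  have "B' = B \<union> (B' - B)" using assms by (auto simp: adv_def)
  then have "{e \<in> B'. v \<in> e} \<subseteq> {e \<in> B. v \<in> e} \<union> (B' - B)" by auto
  moreover have "finite B" using assms fin by (auto simp: adv_def intro: finite_subset)
  ultimately have "degree B' v \<le> card ({e \<in> B. v \<in> e} \<union> (B' - B))"
    unfolding degree_def using fin by (intro card_mono) auto
  also have "\<dots> \<le> degree B v + card (B' - B)" unfolding degree_def by (rule card_Un_le)
  also have "\<dots> \<le> degree B v + b * i" using assms by (simp add: adv_def)
  finally show ?thesis .
qed

lemma force_adv_trans:
  assumes "force (\<lambda>M' B'. adv i M B M' B' \<and> P M' B') M B"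
    and "\<And>M' B'. adv i M B M' B' \<Longrightarrow> P M' B' \<Longrightarrow>
      force (\<lambda>M'' B''. adv j M' B' M'' B'' \<and> P' M'' B'') M' B'"
    and "i + j \<le> l"
  shows "force (\<lambda>M'' B''. adv l M B M'' B'' \<and> P' M'' B'') M B"
proof (rule force_trans[OF assms(1)])
  fix M1 B1 assume 1: "adv i M B M1 B1 \<and> P M1 B1"
  then have "force (\<lambda>M'' B''. adv j M1 B1 M'' B'' \<and> P' M'' B'') M1 B1" using assms(2) by blast
  then show "force (\<lambda>M'' B''. adv l M B M'' B'' \<and> P' M'' B'') M1 B1"
    by (rule force_mono) (use 1 assms(3) adv_trans adv_weaken in blast)
qed

lemma claim_nonadjacent:
  assumes p: "pos M B" and u: "u < n" and F: "F \<subseteq> {..<n}" "u \<notin> F" and X: "finite X"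
    and c: "degree B u + card X < card F"
  shows "force (\<lambda>M' B'. adv 1 M B M' B' \<and> (\<exists>v\<in>F - X. {u, v} \<in> M')) M B"
proof -
  have "\<exists>v\<in>F - X. \<forall>z\<in>{u}. {v, z} \<notin> B"
    using pos_finite[OF p] X c by (intro exists_nonadjacent[where d = "degree B u"]) auto
  then obtain v where v: "v \<in> F - X" "{u, v} \<notin> B" by (auto simp: insert_commute)
  have "force (\<lambda>M' B'. adv 1 M B M' B' \<and> {u, v} \<in> M') M B"
    using v p u F by (intro force_claim) (auto simp: edge_in_complete)
  then show ?thesis by (rule force_mono) (use v in blast)
qed

text \<open>Breaker raises the degree of the centre by at most \<open>b\<close> per move and
  \<open>e\<close> leaves are taken, so a free choice remains throughout.\<close>

lemma claim_star:
  assumes p: "pos M B" and u: "u < n" and F: "F \<subseteq> {..<n}" "u \<notin> F"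
    and c: "degree B u + b * e + e < card F"
  shows "force (\<lambda>M' B'. adv e M B M' B' \<and> (\<exists>Z\<subseteq>F. card Z = e \<and> (\<forall>z\<in>Z. {u, z} \<in> M'))) M B"
  using c
proof (induction e)
  case 0
  then show ?case using adv_refl[OF p] by (intro force.stop) (auto intro!: exI[of _ "{}"])
next
  case (Suc e)
  then have IH: "force (\<lambda>M' B'. adv e M B M' B' \<and> (\<exists>Z\<subseteq>F. card Z = e \<and> (\<forall>z\<in>Z. {u, z} \<in> M'))) M B"
    by simp
  have finF: "finite F" using F finite_subset by blast
  show ?case
  proof (rule force_adv_trans[OF IH, where j = 1])
    fix M' B' assume a: "adv e M B M' B'" and "\<exists>Z\<subseteq>F. card Z = e \<and> (\<forall>z\<in>Z. {u, z} \<in> M')"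
    then obtain Z where Z: "Z \<subseteq> F" "card Z = e" "\<forall>z\<in>Z. {u, z} \<in> M'" by blast
    have finZ: "finite Z" using Z finF finite_subset by blast
    have "degree B' u + card Z < card F"
      using Suc.prems adv_degree[OF a, of u] Z(2) by simp
    then have "force (\<lambda>M'' B''. adv 1 M' B' M'' B'' \<and> (\<exists>v\<in>F - Z. {u, v} \<in> M'')) M' B'"
      using u F finZ adv_pos[OF a] by (intro claim_nonadjacent) auto
    then show "force (\<lambda>M'' B''. adv 1 M' B' M'' B'' \<and> (\<exists>Z\<subseteq>F. card Z = Suc e \<and> (\<forall>z\<in>Z. {u, z} \<in> M''))) M' B'"
    proof (rule force_mono)
      fix M'' B'' assume "adv 1 M' B' M'' B'' \<and> (\<exists>v\<in>F - Z. {u, v} \<in> M'')"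
      then obtain v where v: "adv 1 M' B' M'' B''" "v \<in> F - Z" "{u, v} \<in> M''" by blast
      have "insert v Z \<subseteq> F \<and> card (insert v Z) = Suc e \<and> (\<forall>z\<in>insert v Z. {u, z} \<in> M'')"
        using v Z finZ adv_subset[OF v(1)] by auto
      then show "adv 1 M' B' M'' B'' \<and> (\<exists>Z\<subseteq>F. card Z = Suc e \<and> (\<forall>z\<in>Z. {u, z} \<in> M''))"
        using v(1) by blast
    qed
  qed simp
qed

text \<open>
  Breaker cannot separate \<open>u\<close> from a set \<open>Z\<close> of more than \<open>b\<close> vertices of low degree: Maker passes
  through a vertex that has no Breaker edge to \<open>Z\<close>.
\<close>

lemma claim_via:
  assumes p: "pos M B" and u: "u < n" and F: "F \<subseteq> {..<n}" "u \<notin> F" and X: "finite X"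
    and Z: "Z \<subseteq> {..<n}" "Z \<inter> F \<subseteq> X" "card Z > b"
    and d: "\<And>z. z \<in> insert u Z \<Longrightarrow> degree B z \<le> d"
    and c: "(card Z + 1) * d + card X < card F"
  shows "force (\<lambda>M' B'. adv 2 M B M' B' \<and> (\<exists>a\<in>F - X. \<exists>z\<in>Z. {u, a} \<in> M' \<and> {a, z} \<in> M')) M B"
proof -
  have finZ: "finite Z" using Z(1) finite_subset by blast
  have "card (insert u Z) \<le> card Z + 1" using finZ by (simp add: card_insert_if)
  then have "card (insert u Z) * d \<le> (card Z + 1) * d" by (rule mult_le_mono1)
  then have "card (insert u Z) * d + card X < card F" using c by linarith
  then have "\<exists>a\<in>F - X. \<forall>z\<in>insert u Z. {a, z} \<notin> B"
    using pos_finite[OF p] X d finZ by (intro exists_nonadjacent[where d = d]) auto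
  then obtain a where a: "a \<in> F - X" "\<And>z. z \<in> insert u Z \<Longrightarrow> {a, z} \<notin> B" by blast
  have "{u, a} \<notin> B" using a(2)[of u] by (simp add: insert_commute)
  then have "force (\<lambda>M' B'. adv 1 M B M' B' \<and> {u, a} \<in> M') M B"
    using a p u F by (intro force_claim) (auto simp: edge_in_complete)
  then show ?thesis
  proof (rule force_adv_trans[where j = 1])
    fix M' B' assume adv: "adv 1 M B M' B'" and ua: "{u, a} \<in> M'"
    \<comment> \<open>All edges from \<open>a\<close> to \<open>Z\<close> were unblocked, and the
      one reply in between covers at most \<open>b < card Z\<close> of them.\<close>
    have "\<exists>z\<in>Z. {a, z} \<notin> B'"
    proof (rule ccontr)
      assume "\<not> ?thesis"
      then have "(\<lambda>z. {a, z}) ` Z \<subseteq> B' - B" using a(2) by auto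
      moreover have "inj_on (\<lambda>z. {a, z}) Z" by (auto simp: inj_on_def doubleton_eq_iff)
      moreover have "finite (B' - B)" using pos_finite[OF adv_pos[OF adv]] by simp
      ultimately have "card Z \<le> card (B' - B)" using card_inj_on_le by blast
      then show False using adv Z(3) by (simp add: adv_def)
    qed
    then obtain z where z: "z \<in> Z" "{a, z} \<notin> B'" by blast
    have "{a, z} \<in> complete_edges {..<n}" using z a F Z by (auto simp: edge_in_complete)
    then have "force (\<lambda>M'' B''. adv 1 M' B' M'' B'' \<and> {a, z} \<in> M'') M' B'"
      using z adv_pos[OF adv] by (intro force_claim)
    then show "force (\<lambda>M'' B''. adv 1 M' B' M'' B'' \<and> (\<exists>a\<in>F - X. \<exists>z\<in>Z. {u, a} \<in> M'' \<and> {a, z} \<in> M'')) M' B'"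
      by (rule force_mono) (use a z ua in \<open>auto simp: adv_def\<close>)
  qed simp
qed

text \<open>
  A gadget is a sequence \<open>g\<close> of vertices with a hole at index 1. A new vertex \<open>w\<close> that gets joined to
  \<open>x\<close> and then to one of the vertices in \<open>Y\<close> completes it to a sequence of adjacent vertices, without
  moving the two ends.
\<close>

definition completion :: "nat \<Rightarrow> (nat \<Rightarrow> nat) \<Rightarrow> nat \<Rightarrow> nat set set \<Rightarrow> (nat \<Rightarrow> nat) \<Rightarrow> bool" where
  "completion k g w M f \<longleftrightarrow> inj_on f {..<k} \<and> f ` {..<k} = insert w (g ` ({..<k} - {1})) \<and>
     (\<forall>t\<in>{0, k - 1} - {1}. f t = g t) \<and> (\<forall>t. Suc t < k \<longrightarrow> {f t, f (Suc t)} \<in> M)"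

definition gadget :: "nat \<Rightarrow> (nat \<Rightarrow> nat) \<Rightarrow> nat set set \<Rightarrow> bool" where
  "gadget k g M \<longleftrightarrow> (\<exists>x Y. x \<in> g ` ({..<k} - {1}) \<and> Y \<subseteq> g ` ({..<k} - {1}) \<and> (x \<in> Y \<or> card Y > b) \<and>
     (\<forall>w y M'. w \<notin> g ` ({..<k} - {1}) \<longrightarrow> y \<in> Y \<longrightarrow> M \<subseteq> M' \<longrightarrow> {w, x} \<in> M' \<longrightarrow> {w, y} \<in> M' \<longrightarrow>
        (\<exists>f. completion k g w M' f)))"

lemma completion_mono: "completion k g w M f \<Longrightarrow> M \<subseteq> M' \<Longrightarrow> completion k g w M' f"
  unfolding completion_def by blast

lemma gadget_mono: "gadget k g M \<Longrightarrow> M \<subseteq> M' \<Longrightarrow> gadget k g M'"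
  unfolding gadget_def by (meson order_trans)

lemma image_g_cong: "(\<And>t. t < k \<Longrightarrow> t \<noteq> 1 \<Longrightarrow> g t = g' t) \<Longrightarrow> g ` ({..<k} - {1}) = g' ` ({..<k} - {1})"
  by (rule image_cong) auto

lemma completion_cong:
  assumes "k > 0" "\<And>t. t < k \<Longrightarrow> t \<noteq> 1 \<Longrightarrow> g t = g' t"
  shows "completion k g w M f \<longleftrightarrow> completion k g' w M f"
proof -
  have im: "g ` ({..<k} - {1}) = g' ` ({..<k} - {1})" using assms(2) by (rule image_g_cong)
  have "\<And>t. t \<in> {0, k - 1} - {1} \<Longrightarrow> g t = g' t" using assms by auto
  then have "(\<forall>t\<in>{0, k - 1} - {1}. f t = g t) \<longleftrightarrow> (\<forall>t\<in>{0, k - 1} - {1}. f t = g' t)"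
    by (intro ball_cong refl) (simp only:)
  then show ?thesis unfolding completion_def im by (simp only:)
qed

lemma gadget_cong:
  assumes "k > 0" "\<And>t. t < k \<Longrightarrow> t \<noteq> 1 \<Longrightarrow> g t = g' t"
  shows "gadget k g M \<longleftrightarrow> gadget k g' M"
proof -
  have im: "g ` ({..<k} - {1}) = g' ` ({..<k} - {1})" using assms(2) by (rule image_g_cong)
  have c: "completion k g = completion k g'" using completion_cong[OF assms] by (intro ext)
  show ?thesis unfolding gadget_def im c ..
qed

text \<open>The edge to \<open>x\<close> is claimed first. If \<open>x\<close> lies in
  \<open>Y\<close>, this is enough; if not, the reply blocks at most \<open>b\<close> of the more
  than \<open>b\<close> edges from \<open>w\<close> to \<open>Y\<close>.\<close>

lemma fill_gadget:
  assumes p: "pos M B" and g: "gadget k g M" "g ` ({..<k} - {1}) \<subseteq> {..<n}"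
    and w: "w < n" "w \<notin> g ` ({..<k} - {1})" "\<And>v. v \<in> g ` ({..<k} - {1}) \<Longrightarrow> {w, v} \<notin> B"
  shows "force (\<lambda>M' B'. adv 2 M B M' B' \<and> (\<exists>f. completion k g w M' f)) M B"
proof -
  define S where "S = g ` ({..<k} - {1})"
  obtain x Y where x: "x \<in> S" and Y: "Y \<subseteq> S" "x \<in> Y \<or> card Y > b"
    and cmp: "\<And>y M'. y \<in> Y \<Longrightarrow> M \<subseteq> M' \<Longrightarrow> {w, x} \<in> M' \<Longrightarrow> {w, y} \<in> M' \<Longrightarrow> \<exists>f. completion k g w M' f"
  proof -
    from g(1) obtain x Y where "x \<in> S" "Y \<subseteq> S" "x \<in> Y \<or> card Y > b"
      and *: "\<forall>w y M'. w \<notin> S \<longrightarrow> y \<in> Y \<longrightarrow> M \<subseteq> M' \<longrightarrow> {w, x} \<in> M' \<longrightarrow> {w, y} \<in> M' \<longrightarrow>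
        (\<exists>f. completion k g w M' f)"
      unfolding gadget_def S_def[symmetric] by (elim exE conjE)
    moreover have "w \<notin> S" using w(2) by (simp add: S_def)
    ultimately show ?thesis using that by (meson *)
  qed
  have edge: "{w, v} \<in> complete_edges {..<n}" if "v \<in> S" for v
    using that g w by (auto simp: edge_in_complete S_def)
  have "force (\<lambda>M' B'. adv 1 M B M' B' \<and> {w, x} \<in> M') M B"
    using p edge x w(3) by (intro force_claim) (auto simp: S_def)
  then show ?thesis
  proof (rule force_adv_trans[where j = 1])
    fix M' B' assume adv: "adv 1 M B M' B'" and wx: "{w, x} \<in> M'"
    show "force (\<lambda>M'' B''. adv 1 M' B' M'' B'' \<and> (\<exists>f. completion k g w M'' f)) M' B'"
    proof (cases "x \<in> Y")
      case True
      then show ?thesis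
        using cmp[OF True adv_subset[OF adv] wx wx] adv_refl[OF adv_pos[OF adv]] by (intro force.stop) auto
    next
      case False
      have "\<exists>y\<in>Y. {w, y} \<notin> B'"
      proof (rule ccontr)
        assume "\<not> ?thesis"
        then have "(\<lambda>y. {w, y}) ` Y \<subseteq> B' - B"
          using w(3) Y(1) unfolding S_def by (intro image_subsetI) blast
        moreover have "inj_on (\<lambda>y. {w, y}) Y" by (auto simp: inj_on_def doubleton_eq_iff)
        moreover have "finite (B' - B)" using pos_finite[OF adv_pos[OF adv]] by simp
        ultimately have "card Y \<le> card (B' - B)" using card_inj_on_le by blast
        then show False using adv Y(2) False by (simp add: adv_def)
      qed
      then obtain y where y: "y \<in> Y" "{w, y} \<notin> B'" by blast
      have "force (\<lambda>M'' B''. adv 1 M' B' M'' B'' \<and> {w, y} \<in> M'') M' B'"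
        using y Y edge adv_pos[OF adv] by (intro force_claim) auto
      then show ?thesis
      proof (rule force_mono)
        fix M'' B'' assume *: "adv 1 M' B' M'' B'' \<and> {w, y} \<in> M''"
        then have "M' \<subseteq> M''" by (simp add: adv_def)
        then show "adv 1 M' B' M'' B'' \<and> (\<exists>f. completion k g w M'' f)"
          using cmp[OF y(1), of M''] * adv_subset[OF adv] wx by blast
      qed
    qed
  qed simp
qed

text \<open>The hole is the leaf itself, so the edge from \<open>w\<close> to its neighbour
  \<open>g 0\<close> completes everything: \<open>g 0\<close> serves as \<open>x\<close> and as the
  only element of \<open>Y\<close>.\<close>

lemma gadget_two: "gadget 2 g M"
proof -
  have S: "g ` ({..<2} - {1}) = {g 0}" by (auto simp: lessThan_nat_numeral lessThan_Suc)
  show ?thesis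
    unfolding gadget_def S
  proof (intro exI[of _ "g 0"] exI[of _ "{g 0}"] conjI allI impI)
    fix w y M' assume *: "w \<notin> {g 0}" "y \<in> {g 0}" "M \<subseteq> M'" "{w, g 0} \<in> M'" "{w, y} \<in> M'"
    have "completion 2 g w M' (\<lambda>t. if t = 0 then g 0 else w)"
      unfolding completion_def S
      using * by (auto simp: inj_on_def insert_commute lessThan_nat_numeral lessThan_Suc less_2_cases_iff)
    then show "\<exists>f. completion 2 g w M' f" by blast
  qed auto
qed

text \<open>
  The path gadget is a path \<open>x, s, y\<^sub>1, z\<^sub>1, \<dots>, y\<^sub>d, z\<^sub>d\<close> with chords from \<open>s\<close> to all \<open>z\<^sub>i\<close>. It absorbs \<open>w\<close>
  as \<open>x, w, y\<^sub>i, z\<^sub>i\<^sub>-\<^sub>1, \<dots>, y\<^sub>1, s, z\<^sub>i, y\<^sub>i\<^sub>+\<^sub>1, \<dots>, z\<^sub>d\<close>.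
\<close>

definition spine :: "nat set set \<Rightarrow> nat list \<Rightarrow> bool" where
  "spine M p \<longleftrightarrow> (\<forall>i. Suc i < length p \<longrightarrow> {p ! i, p ! Suc i} \<in> M) \<and> (\<forall>i>0. 2 * i < length p \<longrightarrow> {p ! 0, p ! (2 * i)} \<in> M)"

text \<open>In the indices of \<open>g\<close>, the first vertex \<open>x\<close> has index 0,
  \<open>s\<close> has index 2, the \<open>i\<close>-th \<open>y\<close> has index
  \<open>2 * i + 1\<close> and the \<open>i\<close>-th \<open>z\<close> has index
  \<open>2 * i + 2\<close>. The length \<open>2 * b + 3\<close> of the spine provides
  \<open>b + 1\<close> entry points, one more than Breaker can block.\<close>

lemma gadget_spine:
  assumes p: "spine M p" "length p = 2 * b + 3" "distinct (x # p)" and x: "{x, p ! 0} \<in> M"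
    and g: "\<And>t. t < 2 * b + 5 \<Longrightarrow> t \<noteq> 1 \<Longrightarrow> g t = (if t = 0 then x else p ! (t - 2))"
  shows "gadget (2 * b + 5) g M"
proof -
  define k where "k = 2 * b + 5"
  have gx: "g 0 = x" using g[of 0] by simp
  have gp: "g t = p ! (t - 2)" if "2 \<le> t" "t < k" for t using g[of t] that by (simp add: k_def)
  have injg: "inj_on g ({..<k} - {1})"
  proof (rule inj_onI)
    fix s t assume st: "s \<in> {..<k} - {1}" "t \<in> {..<k} - {1}" "g s = g t"
    have xp: "x \<noteq> p ! i" if "i < length p" for i using p(3) that by auto
    consider "s = 0" "t = 0" | "s = 0" "t \<ge> 2" | "s \<ge> 2" "t = 0" | "s \<ge> 2" "t \<ge> 2" using st by fastforce
    then show "s = t"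
    proof cases
      case 1 then show ?thesis by simp
    next
      case 2
      then have "t - 2 < length p" using st p(2) unfolding k_def by simp
      then show ?thesis using 2 st gx gp[of t] xp[of "t - 2"] by simp
    next
      case 3
      then have "s - 2 < length p" using st p(2) unfolding k_def by simp
      then show ?thesis using 3 st gx gp[of s] xp[of "s - 2"] by simp
    next
      case 4
      then have "p ! (s - 2) = p ! (t - 2)" using st gp[of s] gp[of t] by simp
      moreover have "s - 2 < length p" "t - 2 < length p" using st 4 p(2) by (auto simp: k_def)
      ultimately have "s - 2 = t - 2" using p(3) nth_eq_iff_index_eq[of p] by simp
      then show ?thesis using 4 by simp
    qed
  qed
  define S where "S = g ` ({..<k} - {1})"
  define Y where "Y = (\<lambda>i. g (2 * i + 1)) ` {1..b + 1}"
  have path: "{g t, g (Suc t)} \<in> M" if "2 \<le> t" "Suc t < k" for t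
  proof -
    have "{p ! (t - 2), p ! Suc (t - 2)} \<in> M" using p(1,2) that by (simp add: spine_def k_def)
    moreover have "Suc (t - 2) = Suc t - 2" using that by linarith
    ultimately show ?thesis using gp[of t] gp[of "Suc t"] that by simp
  qed
  have chord: "{g 2, g (2 * i + 2)} \<in> M" if "0 < i" "2 * i + 2 < k" for i
  proof -
    have "{p ! 0, p ! (2 * i)} \<in> M" using p(1,2) that by (simp add: spine_def k_def)
    then show ?thesis using gp[of 2] gp[of "2 * i + 2"] that by simp
  qed
  have "inj_on (\<lambda>i. g (2 * i + 1)) {1..b + 1}"
  proof (rule inj_onI)
    fix i j assume ij: "i \<in> {1..b + 1}" "j \<in> {1..b + 1}" "g (2 * i + 1) = g (2 * j + 1)"
    have mem: "2 * i + 1 \<in> {..<k} - {1}" if "i \<in> {1..b + 1}" for i using that by (auto simp: k_def)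
    have "2 * i + 1 = 2 * j + 1" by (rule inj_onD[OF injg ij(3) mem[OF ij(1)] mem[OF ij(2)]])
    then show "i = j" by simp
  qed
  then have cY: "card Y > b" by (simp add: Y_def card_image)
  show ?thesis
    unfolding gadget_def k_def[symmetric]
  proof (intro exI[of _ x] exI[of _ Y] conjI allI impI)
    show "x \<in> g ` ({..<k} - {1})" using gx by (force simp: k_def)
    show "Y \<subseteq> g ` ({..<k} - {1})" by (force simp: Y_def k_def)
    show "x \<in> Y \<or> b < card Y" using cY by simp
    fix w y M' assume w: "w \<notin> g ` ({..<k} - {1})" and y: "y \<in> Y" and MM: "M \<subseteq> M'"
      and wx: "{w, x} \<in> M'" and wy: "{w, y} \<in> M'"
    obtain i where i: "1 \<le> i" "i \<le> b + 1" "y = g (2 * i + 1)" using y by (auto simp: Y_def)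
    \<comment> \<open>Reversing the segment from 2 to \<open>2 * i + 1\<close> puts \<open>y\<close>
      right after \<open>w\<close> and \<open>s\<close> right before the \<open>i\<close>-th
      \<open>z\<close>, where the chord takes over. The last index lies beyond the segment and stays
      fixed.\<close>
    define \<pi> where "\<pi> t = (if 2 \<le> t \<and> t \<le> 2 * i + 1 then 2 * i + 3 - t else t)" for t
    define f where "f t = (if t = 1 then w else g (\<pi> t))" for t
    have \<pi>: "\<pi> t \<in> {..<k} - {1}" "\<pi> (\<pi> t) = t" if "t \<in> {..<k} - {1}" for t
      using that i by (auto simp: \<pi>_def k_def)
    have im: "\<pi> ` ({..<k} - {1}) = {..<k} - {1}"
      using \<pi> by (metis (no_types, lifting) image_subset_iff subsetI subset_antisym imageI)
    have k1: "1 < k" by (simp add: k_def)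
    have fim: "f ` {..<k} = insert w (g ` ({..<k} - {1}))"
    proof -
      have "f ` {..<k} = insert (f 1) (f ` ({..<k} - {1}))" using k1 by auto
      also have "f ` ({..<k} - {1}) = g ` \<pi> ` ({..<k} - {1})" by (auto simp: f_def image_image)
      finally show ?thesis using im by (simp add: f_def)
    qed
    have "card (f ` {..<k}) = k"
      using fim w injg k1 by (simp add: card_image card_insert_if)
    then have "inj_on f {..<k}" by (simp add: eq_card_imp_inj_on)
    moreover have "f t = g t" if "t \<in> {0, k - 1} - {1}" for t
      using that i by (auto simp: f_def \<pi>_def k_def)
    moreover have "{f t, f (Suc t)} \<in> M'" if t: "Suc t < k" for t
    proof -
      consider "t = 0" | "t = 1" | "2 \<le> t" "t < 2 * i + 1" | "t = 2 * i + 1" | "t > 2 * i + 1" by linarith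
      then show ?thesis
      proof cases
        case 1
        have "f t = x" "f (Suc t) = w" using 1 gx i by (simp_all add: f_def \<pi>_def)
        then show ?thesis using wx by (simp add: insert_commute)
      next
        case 2
        have "f (Suc t) = g (2 * i + 1)" using 2 i by (simp add: f_def \<pi>_def)
        moreover have "f t = w" using 2 by (simp add: f_def)
        ultimately show ?thesis using wy i by simp
      next
        case 3
        have "{g (2 * i + 3 - Suc t), g (Suc (2 * i + 3 - Suc t))} \<in> M" using 3 i by (intro path) (auto simp: k_def)
        moreover have "Suc (2 * i + 3 - Suc t) = 2 * i + 3 - t" using 3 by linarith
        moreover have "f t = g (2 * i + 3 - t)" "f (Suc t) = g (2 * i + 3 - Suc t)" using 3 by (simp_all add: f_def \<pi>_def)
        ultimately show ?thesis using MM by (simp add: insert_commute subset_iff)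
      next
        case 4
        have "{g 2, g (2 * i + 2)} \<in> M" using t 4 i by (intro chord) auto
        moreover have "f t = g 2" "f (Suc t) = g (2 * i + 2)" using 4 i by (simp_all add: f_def \<pi>_def)
        ultimately show ?thesis using MM by auto
      next
        case 5
        have "f t = g t" "f (Suc t) = g (Suc t)" using 5 i by (simp_all add: f_def \<pi>_def)
        moreover have "{g t, g (Suc t)} \<in> M" using 5 i t by (intro path) auto
        ultimately show ?thesis using MM by auto
      qed
    qed
    ultimately show "\<exists>f. completion k g w M' f" using fim unfolding completion_def by blast
  qed
qed

section \<open>Building gadgets during play\<close>

abbreviation grown :: "nat \<Rightarrow> nat set \<Rightarrow> nat set \<Rightarrow> nat \<Rightarrow> nat set set \<Rightarrow> bool" where
  "grown s F Z i M \<equiv> \<exists>p. length p = 2 * i + 1 \<and> distinct p \<and> p ! 0 = s \<and>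
     set p \<subseteq> insert s F \<and> card (Z - set p) + i = 2 * b + 1 \<and> spine M p"

text \<open>The far ends \<open>Z\<close> of \<open>2 * b + 1\<close> edges at \<open>s\<close>
  serve as a stock for the \<open>z\<close> vertices, so that every chord is claimed in advance.
  Each of the \<open>b + 1\<close> rounds uses up one of them, and before each round more than
  \<open>b\<close> are left, as \<open>claim_via\<close> requires. The \<open>y\<close> vertices are
  taken outside \<open>Z\<close> to spare the stock.\<close>

lemma build_spine:
  assumes p: "pos M B" and s: "s < n" "s \<notin> F" "s \<notin> Z" and F: "F \<subseteq> {..<n}" and Z: "Z \<subseteq> F" "card Z = 2 * b + 1"
    and sZ: "\<And>z. z \<in> Z \<Longrightarrow> {s, z} \<in> M"
    and d: "\<And>v. v \<in> insert s F \<Longrightarrow> degree B v + b * (2 * b + 2) \<le> d"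
    and c: "(2 * b + 2) * d + (4 * b + 4) < card F"
    and m: "m \<le> b + 1"
  shows "force (\<lambda>M' B'. adv (2 * m) M B M' B' \<and> grown s F Z m M') M B"
  using m
proof (induction m)
  case 0
  have "spine M [s]" by (simp add: spine_def)
  moreover have "card (Z - set [s]) = 2 * b + 1" using Z s by simp
  ultimately show ?case using adv_refl[OF p]
    by (intro force.stop conjI exI[of _ "[s]"]) auto
next
  case (Suc m)
  have finF: "finite F" using F finite_subset by blast
  then have finZ: "finite Z" using Z finite_subset by blast
  have IH: "force (\<lambda>M' B'. adv (2 * m) M B M' B' \<and> grown s F Z m M') M B"
    using Suc by simp
  show ?case
  proof (rule force_adv_trans[OF IH, where j = 2])
    fix M' B' assume adv: "adv (2 * m) M B M' B'" and "grown s F Z m M'"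
    then obtain p where p: "length p = 2 * m + 1" "distinct p" "p ! 0 = s" "set p \<subseteq> insert s F"
        "card (Z - set p) + m = 2 * b + 1" "spine M' p" by blast
    have lp: "last p \<in> set p" using p(1) by (intro last_in_set) auto
    have dg: "degree B' v \<le> d" if "v \<in> insert s F" for v
    proof -
      have "degree B' v \<le> degree B v + b * (2 * m)" by (rule adv_degree[OF adv])
      also have "\<dots> \<le> degree B v + b * (2 * b + 2)" using Suc.prems by (intro add_left_mono mult_le_mono2) simp
      finally show ?thesis using d[OF that] by linarith
    qed
    have cp: "card (set p) = 2 * m + 1" using p by (simp add: distinct_card)
    have finX: "finite (Z \<union> set p)" using finZ by simp
    define F' where "F' = F - {last p}"
    have "card (Z - set p) \<le> 2 * b + 1" using p(5) by simp
    then have "(card (Z - set p) + 1) * d \<le> (2 * b + 2) * d" by (intro mult_le_mono1) simp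
    moreover have "card (set p \<union> Z) \<le> 4 * b + 3"
    proof -
      have "card (set p \<union> Z) = card (set p \<union> (Z - set p))" by (simp add: Un_Diff_cancel)
      also have "\<dots> \<le> (2 * m + 1) + card (Z - set p)" using card_Un_le cp by metis
      finally show ?thesis using p(5) Suc.prems by linarith
    qed
    moreover have "card F \<le> card F' + 1" unfolding F'_def using finF by (auto simp: card_Diff_singleton_if)
    ultimately have c': "(card (Z - set p) + 1) * d + card (set p \<union> Z) < card F'" using c by linarith
    have "force (\<lambda>M'' B''. adv 2 M' B' M'' B'' \<and> (\<exists>a\<in>F' - (set p \<union> Z). \<exists>z\<in>Z - set p. {last p, a} \<in> M'' \<and> {a, z} \<in> M'')) M' B'"
    proof (rule claim_via[where d = d])
      show "pos M' B'" by (rule adv_pos[OF adv])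
      show "last p < n" using lp p(4) s F by auto
      show "F' \<subseteq> {..<n}" "last p \<notin> F'" using F by (auto simp: F'_def)
      show "Z - set p \<subseteq> {..<n}" using Z F by auto
      show "b < card (Z - set p)" using p(5) Suc.prems by linarith
      show "degree B' z \<le> d" if "z \<in> insert (last p) (Z - set p)" for z
        using that lp p(4) Z by (intro dg) auto
    qed (use c' finZ in auto)
    then show "force (\<lambda>M'' B''. adv 2 M' B' M'' B'' \<and> grown s F Z (Suc m) M'') M' B'"
    proof (rule force_mono)
      fix M'' B'' assume "adv 2 M' B' M'' B'' \<and> (\<exists>a\<in>F' - (set p \<union> Z). \<exists>z\<in>Z - set p. {last p, a} \<in> M'' \<and> {a, z} \<in> M'')"
      then obtain a z where adv2: "adv 2 M' B' M'' B''" and a: "a \<in> F" "a \<notin> set p" "a \<notin> Z"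
        and z: "z \<in> Z" "z \<notin> set p" and e: "{last p, a} \<in> M''" "{a, z} \<in> M''" by (auto simp: F'_def)
      define p' where "p' = p @ [a, z]"
      have az: "a \<noteq> z" using a z by auto
      have "card (Z - set p') + Suc m = 2 * b + 1"
      proof -
        have "Z - set p' = (Z - set p) - {z}" using a by (auto simp: p'_def)
        moreover have "card (Z - set p) = Suc (card (Z - set p - {z}))"
          by (rule card.remove) (use z finZ in auto)
        ultimately have "card (Z - set p) = Suc (card (Z - set p'))" by (simp only:)
        then show ?thesis using p(5) by simp
      qed
      moreover have "p ! i = p' ! i" if "i < length p" for i using that by (simp add: p'_def nth_append)
      moreover have "{s, z} \<in> M''" using sZ z adv_subset[OF adv] adv_subset[OF adv2] by blast
      moreover have "spine M'' p'"
        unfolding spine_def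
      proof (intro conjI allI impI)
        fix i assume i: "Suc i < length p'"
        consider "Suc i < length p" | "i = 2 * m" | "i = 2 * m + 1" using i p(1) by (fastforce simp: p'_def)
        then show "{p' ! i, p' ! Suc i} \<in> M''"
        proof cases
          case 1
          then show ?thesis using p(6) adv_subset[OF adv2] by (auto simp: p'_def nth_append spine_def)
        next
          case 2
          have "p \<noteq> []" using p(1) by auto
          then have "last p = p ! (2 * m)" using p(1) by (simp add: last_conv_nth)
          then show ?thesis using 2 e(1) p(1) by (simp add: p'_def nth_append)
        next
          case 3
          then show ?thesis using e(2) p(1) by (simp add: p'_def nth_append)
        qed
      next
        fix i :: nat assume i: "0 < i" "2 * i < length p'"
        consider "2 * i < length p" | "i = m + 1" using i p(1) by (fastforce simp: p'_def)
        then show "{p' ! 0, p' ! (2 * i)} \<in> M''"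
        proof cases
          case 1
          then show ?thesis using p(1,6) i adv_subset[OF adv2] by (auto simp: p'_def nth_append spine_def)
        next
          case 2
          then show ?thesis using p(1,3) \<open>{s, z} \<in> M''\<close> by (simp add: p'_def nth_append)
        qed
      qed
      ultimately have "length p' = 2 * Suc m + 1 \<and> distinct p' \<and> p' ! 0 = s \<and> set p' \<subseteq> insert s F \<and>
          card (Z - set p') + Suc m = 2 * b + 1 \<and> spine M'' p'"
        using p a z az Z by (auto simp: p'_def nth_append)
      then show "adv 2 M' B' M'' B'' \<and> grown s F Z (Suc m) M''"
        using adv2 by blast
    qed
  qed simp
qed

abbreviation built :: "nat \<Rightarrow> nat set \<Rightarrow> nat \<Rightarrow> nat set set \<Rightarrow> bool" where
  "built u F k M \<equiv> \<exists>g. inj_on g ({..<k} - {1}) \<and> g ` ({..<k} - {1}) \<subseteq> F \<and> {u, g 0} \<in> M \<and> gadget k g M"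

text \<open>One move reaches \<open>x\<close>, and for \<open>k = 2\<close> this is all. Otherwise
  one more reaches \<open>s\<close>, then \<open>2 * b + 1\<close> are spent on the star at
  \<open>s\<close> and \<open>2 * (b + 1)\<close> on the spine, which makes
  \<open>4 * b + 5\<close>.\<close>

lemma build_gadget:
  assumes k: "k = 2 \<or> k = 2 * b + 5" and p: "pos M B" and u: "u < n" "u \<notin> F" and F: "F \<subseteq> {..<n}"
    and d: "\<And>v. v \<in> insert u F \<Longrightarrow> degree B v + b * (4 * b + 5) \<le> d"
    and c: "(2 * b + 2) * d + (4 * b + 6) < card F"
  shows "force (\<lambda>M' B'. adv (4 * b + 5) M B M' B' \<and> built u F k M') M B"
proof -
  have finF: "finite F" using F finite_subset by blast
  have du: "degree B v \<le> d" if "v \<in> insert u F" for v using d[OF that] by simp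
  have cF: "2 * d + (4 * b + 6) < card F"
  proof -
    have "2 * d \<le> (2 * b + 2) * d" by (intro mult_le_mono1) simp
    then show ?thesis using c by linarith
  qed
  have first: "force (\<lambda>M' B'. adv 1 M B M' B' \<and> (\<exists>x\<in>F - {}. {u, x} \<in> M')) M B"
    using p u F du[of u] cF by (intro claim_nonadjacent) auto
  show ?thesis
  proof (rule force_adv_trans[OF first, where j = "4 * b + 4"])
    fix M1 B1 assume adv1: "adv 1 M B M1 B1" and "\<exists>x\<in>F - {}. {u, x} \<in> M1"
    then obtain x where x: "x \<in> F" "{u, x} \<in> M1" by blast
    show "force (\<lambda>M' B'. adv (4 * b + 4) M1 B1 M' B' \<and> built u F k M') M1 B1"
    proof (cases "k = 2")
      case True
      have "{..<2} - {1} = {0::nat}" by auto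
      then have "inj_on (\<lambda>_. x) ({..<k} - {1}) \<and> (\<lambda>_. x) ` ({..<k} - {1}) \<subseteq> F \<and> {u, x} \<in> M1 \<and> gadget k (\<lambda>_. x) M1"
        using x gadget_two True by simp
      then show ?thesis using adv_refl[OF adv_pos[OF adv1]]
        by (intro force.stop conjI exI[of _ "\<lambda>_. x"]) auto
    next
      case False
      then have k5: "k = 2 * b + 5" using k by simp
      define F1 where "F1 = F - {x}"
      have cF1: "card F = Suc (card F1)" unfolding F1_def using finF x by (intro card.remove)
      have d1: "degree B1 v \<le> degree B v + b * 1" for v by (rule adv_degree[OF adv1])
      have dd: "b * (4 * b + 5) = b + b * (4 * b + 4)" by (simp add: algebra_simps)
      have second: "force (\<lambda>M' B'. adv 1 M1 B1 M' B' \<and> (\<exists>s\<in>F1 - {}. {x, s} \<in> M')) M1 B1"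
      proof (rule claim_nonadjacent)
        have "degree B x + (b + b * (4 * b + 4)) \<le> d" using d[of x] x(1) unfolding dd by blast
        then have "degree B x + b \<le> d" by (rule order_trans[rotated]) simp
        then have "degree B1 x \<le> d" using d1[of x] by simp
        then show "degree B1 x + card {} < card F1" using cF cF1 by (simp del: mult_Suc)
      qed (use adv_pos[OF adv1] x F in \<open>auto simp: F1_def\<close>)
      show ?thesis
      proof (rule force_adv_trans[OF second, where j = "4 * b + 3"])
        fix M2 B2 assume adv2: "adv 1 M1 B1 M2 B2" and "\<exists>s\<in>F1 - {}. {x, s} \<in> M2"
        then obtain s where s: "s \<in> F1" "{x, s} \<in> M2" by blast
        define F2 where "F2 = F1 - {s}"
        have cF2: "card F1 = Suc (card F2)" unfolding F2_def using finF s by (intro card.remove) (auto simp: F1_def)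
        have d2: "degree B2 v \<le> degree B v + b * 2" for v
          using adv_degree[OF adv_trans[OF adv1 adv2]] by (simp add: numeral_2_eq_2)
        \<comment> \<open>The Breaker edges are charged to the three phases: two single moves, the
          star, the spine.\<close>
        have dd2: "b * (4 * b + 5) = b * 2 + b * (2 * b + 1) + b * (2 * b + 2)" by (simp add: algebra_simps)
        have sF: "s \<in> F" using s by (simp add: F1_def)
        have "degree B2 s + b * (2 * b + 1) + (2 * b + 1) < card F2"
        proof -
          have "degree B s + (b * 2 + b * (2 * b + 1) + b * (2 * b + 2)) \<le> d" using d[of s] sF unfolding dd2 by blast
          then have "degree B2 s + b * (2 * b + 1) \<le> d" using d2[of s] by linarith
          then show ?thesis using cF cF1 cF2 by linarith
        qed
        then have third: "force (\<lambda>M' B'. adv (2 * b + 1) M2 B2 M' B' \<and> (\<exists>Z\<subseteq>F2. card Z = 2 * b + 1 \<and> (\<forall>z\<in>Z. {s, z} \<in> M'))) M2 B2"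
          using adv_pos[OF adv2] sF F by (intro claim_star) (auto simp: F2_def F1_def)
        show "force (\<lambda>M' B'. adv (4 * b + 3) M2 B2 M' B' \<and> built u F k M') M2 B2"
        proof (rule force_adv_trans[OF third, where j = "2 * (b + 1)"])
          fix M3 B3 assume adv3: "adv (2 * b + 1) M2 B2 M3 B3" and "\<exists>Z\<subseteq>F2. card Z = 2 * b + 1 \<and> (\<forall>z\<in>Z. {s, z} \<in> M3)"
          then obtain Z where Z: "Z \<subseteq> F2" "card Z = 2 * b + 1" "\<forall>z\<in>Z. {s, z} \<in> M3" by blast
          have d3: "degree B3 v + b * (2 * b + 2) \<le> d" if "v \<in> F" for v
          proof -
            have "degree B v + (b * 2 + b * (2 * b + 1) + b * (2 * b + 2)) \<le> d" using d[of v] that unfolding dd2 by blast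
            then show ?thesis using adv_degree[OF adv3, of v] d2[of v] by linarith
          qed
          have "(2 * b + 2) * d + (4 * b + 4) < card F2" using c cF1 cF2 by linarith
          then have "force (\<lambda>M' B'. adv (2 * (b + 1)) M3 B3 M' B' \<and> grown s F2 Z (b + 1) M') M3 B3"
            using adv_pos[OF adv3] sF F Z d3 by (intro build_spine) (auto simp: F2_def F1_def)
          then show "force (\<lambda>M' B'. adv (2 * (b + 1)) M3 B3 M' B' \<and> built u F k M') M3 B3"
          proof (rule force_mono)
            fix M4 B4 assume "adv (2 * (b + 1)) M3 B3 M4 B4 \<and> grown s F2 Z (b + 1) M4"
            then obtain p where adv4: "adv (2 * (b + 1)) M3 B3 M4 B4" and "length p = 2 * (b + 1) + 1" and p0: "distinct p" "p ! 0 = s"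
              "set p \<subseteq> insert s F2" "spine M4 p" by blast
            then have p: "length p = 2 * b + 3" "distinct p" "p ! 0 = s" "set p \<subseteq> insert s F2" "spine M4 p" by simp_all
            have MM: "M1 \<subseteq> M4" "M2 \<subseteq> M4" using adv_subset[OF adv2] adv_subset[OF adv3] adv_subset[OF adv4] by auto
            define g where "g t = (if t = 0 then x else p ! (t - 2))" for t :: nat
            have pF: "set p \<subseteq> F" "x \<notin> set p" using p(4) s by (auto simp: F2_def F1_def)
            have "gadget k g M4" unfolding k5
              using p s MM pF by (intro gadget_spine[where p = p and x = x]) (auto simp: g_def)
            moreover have "g ` ({..<k} - {1}) \<subseteq> F"
            proof
              fix v assume "v \<in> g ` ({..<k} - {1})"
              then obtain t where t: "t < k" "t \<noteq> 1" "v = g t" by auto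
              show "v \<in> F"
              proof (cases "t = 0")
                case False
                then have "t - 2 < length p" using t p(1) k5 by linarith
                then show ?thesis using t False pF by (auto simp: g_def)
              qed (use t x in \<open>simp add: g_def\<close>)
            qed
            moreover have "inj_on g ({..<k} - {1})"
            proof (rule inj_onI)
              fix t t' assume tt: "t \<in> {..<k} - {1}" "t' \<in> {..<k} - {1}" "g t = g t'"
              have lt: "r - 2 < length p" if "r \<in> {..<k} - {1}" for r using that p(1) k5 by auto
              have xp: "x \<noteq> p ! i" if "i < length p" for i using pF that by auto
              consider "t = 0" "t' = 0" | "t = 0" "t' \<ge> 2" | "t \<ge> 2" "t' = 0" | "t \<ge> 2" "t' \<ge> 2" using tt by fastforce
              then show "t = t'"
              proof cases
                case 4
                then have "p ! (t - 2) = p ! (t' - 2)" using tt by (simp add: g_def)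
                then have "t - 2 = t' - 2" using lt tt p(2) nth_eq_iff_index_eq by blast
                then show ?thesis using 4 by simp
              next
                case 2
                then show ?thesis using tt xp[OF lt[OF tt(2)]] by (simp add: g_def)
              next
                case 3
                then show ?thesis using tt xp[OF lt[OF tt(1)]] by (simp add: g_def)
              qed simp
            qed
            moreover have "{u, g 0} \<in> M4" using x MM by (auto simp: g_def)
            ultimately show "adv (2 * (b + 1)) M3 B3 M4 B4 \<and> built u F k M4" using adv4 by blast
          qed
        qed simp
      qed simp
    qed
  qed simp
qed

end

section \<open>Partial embeddings\<close>

text \<open>The hypothesis \<open>inner\<close> says that only the two ends of a chain may have
  children outside it, so a completion that fixes the ends may permute the rest freely. The index 1
  is listed separately because for \<open>k = 2\<close> the hole is itself the last role.\<close>

locale embedding = rooted_tree V E root par h + clique_game n b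
  for V :: "nat set" and E root par h n b +
  fixes k :: nat and J :: "nat set" and ro :: "nat \<Rightarrow> nat \<Rightarrow> nat"
  assumes n: "n = card V" and k: "k = 2 \<or> k = 2 * b + 5"
    and chains: "gadget_chains k J ro"
    and inner: "j \<in> J \<Longrightarrow> 0 < t \<Longrightarrow> t < k \<Longrightarrow> t < k - 1 \<or> t = 1 \<Longrightarrow> ch (ro j t) \<subseteq> ro j ` {..<k}"
begin

definition R :: "nat \<Rightarrow> nat set" where "R j = ro j ` {..<k}"

definition S :: "(nat \<Rightarrow> nat) \<Rightarrow> nat \<Rightarrow> nat set" where
  "S \<phi> j = (\<lambda>t. \<phi> (ro j t)) ` ({..<k} - {1})"

definition hole :: "nat \<Rightarrow> nat" where "hole j = ro j 1"

text \<open>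
  The roles in \<open>D\<close> are placed by \<open>\<phi>\<close>, except for the holes of the gadgets in \<open>A\<close>, where \<open>\<phi>\<close> is
  meaningless. The gadgets are wired internally only when they are filled.
\<close>

definition Emb :: "(nat \<Rightarrow> nat) \<Rightarrow> nat set \<Rightarrow> nat set \<Rightarrow> nat set set \<Rightarrow> bool" where
  "Emb \<phi> D A M \<longleftrightarrow> root \<in> D \<and> D \<subseteq> V \<and> (\<forall>r\<in>D. r \<noteq> root \<longrightarrow> par r \<in> D) \<and>
     A \<subseteq> J \<and> (\<forall>j\<in>A. R j \<subseteq> D) \<and>
     inj_on \<phi> (D - hole ` A) \<and> \<phi> ` (D - hole ` A) \<subseteq> {..<n} \<and>
     (\<forall>r\<in>D. r \<noteq> root \<longrightarrow> r \<notin> (\<Union>j\<in>A. R j - {j}) \<longrightarrow> {\<phi> r, \<phi> (par r)} \<in> M) \<and>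
     (\<forall>j\<in>A. gadget k (\<lambda>t. \<phi> (ro j t)) M)"

definition Fr :: "(nat \<Rightarrow> nat) \<Rightarrow> nat set \<Rightarrow> nat set \<Rightarrow> nat set" where
  "Fr \<phi> D A = {..<n} - \<phi> ` (D - hole ` A)"

definition SA :: "(nat \<Rightarrow> nat) \<Rightarrow> nat set \<Rightarrow> nat set" where
  "SA \<phi> A = (\<Union>j\<in>A. S \<phi> j)"

definition Op :: "(nat \<Rightarrow> nat) \<Rightarrow> nat set \<Rightarrow> nat set" where
  "Op \<phi> D = \<phi> ` {r \<in> D. \<not> ch r \<subseteq> D}"

definition live :: "(nat \<Rightarrow> nat) \<Rightarrow> nat set \<Rightarrow> nat set \<Rightarrow> nat set" where
  "live \<phi> D A = Fr \<phi> D A \<union> SA \<phi> A \<union> Op \<phi> D"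

text \<open>The monotonicity behind all counting of responses: a vertex that has left one of the
  three sets never returns to it. \<open>Op\<close> by itself is not monotone, since a freshly
  placed role may be open, hence the union \<open>live\<close>.\<close>

definition shrinks :: "(nat \<Rightarrow> nat) \<Rightarrow> nat set \<Rightarrow> nat set \<Rightarrow> (nat \<Rightarrow> nat) \<Rightarrow> nat set \<Rightarrow> nat set \<Rightarrow> bool" where
  "shrinks \<phi> D A \<phi>' D' A' \<longleftrightarrow> Fr \<phi>' D' A' \<subseteq> Fr \<phi> D A \<and>
     Fr \<phi>' D' A' \<union> SA \<phi>' A' \<subseteq> Fr \<phi> D A \<union> SA \<phi> A \<and> live \<phi>' D' A' \<subseteq> live \<phi> D A"

lemma shrinks_refl: "shrinks \<phi> D A \<phi> D A"
  by (simp add: shrinks_def)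

lemma shrinks_trans: "shrinks \<phi> D A \<phi>' D' A' \<Longrightarrow> shrinks \<phi>' D' A' \<phi>'' D'' A'' \<Longrightarrow> shrinks \<phi> D A \<phi>'' D'' A''"
  unfolding shrinks_def by (meson subset_trans)

lemma EmbD:
  assumes "Emb \<phi> D A M"
  shows "root \<in> D" "D \<subseteq> V" "r \<in> D \<Longrightarrow> r \<noteq> root \<Longrightarrow> par r \<in> D" "A \<subseteq> J" "j \<in> A \<Longrightarrow> R j \<subseteq> D"
    "inj_on \<phi> (D - hole ` A)" "\<phi> ` (D - hole ` A) \<subseteq> {..<n}"
    "r \<in> D \<Longrightarrow> r \<noteq> root \<Longrightarrow> r \<notin> (\<Union>j\<in>A. R j - {j}) \<Longrightarrow> {\<phi> r, \<phi> (par r)} \<in> M"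
    "j \<in> A \<Longrightarrow> gadget k (\<lambda>t. \<phi> (ro j t)) M"
  using assms by (simp_all add: Emb_def)

lemma Emb_mono: "Emb \<phi> D A M \<Longrightarrow> M \<subseteq> M' \<Longrightarrow> Emb \<phi> D A M'"
  unfolding Emb_def by (meson gadget_mono subsetD)

lemma k_ge: "k \<ge> 2"
  using k by auto

lemma ro_0: "j \<in> J \<Longrightarrow> ro j 0 = j"
  and ro_Suc: "j \<in> J \<Longrightarrow> Suc t < k \<Longrightarrow> ro j (Suc t) \<in> ch (ro j t)"
  and ro_eq: "j \<in> J \<Longrightarrow> j' \<in> J \<Longrightarrow> t < k \<Longrightarrow> t' < k \<Longrightarrow> ro j t = ro j' t' \<Longrightarrow> j = j' \<and> t = t'"
  and J_sub: "J \<subseteq> V - {root}"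
  using chains unfolding gadget_chains_def by blast+

lemma inj_ro: "j \<in> J \<Longrightarrow> inj_on (ro j) {..<k}"
  using ro_eq by (intro inj_onI) auto

lemma R_disjoint: "j \<in> J \<Longrightarrow> j' \<in> J \<Longrightarrow> j \<noteq> j' \<Longrightarrow> R j \<inter> R j' = {}"
  unfolding R_def using ro_eq by blast

lemma top_in_R: "j \<in> J \<Longrightarrow> j \<in> R j"
  unfolding R_def using ro_0[of j] k_ge by (metis image_eqI lessThan_iff less_le_trans pos2)

lemma hole_in_R: "j \<in> J \<Longrightarrow> hole j \<in> R j"
  unfolding R_def hole_def using k_ge by auto

lemma hole_neq_top: "j \<in> J \<Longrightarrow> hole j \<noteq> j"
  using ro_eq[of j j 1 0] ro_0[of j] k_ge unfolding hole_def by auto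

lemma par_ro: "j \<in> J \<Longrightarrow> Suc t < k \<Longrightarrow> par (ro j (Suc t)) = ro j t \<and> ro j (Suc t) \<noteq> root \<and> ro j (Suc t) \<in> V"
  using ro_Suc[of j t] by (simp add: ch_iff)

lemma R_sub: "j \<in> J \<Longrightarrow> R j \<subseteq> V - {root}"
proof
  fix r assume j: "j \<in> J" and "r \<in> R j"
  then obtain t where t: "t < k" "r = ro j t" by (auto simp: R_def)
  show "r \<in> V - {root}"
    using t par_ro[OF j, of "t - 1"] ro_0[OF j] J_sub j by (cases t) auto
qed

lemma h_ro: "j \<in> J \<Longrightarrow> t < k \<Longrightarrow> h j \<le> h (ro j t)"
proof (induction t)
  case (Suc t)
  then have "h (ro j t) < h (ro j (Suc t))"
    using par_ro[of j t] par_less[of "ro j (Suc t)"] by simp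
  then show ?case using Suc by simp
qed (simp add: ro_0)

lemma par_top: "j \<in> J \<Longrightarrow> par j \<notin> R j"
proof
  assume j: "j \<in> J" and "par j \<in> R j"
  then obtain t where t: "t < k" "par j = ro j t" by (auto simp: R_def)
  then have "h j \<le> h (par j)" using h_ro[OF j t(1)] by simp
  moreover have "h (par j) < h j" using j J_sub by (intro par_less) auto
  ultimately show False by simp
qed

lemma R_minus_hole: "j \<in> J \<Longrightarrow> R j - {hole j} = ro j ` ({..<k} - {1})"
  unfolding R_def hole_def using inj_ro[of j] k_ge by (auto simp: inj_on_def)

lemma S_eq: "j \<in> J \<Longrightarrow> S \<phi> j = \<phi> ` (R j - {hole j})"
  by (simp add: S_def R_minus_hole image_image)

lemma hole_not_in_other: "j \<in> J \<Longrightarrow> j' \<in> J \<Longrightarrow> hole j' \<in> R j \<Longrightarrow> j = j'"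
  using R_disjoint hole_in_R by blast

lemma S_sub:
  assumes e: "Emb \<phi> D A M" and j: "j \<in> A"
  shows "R j - {hole j} \<subseteq> D - hole ` A"
proof
  fix r assume r: "r \<in> R j - {hole j}"
  have "r \<noteq> hole j'" if "j' \<in> A" for j'
    using r hole_not_in_other[of j j'] EmbD(4)[OF e] j that by blast
  then show "r \<in> D - hole ` A" using EmbD(5)[OF e j] r by blast
qed

lemma S_sub_n:
  assumes e: "Emb \<phi> D A M" and j: "j \<in> A"
  shows "S \<phi> j \<subseteq> \<phi> ` (D - hole ` A)"
proof -
  have "j \<in> J" using EmbD(4)[OF e] j by blast
  show ?thesis unfolding S_eq[OF \<open>j \<in> J\<close>] by (intro image_mono S_sub[OF e j])
qed

lemma S_sub_lt: "Emb \<phi> D A M \<Longrightarrow> j \<in> A \<Longrightarrow> S \<phi> j \<subseteq> {..<n}"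
  using S_sub_n EmbD(7) by (meson subset_trans)

lemma S_disjoint:
  assumes "Emb \<phi> D A M" "j \<in> A" "j' \<in> A" "j \<noteq> j'"
  shows "S \<phi> j \<inter> S \<phi> j' = {}"
proof -
  have "(R j - {hole j}) \<inter> (R j' - {hole j'}) = {}" using R_disjoint assms EmbD(4) by blast
  then show ?thesis
    using S_eq inj_on_image_Int[OF EmbD(6)[OF assms(1)] S_sub[OF assms(1,2)] S_sub[OF assms(1,3)]]
      EmbD(4)[OF assms(1)] assms by (metis image_empty subsetD)
qed

lemma card_S_le: "card (S \<phi> j) \<le> k"
proof -
  have "card (S \<phi> j) \<le> card ({..<k} - {1})" unfolding S_def by (rule card_image_le) simp
  also have "\<dots> \<le> k" by (metis card_mono Diff_subset finite_lessThan card_lessThan)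
  finally show ?thesis .
qed

text \<open>By \<open>inner\<close>, the children of a hole belong to its own gadget, whose roles
  are placed all at once. So the meaningless value of \<phi> at an unfilled hole never shows up in
  \<open>Op\<close>.\<close>

lemma open_not_hole:
  assumes "Emb \<phi> D A M" "r \<in> D" "\<not> ch r \<subseteq> D"
  shows "r \<in> D - hole ` A"
proof -
  have "r \<noteq> hole j" if j: "j \<in> A" for j
  proof
    assume "r = hole j"
    moreover have "ch (hole j) \<subseteq> R j"
      unfolding hole_def R_def using j EmbD(4)[OF assms(1)] k_ge by (intro inner) auto
    ultimately show False using assms(3) EmbD(5)[OF assms(1) j] by blast
  qed
  then show ?thesis using assms(2) by blast
qed

lemma Op_sub: "Emb \<phi> D A M \<Longrightarrow> Op \<phi> D \<subseteq> \<phi> ` (D - hole ` A)"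
  unfolding Op_def using open_not_hole by blast

lemma finD: "Emb \<phi> D A M \<Longrightarrow> finite D \<and> finite A"
  using EmbD(2,4) finV J_sub by (meson finite_Diff finite_subset)

lemma inj_hole: "inj_on hole J"
  using R_disjoint hole_in_R by (intro inj_onI) (metis IntI empty_iff)

text \<open>Each unfilled hole is a placed role without a vertex, and thus holds one free vertex in
  reserve. For \<open>D = V\<close> there are exactly as many free vertices as holes.\<close>

lemma card_Fr: 
  assumes e: "Emb \<phi> D A M"
  shows "card (Fr \<phi> D A) + card D = n + card A"
proof -
  have hA: "hole ` A \<subseteq> D" using EmbD(4,5)[OF e] hole_in_R by blast
  have "card (hole ` A) = card A" using inj_hole EmbD(4)[OF e] by (meson card_image inj_on_subset)
  then have "card (D - hole ` A) = card D - card A"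
    using hA finD[OF e] by (simp add: card_Diff_subset)
  then have c1: "card (\<phi> ` (D - hole ` A)) = card D - card A" using EmbD(6)[OF e] by (simp add: card_image)
  have le: "card A \<le> card D" using hA finD[OF e] \<open>card (hole ` A) = card A\<close> by (metis card_mono)
  have "card (Fr \<phi> D A) = n - (card D - card A)"
    unfolding Fr_def using c1 EmbD(7)[OF e] finD[OF e] by (simp add: card_Diff_subset)
  moreover have "card D \<le> n" using EmbD(2)[OF e] finV n by (simp add: card_mono)
  ultimately show ?thesis using le by linarith
qed

lemma fin_Fr: "finite (Fr \<phi> D A)"
  by (simp add: Fr_def)

lemma Fr_lt: "Fr \<phi> D A \<subseteq> {..<n}"
  by (auto simp: Fr_def)

lemma live_lt:
  assumes e: "Emb \<phi> D A M"
  shows "live \<phi> D A \<subseteq> {..<n}"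
proof -
  have "SA \<phi> A \<subseteq> {..<n}" unfolding SA_def using S_sub_lt[OF e] by (rule UN_least)
  moreover have "Op \<phi> D \<subseteq> {..<n}" using Op_sub[OF e] EmbD(7)[OF e] by (rule subset_trans)
  ultimately show ?thesis unfolding live_def using Fr_lt[of \<phi> D A] by simp
qed

section \<open>Extending a partial embedding\<close>

lemma Emb_extend:
  assumes e: "Emb \<phi> D A M" and r: "r \<in> V" "r \<notin> D" "par r \<in> D" and w: "w \<in> Fr \<phi> D A"
    and edge: "{\<phi> (par r), w} \<in> M"
  shows "Emb (\<phi>(r := w)) (insert r D) A M" "shrinks \<phi> D A (\<phi>(r := w)) (insert r D) A"
    "Fr (\<phi>(r := w)) (insert r D) A = Fr \<phi> D A - {w}" "SA (\<phi>(r := w)) A = SA \<phi> A"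
proof -
  let ?\<phi> = "\<phi>(r := w)"
  have rR: "r \<notin> R j" if "j \<in> A" for j using EmbD(5)[OF e that] r(2) by blast
  have ro: "ro j t \<noteq> r" if "j \<in> A" "t < k" for j t using rR[OF that(1)] that(2) by (auto simp: R_def)
  have rh: "r \<notin> hole ` A" using rR hole_in_R EmbD(4)[OF e] by blast
  have D': "insert r D - hole ` A = insert r (D - hole ` A)" using rh by auto
  have im: "?\<phi> ` (D - hole ` A) = \<phi> ` (D - hole ` A)" using r(2) by (intro image_cong) auto
  have im': "?\<phi> ` (insert r D - hole ` A) = insert w (\<phi> ` (D - hole ` A))"
    unfolding D' image_insert im by simp
  have rroot: "r \<noteq> root" using r EmbD(1)[OF e] by blast
  have Seq: "S ?\<phi> j = S \<phi> j" if "j \<in> A" for j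
    unfolding S_def using ro[OF that] by (intro image_cong) auto
  have wn: "w < n" "w \<notin> \<phi> ` (D - hole ` A)" using w by (auto simp: Fr_def)
  show emb: "Emb ?\<phi> (insert r D) A M"
    unfolding Emb_def
  proof (intro conjI ballI impI)
    show "root \<in> insert r D" "insert r D \<subseteq> V" "A \<subseteq> J" using EmbD(1,2,4)[OF e] r by auto
    show "par x \<in> insert r D" if "x \<in> insert r D" "x \<noteq> root" for x using that r EmbD(3)[OF e] by auto
    show "R j \<subseteq> insert r D" if "j \<in> A" for j using EmbD(5)[OF e that] by blast
    show "?\<phi> ` (insert r D - hole ` A) \<subseteq> {..<n}" unfolding im' using wn EmbD(7)[OF e] by simp
    show "inj_on ?\<phi> (insert r D - hole ` A)"
    proof -
      have "inj_on ?\<phi> (D - hole ` A)" using EmbD(6)[OF e] r(2) by (subst inj_on_cong[of _ _ \<phi>]) auto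
      then show ?thesis unfolding D' using wn im r(2) by (auto simp: image_iff)
    qed
    fix x assume x: "x \<in> insert r D" "x \<noteq> root" "x \<notin> (\<Union>j\<in>A. R j - {j})"
    show "{?\<phi> x, ?\<phi> (par x)} \<in> M"
    proof (cases "x = r")
      case True
      then show ?thesis using edge r by (auto simp: insert_commute)
    next
      case False
      then have "par x \<noteq> r" using x EmbD(3)[OF e] r(2) by auto
      then show ?thesis using False x EmbD(8)[OF e] by simp
    qed
  next
    fix j assume j: "j \<in> A"
    then show "gadget k (\<lambda>t. ?\<phi> (ro j t)) M"
      using EmbD(9)[OF e j] gadget_cong[of k "\<lambda>t. \<phi> (ro j t)" "\<lambda>t. ?\<phi> (ro j t)" M] ro[OF j] k_ge by auto
  qed
  show Freq: "Fr ?\<phi> (insert r D) A = Fr \<phi> D A - {w}" unfolding Fr_def im' by auto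
  show SAeq: "SA ?\<phi> A = SA \<phi> A" unfolding SA_def using Seq by simp
  have "Op ?\<phi> (insert r D) \<subseteq> insert w (Op \<phi> D)"
  proof
    fix v assume "v \<in> Op ?\<phi> (insert r D)"
    then obtain x where x: "x \<in> insert r D" "\<not> ch x \<subseteq> insert r D" "v = ?\<phi> x"
      unfolding Op_def by blast
    show "v \<in> insert w (Op \<phi> D)"
    proof (cases "x = r")
      case False
      then have "x \<in> D" "\<not> ch x \<subseteq> D" "v = \<phi> x" using x by auto
      then show ?thesis unfolding Op_def by blast
    qed (use x in simp)
  qed
  then show "shrinks \<phi> D A ?\<phi> (insert r D) A"
    unfolding shrinks_def live_def Freq SAeq using w by blast
qed

text \<open>The vertices of the gadget are redistributed among its roles according to
  \<open>f\<close>. Tree edges leaving the gadget survive because they are attached at its ends,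
  where \<open>f\<close> agrees with the old placement.\<close>

lemma Emb_fill:
  assumes e: "Emb \<phi> D A M" and j: "j \<in> A" and w: "w \<in> Fr \<phi> D A"
    and f: "completion k (\<lambda>t. \<phi> (ro j t)) w M f"
  shows "\<exists>\<phi>'. Emb \<phi>' D (A - {j}) M \<and> Fr \<phi>' D (A - {j}) = Fr \<phi> D A - {w} \<and>
    (\<forall>j'\<in>A - {j}. \<forall>t<k. \<phi>' (ro j' t) = \<phi> (ro j' t)) \<and> SA \<phi>' (A - {j}) \<subseteq> SA \<phi> A - S \<phi> j \<and>
    shrinks \<phi> D A \<phi>' D (A - {j})"
proof -
  have jJ: "j \<in> J" using EmbD(4)[OF e] j by blast
  define idx where "idx = inv_into {..<k} (ro j)"
  have idx: "idx (ro j t) = t" if "t < k" for t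
    unfolding idx_def using inj_ro[OF jJ] that by (intro inv_into_f_f) auto
  define \<phi>' where "\<phi>' r = (if r \<in> R j then f (idx r) else \<phi> r)" for r
  have \<phi>'_ro: "\<phi>' (ro j t) = f t" if "t < k" for t
    using that idx by (auto simp: \<phi>'_def R_def)
  have \<phi>'_out: "\<phi>' r = \<phi> r" if "r \<notin> R j" for r using that by (simp add: \<phi>'_def)
  have f1: "inj_on f {..<k}" and f2: "f ` {..<k} = insert w (S \<phi> j)"
    and f3: "\<And>t. t \<in> {0, k - 1} - {1} \<Longrightarrow> f t = \<phi> (ro j t)"
    and f4: "\<And>t. Suc t < k \<Longrightarrow> {f t, f (Suc t)} \<in> M"
    using f by (auto simp: completion_def S_def)
  have other: "\<phi>' (ro j' t) = \<phi> (ro j' t)" if "j' \<in> A - {j}" "t < k" for j' t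
    using that R_disjoint[of j j'] jJ EmbD(4)[OF e] by (intro \<phi>'_out) (auto simp: R_def)
  have bd: "\<phi>' r = \<phi> r" if "r \<in> D" "\<not> ch r \<subseteq> R j" for r
  proof (cases "r \<in> R j")
    case True
    then obtain t where t: "t < k" "r = ro j t" by (auto simp: R_def)
    have "\<not> (0 < t \<and> (t < k - 1 \<or> t = 1))" using inner[OF jJ _ t(1)] that(2) t(2) by (auto simp: R_def)
    then have "t \<in> {0, k - 1} - {1}" using t(1) by auto
    then show ?thesis using f3 \<phi>'_ro t by simp
  qed (rule \<phi>'_out)
  have \<phi>'R: "\<phi>' ` R j = insert w (S \<phi> j)"
  proof -
    have "\<phi>' ` R j = f ` {..<k}" unfolding R_def image_image using \<phi>'_ro by (intro image_cong) auto
    then show ?thesis using f2 by simp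
  qed
  define D1 where "D1 = D - hole ` A - R j"
  have RD: "R j \<subseteq> D" by (rule EmbD(5)[OF e j])
  have Rh: "R j \<inter> hole ` (A - {j}) = {}" using hole_not_in_other[OF jJ] EmbD(4)[OF e] by blast
  have Deq: "D - hole ` (A - {j}) = R j \<union> D1"
    unfolding D1_def using RD Rh hole_in_R[OF jJ] by blast
  have Deq0: "D - hole ` A = (R j - {hole j}) \<union> D1"
    unfolding D1_def using RD Rh S_sub[OF e j] j by blast
  have im1: "\<phi>' ` D1 = \<phi> ` D1" using \<phi>'_out by (intro image_cong) (auto simp: D1_def)
  have dj: "S \<phi> j \<inter> \<phi> ` D1 = {}"
  proof -
    have sub1: "R j - {hole j} \<subseteq> D - hole ` A" and sub2: "D1 \<subseteq> D - hole ` A" using Deq0 by blast+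
    have "(R j - {hole j}) \<inter> D1 = {}" by (auto simp: D1_def)
    then show ?thesis unfolding S_eq[OF jJ]
      using inj_on_image_Int[OF EmbD(6)[OF e] sub1 sub2] by simp
  qed
  have wn: "w < n" "w \<notin> \<phi> ` (D - hole ` A)" using w by (auto simp: Fr_def)
  have im: "\<phi>' ` (D - hole ` (A - {j})) = insert w (\<phi> ` (D - hole ` A))"
    unfolding Deq Deq0 image_Un \<phi>'R im1 S_eq[OF jJ] by simp
  have inj: "inj_on \<phi>' (D - hole ` (A - {j}))"
    unfolding Deq
  proof (rule inj_on_Un[THEN iffD2], intro conjI)
    show "inj_on \<phi>' (R j)"
    proof (rule inj_onI)
      fix x y assume "x \<in> R j" "y \<in> R j" and xy: "\<phi>' x = \<phi>' y"
      then obtain s t where st: "s < k" "x = ro j s" "t < k" "y = ro j t" by (auto simp: R_def)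
      then have "f s = f t" using xy \<phi>'_ro by simp
      then have "s = t" using f1 st by (simp add: inj_on_def)
      then show "x = y" using st by simp
    qed
    have "inj_on \<phi> D1" using EmbD(6)[OF e] unfolding Deq0 by (rule inj_on_subset) simp
    then show "inj_on \<phi>' D1" using \<phi>'_out by (subst inj_on_cong[of _ _ \<phi>]) (auto simp: D1_def)
    have "w \<notin> \<phi> ` D1" using wn Deq0 by blast
    then have "\<phi>' ` R j \<inter> \<phi>' ` D1 = {}" unfolding \<phi>'R im1 using dj by blast
    then show "\<phi>' ` (R j - D1) \<inter> \<phi>' ` (D1 - R j) = {}" by blast
  qed
  have emb: "Emb \<phi>' D (A - {j}) M"
    unfolding Emb_def
  proof (intro conjI ballI impI)
    show "root \<in> D" "D \<subseteq> V" "A - {j} \<subseteq> J" using EmbD(1,2,4)[OF e] by auto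
    show "par r \<in> D" if "r \<in> D" "r \<noteq> root" for r using EmbD(3)[OF e that] .
    show "R j' \<subseteq> D" if "j' \<in> A - {j}" for j' using EmbD(5)[OF e] that by blast
    show "\<phi>' ` (D - hole ` (A - {j})) \<subseteq> {..<n}" unfolding im using wn EmbD(7)[OF e] by simp
    show "inj_on \<phi>' (D - hole ` (A - {j}))" by (rule inj)
    show "gadget k (\<lambda>t. \<phi>' (ro j' t)) M" if j': "j' \<in> A - {j}" for j'
      using EmbD(9)[OF e, of j'] gadget_cong[of k "\<lambda>t. \<phi> (ro j' t)" "\<lambda>t. \<phi>' (ro j' t)" M] other[OF j'] j' k_ge
      by auto
    fix r assume r: "r \<in> D" "r \<noteq> root" "r \<notin> (\<Union>j'\<in>A - {j}. R j' - {j'})"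
    show "{\<phi>' r, \<phi>' (par r)} \<in> M"
    proof (cases "r \<in> R j - {j}")
      case True
      then obtain t where t: "t < k" "r = ro j t" by (auto simp: R_def)
      then obtain s where s: "t = Suc s" using True ro_0[OF jJ] by (cases t) auto
      then have "par r = ro j s" using par_ro[OF jJ] t by simp
      then show ?thesis using f4[of s] \<phi>'_ro[of s] \<phi>'_ro[of t] t s by (simp add: insert_commute)
    next
      case False
      then have old: "{\<phi> r, \<phi> (par r)} \<in> M" using r by (intro EmbD(8)[OF e]) auto
      have "\<phi>' r = \<phi> r"
      proof (cases "r = j")
        case True
        have "\<phi>' (ro j 0) = \<phi> (ro j 0)" using \<phi>'_ro[of 0] f3[of 0] k_ge by simp
        then show ?thesis using True ro_0[OF jJ] by simp
      qed (use False \<phi>'_out in auto)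
      moreover have "\<phi>' (par r) = \<phi> (par r)"
      proof (cases "r = j")
        case True
        then show ?thesis using par_top[OF jJ] \<phi>'_out by simp
      next
        case rj: False
        \<comment> \<open>The role \<open>r\<close> is a child outside the gadget, so its parent
          keeps its vertex by \<open>bd\<close>.\<close>
        have "r \<in> ch (par r)" using r EmbD(2)[OF e] by (auto simp: ch_iff)
        then have "\<not> ch (par r) \<subseteq> R j" using False rj by blast
        then show ?thesis using bd EmbD(3)[OF e r(1,2)] by blast
      qed
      ultimately show ?thesis using old by simp
    qed
  qed
  have Freq: "Fr \<phi>' D (A - {j}) = Fr \<phi> D A - {w}" unfolding Fr_def im by auto
  have Sother: "S \<phi>' j' = S \<phi> j'" if "j' \<in> A - {j}" for j'
    unfolding S_def using other[OF that] by (intro image_cong) auto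
  have SAeq: "SA \<phi>' (A - {j}) \<subseteq> SA \<phi> A - S \<phi> j"
    unfolding SA_def using Sother S_disjoint[OF e _ j] by blast
  have "Op \<phi>' D \<subseteq> Op \<phi> D"
  proof
    fix v assume "v \<in> Op \<phi>' D"
    then obtain r where r: "r \<in> D" "\<not> ch r \<subseteq> D" "v = \<phi>' r" by (auto simp: Op_def)
    then have "\<not> ch r \<subseteq> R j" using RD by blast
    then show "v \<in> Op \<phi> D" using r bd by (auto simp: Op_def)
  qed
  then have "shrinks \<phi> D A \<phi>' D (A - {j})"
    unfolding shrinks_def live_def Freq using SAeq by blast
  then show ?thesis using emb Freq SAeq other by blast
qed

lemma Emb_gadget:
  assumes e: "Emb \<phi> D A M" and j: "j \<in> J" "j \<notin> D" "par j \<in> D"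
    and g: "inj_on g ({..<k} - {1})" "g ` ({..<k} - {1}) \<subseteq> Fr \<phi> D A" "{\<phi> (par j), g 0} \<in> M" "gadget k g M"
  shows "\<exists>\<phi>'. Emb \<phi>' (D \<union> R j) (insert j A) M \<and> shrinks \<phi> D A \<phi>' (D \<union> R j) (insert j A)"
proof -
  \<comment> \<open>\<open>D\<close> is closed under parents, so below an unplaced top the whole
    chain is unplaced.\<close>
  have ro_not: "ro j t \<notin> D" if "t < k" for t
    using that
  proof (induction t)
    case (Suc t)
    then show ?case using par_ro[OF j(1), of t] EmbD(3)[OF e, of "ro j (Suc t)"] by auto
  qed (simp add: ro_0 j)
  then have RD: "R j \<inter> D = {}" by (auto simp: R_def)
  define idx where "idx = inv_into {..<k} (ro j)"
  have idx: "idx (ro j t) = t" if "t < k" for t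
    unfolding idx_def using inj_ro[OF j(1)] that by (intro inv_into_f_f) auto
  define \<phi>' where "\<phi>' r = (if r \<in> R j then g (idx r) else \<phi> r)" for r
  have \<phi>'_ro: "\<phi>' (ro j t) = g t" if "t < k" for t
    using that idx by (auto simp: \<phi>'_def R_def)
  have \<phi>'_D: "\<phi>' r = \<phi> r" if "r \<in> D" for r using that RD by (auto simp: \<phi>'_def)
  have jA: "j \<notin> A" using j EmbD(5)[OF e] top_in_R by blast
  have hAD: "hole ` A \<subseteq> D" using EmbD(4,5)[OF e] hole_in_R by blast
  define G where "G = g ` ({..<k} - {1})"
  have imR: "\<phi>' ` (R j - {hole j}) = G"
    unfolding R_minus_hole[OF j(1)] G_def image_image using \<phi>'_ro by (intro image_cong) auto
  have Deq: "D \<union> R j - hole ` insert j A = (D - hole ` A) \<union> (R j - {hole j})"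
    using RD hAD hole_in_R[OF j(1)] by auto
  have imD: "\<phi>' ` (D - hole ` A) = \<phi> ` (D - hole ` A)" using \<phi>'_D by (intro image_cong) auto
  have im: "\<phi>' ` (D \<union> R j - hole ` insert j A) = \<phi> ` (D - hole ` A) \<union> G"
    unfolding Deq image_Un imR imD ..
  have GF: "G \<subseteq> {..<n}" "G \<inter> \<phi> ` (D - hole ` A) = {}" using g(2) by (auto simp: Fr_def G_def)
  have other: "\<phi>' (ro j' t) = \<phi> (ro j' t)" if "j' \<in> A" "t < k" for j' t
    using that EmbD(5)[OF e that(1)] by (intro \<phi>'_D) (auto simp: R_def)
  have gj: "S \<phi>' j = G" unfolding S_def G_def using \<phi>'_ro by (intro image_cong) auto
  have emb: "Emb \<phi>' (D \<union> R j) (insert j A) M"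
    unfolding Emb_def
  proof (intro conjI ballI impI)
    show "root \<in> D \<union> R j" "D \<union> R j \<subseteq> V" "insert j A \<subseteq> J" using EmbD(1,2,4)[OF e] j R_sub[OF j(1)] by auto
    show "par r \<in> D \<union> R j" if r: "r \<in> D \<union> R j" "r \<noteq> root" for r
    proof (cases "r \<in> D")
      case True
      then show ?thesis using EmbD(3)[OF e] r by blast
    next
      case False
      then obtain t where t: "t < k" "r = ro j t" using r by (auto simp: R_def)
      show ?thesis
      proof (cases t)
        case 0
        then show ?thesis using t ro_0 j by simp
      next
        case (Suc s)
        then show ?thesis using par_ro[OF j(1), of s] t by (auto simp: R_def)
      qed
    qed
    show "R j' \<subseteq> D \<union> R j" if "j' \<in> insert j A" for j' using EmbD(5)[OF e] that by blast
    show "\<phi>' ` (D \<union> R j - hole ` insert j A) \<subseteq> {..<n}" unfolding im using GF EmbD(7)[OF e] by simp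
    show "inj_on \<phi>' (D \<union> R j - hole ` insert j A)"
      unfolding Deq
    proof (rule inj_on_Un[THEN iffD2], intro conjI)
      show "inj_on \<phi>' (D - hole ` A)" using EmbD(6)[OF e] \<phi>'_D by (subst inj_on_cong[of _ _ \<phi>]) auto
      show "inj_on \<phi>' (R j - {hole j})"
        unfolding R_minus_hole[OF j(1)]
      proof (rule inj_onI)
        fix x y assume "x \<in> ro j ` ({..<k} - {1})" "y \<in> ro j ` ({..<k} - {1})" and xy: "\<phi>' x = \<phi>' y"
        then obtain s t where st: "s \<in> {..<k} - {1}" "x = ro j s" "t \<in> {..<k} - {1}" "y = ro j t" by blast
        then have "g s = g t" using xy \<phi>'_ro by simp
        then have "s = t" using inj_onD[OF g(1)] st by blast
        then show "x = y" using st by simp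
      qed
      show "\<phi>' ` (D - hole ` A - (R j - {hole j})) \<inter> \<phi>' ` (R j - {hole j} - (D - hole ` A)) = {}"
      proof -
        have "\<phi>' ` (D - hole ` A - (R j - {hole j})) \<subseteq> \<phi> ` (D - hole ` A)"
          unfolding imD[symmetric] by (intro image_mono) blast
        moreover have "\<phi>' ` (R j - {hole j} - (D - hole ` A)) \<subseteq> G"
          unfolding imR[symmetric] by (intro image_mono) blast
        ultimately show ?thesis using GF(2) by blast
      qed
    qed
    show "gadget k (\<lambda>t. \<phi>' (ro j' t)) M" if j': "j' \<in> insert j A" for j'
    proof (cases "j' = j")
      case True
      then show ?thesis
        using g(4) gadget_cong[of k g "\<lambda>t. \<phi>' (ro j t)" M] \<phi>'_ro k_ge by auto
    next
      case False
      then show ?thesis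
        using EmbD(9)[OF e, of j'] gadget_cong[of k "\<lambda>t. \<phi> (ro j' t)" "\<lambda>t. \<phi>' (ro j' t)" M] other j' k_ge by auto
    qed
    fix r assume r: "r \<in> D \<union> R j" "r \<noteq> root" "r \<notin> (\<Union>j'\<in>insert j A. R j' - {j'})"
    show "{\<phi>' r, \<phi>' (par r)} \<in> M"
    proof (cases "r \<in> D")
      case True
      then have "par r \<in> D" using EmbD(3)[OF e] r by blast
      moreover have "{\<phi> r, \<phi> (par r)} \<in> M" using True r by (intro EmbD(8)[OF e]) auto
      ultimately show ?thesis using True \<phi>'_D by simp
    next
      case False
      then have "r = j" using r by auto
      moreover have "\<phi>' j = g 0" using \<phi>'_ro[of 0] ro_0[OF j(1)] k_ge by simp
      ultimately show ?thesis using g(3) \<phi>'_D j by (simp add: insert_commute)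
    qed
  qed
  have Freq: "Fr \<phi>' (D \<union> R j) (insert j A) = Fr \<phi> D A - G" unfolding Fr_def im by auto
  have SAeq: "SA \<phi>' (insert j A) = SA \<phi> A \<union> G"
  proof -
    have "S \<phi>' j' = S \<phi> j'" if "j' \<in> A" for j'
      unfolding S_def using other[OF that] by (intro image_cong) auto
    then show ?thesis unfolding SA_def using gj by auto
  qed
  have "Op \<phi>' (D \<union> R j) \<subseteq> Op \<phi> D \<union> G"
  proof
    fix v assume "v \<in> Op \<phi>' (D \<union> R j)"
    then obtain r where r: "r \<in> D \<union> R j" "\<not> ch r \<subseteq> D \<union> R j" "v = \<phi>' r" by (auto simp: Op_def)
    show "v \<in> Op \<phi> D \<union> G"
    proof (cases "r \<in> D")
      case True
      then show ?thesis using r \<phi>'_D by (auto simp: Op_def)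
    next
      case False
      moreover have "r \<noteq> hole j"
        using open_not_hole[OF emb r(1)] r(2) by blast
      ultimately show ?thesis using r imR by blast
    qed
  qed
  then have "shrinks \<phi> D A \<phi>' (D \<union> R j) (insert j A)"
    unfolding shrinks_def live_def Freq SAeq using g(2)[folded G_def] by blast
  then show ?thesis using emb by blast
qed

end

section \<open>Placing all roles\<close>

text \<open>
  A vertex of Breaker degree at least \<open>D0\<close> calls for a response of at most \<open>c\<close> moves; \<open>Q\<close> bounds the number
  of responses and \<open>dm\<close> the Breaker degrees of all vertices that are still needed.
\<close>

locale placement = embedding V E root par h n b k J ro
  for V :: "nat set" and E root par h n b k J ro +
  fixes \<Delta> c D0 Q dm :: nat
  assumes ch_le: "r \<in> V \<Longrightarrow> card (ch r) \<le> \<Delta>"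
    and c_ge: "\<Delta> \<le> c" "b + 3 \<le> c"
    and D0: "12 * b * c \<le> D0" "12 * b * (n + (4 * b + 5) * card J + 1) < D0 * (Q + 1)"
    and dm: "D0 + b * (4 * b + 5) + b * c * Q + b * (c + (4 * b + 5)) \<le> dm"
    and J_large: "c * Q + (2 * b + 6) * dm + (10 * b + 20) + c + dm * (\<Delta> + \<Delta> * \<Delta>) < card J"
begin

definition heavy :: "nat set set \<Rightarrow> nat set" where
  "heavy B = {v \<in> {..<n}. D0 \<le> degree B v}"

abbreviation retired :: "(nat \<Rightarrow> nat) \<Rightarrow> nat set \<Rightarrow> nat set \<Rightarrow> nat set set \<Rightarrow> nat" where
  "retired \<phi> D A B \<equiv> card (heavy B - Fr \<phi> D A) + card (heavy B - (Fr \<phi> D A \<union> SA \<phi> A)) + card (heavy B - live \<phi> D A)"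

text \<open>
  The number \<open>q\<close> counts the responses to vertices of high Breaker degree. Each of them
  makes some heavy vertex leave one of the sets \<open>Fr\<close>, \<open>Fr \<union> SA\<close>, \<open>live\<close> for good.
\<close>

definition Inv :: "nat \<Rightarrow> (nat \<Rightarrow> nat) \<Rightarrow> nat set \<Rightarrow> nat set \<Rightarrow> nat set set \<Rightarrow> nat set set \<Rightarrow> bool" where
  "Inv q \<phi> D A M B \<longleftrightarrow> pos M B \<and> Emb \<phi> D A M \<and>
     card {j \<in> J. j \<in> D \<and> j \<notin> A} \<le> c * q \<and>
     card M \<le> card D + (4 * b + 5) * card (J \<inter> D) + c * q \<and>
     (\<forall>v\<in>live \<phi> D A. degree B v \<le> D0 + b * (4 * b + 5) + b * c * q) \<and>
     q \<le> retired \<phi> D A B"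

lemma fin_J: "finite J"
  using J_sub finV by (meson finite_Diff finite_subset)

lemma InvD:
  assumes "Inv q \<phi> D A M B"
  shows "pos M B" "Emb \<phi> D A M" "card {j \<in> J. j \<in> D \<and> j \<notin> A} \<le> c * q"
    "card M \<le> card D + (4 * b + 5) * card (J \<inter> D) + c * q"
    "v \<in> live \<phi> D A \<Longrightarrow> degree B v \<le> D0 + b * (4 * b + 5) + b * c * q"
    "q \<le> retired \<phi> D A B"
  using assms by (simp_all add: Inv_def)

lemma fin_heavy: "finite (heavy B)"
  by (simp add: heavy_def)

section \<open>Bounds that follow from the invariant\<close>

lemma card_heavy:
  assumes "pos M B"
  shows "card (heavy B) * D0 \<le> 2 * card B"
proof -
  have finB: "finite B" using pos_finite[OF assms] by simp
  have two: "card {v \<in> {..<n}. v \<in> e} = 2" if "e \<in> B" for e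
  proof -
    have "e \<subseteq> {..<n}" "card e = 2"
      using that assms unfolding pos_def by (auto simp: complete_edges_def)
    moreover have "{v \<in> {..<n}. v \<in> e} = e" using calculation by auto
    ultimately show ?thesis by simp
  qed
  have "card (heavy B) * D0 = (\<Sum>v\<in>heavy B. D0)" by simp
  also have "\<dots> \<le> (\<Sum>v\<in>heavy B. degree B v)" by (intro sum_mono) (simp add: heavy_def)
  also have "\<dots> \<le> (\<Sum>v\<in>{..<n}. degree B v)" by (intro sum_mono2) (auto simp: heavy_def)
  also have "\<dots> = 2 * card B"
    unfolding degree_def using finB two by (intro sum_multicount) auto
  finally show ?thesis .
qed

text \<open>Each heavy vertex is counted at most three times in \<open>retired\<close>, and double
  counting bounds the heavy vertices by the number of Breaker edges. That number depends on
  \<open>q\<close> again, because responses cost moves; the hypothesis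
  \<open>12 * b * c \<le> D0\<close> absorbs this feedback.\<close>

lemma Inv_le_Q:
  assumes i: "Inv q \<phi> D A M B"
  shows "q \<le> Q"
proof -
  have "q \<le> card (heavy B) + card (heavy B) + card (heavy B)"
    using InvD(6)[OF i] card_mono[OF fin_heavy[of B], of "heavy B - Fr \<phi> D A"]
      card_mono[OF fin_heavy[of B], of "heavy B - (Fr \<phi> D A \<union> SA \<phi> A)"]
      card_mono[OF fin_heavy[of B], of "heavy B - live \<phi> D A"] by force
  then have "q * D0 \<le> (card (heavy B) + card (heavy B) + card (heavy B)) * D0" by (rule mult_le_mono1)
  also have "\<dots> = 3 * (card (heavy B) * D0)" by (simp add: algebra_simps)
  also have "\<dots> \<le> 3 * (2 * card B)" using card_heavy[OF InvD(1)[OF i]] by (rule mult_le_mono2)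
  also have "\<dots> \<le> 6 * (b * (card M + 1))" using InvD(1)[OF i] by (simp add: pos_def)
  also have "\<dots> \<le> 6 * (b * (n + (4 * b + 5) * card J + c * q + 1))"
  proof -
    have "card D \<le> n" using EmbD(2)[OF InvD(2)[OF i]] finV n by (simp add: card_mono)
    moreover have "card (J \<inter> D) \<le> card J" using fin_J by (simp add: card_mono)
    then have "(4 * b + 5) * card (J \<inter> D) \<le> (4 * b + 5) * card J" by (rule mult_le_mono2)
    ultimately have "card M + 1 \<le> n + (4 * b + 5) * card J + c * q + 1" using InvD(4)[OF i] by linarith
    then show ?thesis by (intro mult_le_mono2)
  qed
  finally have "2 * (q * D0) \<le> 12 * b * (n + (4 * b + 5) * card J + 1) + 12 * b * c * q"
    by (simp add: algebra_simps)
  moreover have "12 * b * c * q \<le> D0 * q" using D0(1) by (rule mult_le_mono1)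
  moreover have "D0 * q = q * D0" by (rule mult.commute)
  ultimately have "q * D0 < D0 * (Q + 1)" using D0(2) by linarith
  then have "q < Q + 1" by (metis mult.commute mult_less_cancel1)
  then show ?thesis by simp
qed

text \<open>\<open>dm\<close> includes slack for one response and one gadget, so that degree bounds
  persist while a step is being carried out.\<close>

lemma live_degree:
  assumes i: "Inv q \<phi> D A M B" and v: "v \<in> live \<phi> D A" and l: "l \<le> c + (4 * b + 5)"
  shows "degree B v + b * l \<le> dm"
proof -
  have "b * c * q \<le> b * c * Q" using Inv_le_Q[OF i] by (rule mult_le_mono2)
  moreover have "b * l \<le> b * (c + (4 * b + 5))" using l by (rule mult_le_mono2)
  ultimately show ?thesis using InvD(5)[OF i v] dm by linarith
qed

text \<open>A top in \<open>J\<close> is still unplaced, belongs to an unfilled gadget, or has been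
  given up or filled early in one of the few responses. The first two kinds are covered by the
  reserve of free vertices, which is therefore never much smaller than
  \<open>card J\<close>.\<close>

lemma card_J_le:
  assumes i: "Inv q \<phi> D A M B"
  shows "card J \<le> c * Q + card A + card (V - D)" "card (Fr \<phi> D A) = card A + card (V - D)"
proof -
  note e = InvD(2)[OF i]
  have fin: "finite A" "finite D" using finD[OF e] by auto
  have "J \<subseteq> {j \<in> J. j \<in> D \<and> j \<notin> A} \<union> A \<union> (V - D)" using J_sub by blast
  then have "card J \<le> card ({j \<in> J. j \<in> D \<and> j \<notin> A} \<union> A \<union> (V - D))"
    using fin fin_J finV by (intro card_mono) auto
  also have "\<dots> \<le> card {j \<in> J. j \<in> D \<and> j \<notin> A} + card A + card (V - D)"
    by (meson add_le_mono1 card_Un_le le_trans)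
  finally have "card J \<le> c * q + card A + card (V - D)" using InvD(3)[OF i] by linarith
  moreover have "c * q \<le> c * Q" using Inv_le_Q[OF i] by (rule mult_le_mono2)
  ultimately show "card J \<le> c * Q + card A + card (V - D)" by linarith
  have "card (V - D) = n - card D" "card D \<le> n"
    using EmbD(2)[OF e] fin finV n by (simp_all add: card_Diff_subset card_mono)
  then show "card (Fr \<phi> D A) = card A + card (V - D)" using card_Fr[OF e] by linarith
qed

lemma Fr_large:
  assumes i: "Inv q \<phi> D A M B"
  shows "(2 * b + 6) * dm + (10 * b + 20) + c < card (Fr \<phi> D A)"
  using card_J_le[OF i] J_large by linarith

section \<open>Preservation of the invariant\<close>

lemma heavy_mono: "adv i M B M' B' \<Longrightarrow> heavy B \<subseteq> heavy B'"
proof -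
  assume a: "adv i M B M' B'"
  have "finite B'" using a adv_pos pos_finite by blast
  then have "degree B v \<le> degree B' v" for v
    unfolding degree_def using a by (intro card_mono) (auto simp: adv_def)
  then show ?thesis unfolding heavy_def using le_trans by blast
qed

lemma stage_mono:
  assumes "adv i M B M' B'" "F' \<subseteq> F"
  shows "card (heavy B - F) \<le> card (heavy B' - F')"
  using heavy_mono[OF assms(1)] assms(2) fin_heavy by (intro card_mono) auto

lemma stage_less:
  assumes "adv i M B M' B'" "F' \<subseteq> F" "v \<in> heavy B" "v \<in> F" "v \<notin> F'"
  shows "card (heavy B - F) < card (heavy B' - F')"
  using heavy_mono[OF assms(1)] assms(2-) fin_heavy by (intro psubset_card_mono) auto

text \<open>When no live vertex is heavy, the live degrees are below \<open>D0\<close>, and the few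
  moves of the step fit into the constant term of the degree bound, so \<open>q\<close> is not
  charged. The last hypothesis pays for the moves: one per new role, and \<open>4 * b + 5\<close>
  extra per new gadget.\<close>

lemma Inv_regular:
  assumes i: "Inv q \<phi> D A M B" and light: "live \<phi> D A \<inter> heavy B = {}"
    and a: "adv l M B M' B'" "l \<le> 4 * b + 5" and e: "Emb \<phi>' D' A' M'" and s: "shrinks \<phi> D A \<phi>' D' A'"
    and J1: "{j \<in> J. j \<in> D' \<and> j \<notin> A'} \<subseteq> {j \<in> J. j \<in> D \<and> j \<notin> A}"
    and J2: "l + card D + (4 * b + 5) * card (J \<inter> D) \<le> card D' + (4 * b + 5) * card (J \<inter> D')"
  shows "Inv q \<phi>' D' A' M' B'"
  unfolding Inv_def
proof (intro conjI ballI)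
  show "pos M' B'" by (rule adv_pos[OF a(1)])
  show "Emb \<phi>' D' A' M'" by (rule e)
  have "card {j \<in> J. j \<in> D' \<and> j \<notin> A'} \<le> card {j \<in> J. j \<in> D \<and> j \<notin> A}" using J1 fin_J by (intro card_mono) auto
  then show "card {j \<in> J. j \<in> D' \<and> j \<notin> A'} \<le> c * q" using InvD(3)[OF i] by linarith
  have "card M' \<le> card M + l" using a by (simp add: adv_def)
  then show "card M' \<le> card D' + (4 * b + 5) * card (J \<inter> D') + c * q" using InvD(4)[OF i] J2 by linarith
  show "degree B' v \<le> D0 + b * (4 * b + 5) + b * c * q" if "v \<in> live \<phi>' D' A'" for v
  proof -
    have v: "v \<in> live \<phi> D A" using that s by (auto simp: shrinks_def)
    then have "v < n" using live_lt[OF InvD(2)[OF i]] by auto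
    then have "degree B v < D0" using v light by (auto simp: heavy_def)
    moreover have "degree B' v \<le> degree B v + b * l" by (rule adv_degree[OF a(1)])
    moreover have "b * l \<le> b * (4 * b + 5)" using a(2) by (rule mult_le_mono2)
    ultimately show ?thesis by linarith
  qed
  have s': "Fr \<phi>' D' A' \<subseteq> Fr \<phi> D A" "Fr \<phi>' D' A' \<union> SA \<phi>' A' \<subseteq> Fr \<phi> D A \<union> SA \<phi> A" "live \<phi>' D' A' \<subseteq> live \<phi> D A"
    using s by (auto simp: shrinks_def)
  show "q \<le> retired \<phi>' D' A' B'"
    using InvD(6)[OF i] stage_mono[OF a(1) s'(1)] stage_mono[OF a(1) s'(2)] stage_mono[OF a(1) s'(3)] by linarith
qed

text \<open>Degrees never fall and the three sets only shrink, so \<open>v\<close> counts as retired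
  from now on. One increment of \<open>q\<close> pays for up to \<open>c\<close> moves, up to
  \<open>c\<close> lost gadgets, and \<open>b * c\<close> in every degree.\<close>

lemma Inv_danger:
  assumes i: "Inv q \<phi> D A M B" and v: "v \<in> heavy B"
    and a: "adv l M B M' B'" "l \<le> c" and e: "Emb \<phi>' D' A' M'" and s: "shrinks \<phi> D A \<phi>' D' A'"
    and D: "D \<subseteq> D'" and J1: "card (D' - D) + card (A - A') \<le> c"
    and out: "v \<in> Fr \<phi> D A \<and> v \<notin> Fr \<phi>' D' A' \<or> v \<in> Fr \<phi> D A \<union> SA \<phi> A \<and> v \<notin> Fr \<phi>' D' A' \<union> SA \<phi>' A'
      \<or> v \<in> live \<phi> D A \<and> v \<notin> live \<phi>' D' A'"
  shows "Inv (Suc q) \<phi>' D' A' M' B'"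
  unfolding Inv_def
proof (intro conjI ballI)
  show "pos M' B'" by (rule adv_pos[OF a(1)])
  show "Emb \<phi>' D' A' M'" by (rule e)
  have fin: "finite D'" "finite A" using finD[OF e] finD[OF InvD(2)[OF i]] by auto
  have "{j \<in> J. j \<in> D' \<and> j \<notin> A'} \<subseteq> {j \<in> J. j \<in> D \<and> j \<notin> A} \<union> ((D' - D) \<union> (A - A'))" by blast
  then have "card {j \<in> J. j \<in> D' \<and> j \<notin> A'} \<le> card ({j \<in> J. j \<in> D \<and> j \<notin> A} \<union> ((D' - D) \<union> (A - A')))"
    using fin fin_J by (intro card_mono) auto
  also have "\<dots> \<le> card {j \<in> J. j \<in> D \<and> j \<notin> A} + (card (D' - D) + card (A - A'))"
    by (meson add_left_mono card_Un_le le_trans)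
  finally show "card {j \<in> J. j \<in> D' \<and> j \<notin> A'} \<le> c * Suc q" using InvD(3)[OF i] J1 by simp
  have "card M' \<le> card M + c" using a by (simp add: adv_def)
  moreover have "card D \<le> card D'" using D fin by (simp add: card_mono)
  moreover have "(4 * b + 5) * card (J \<inter> D) \<le> (4 * b + 5) * card (J \<inter> D')"
    using D fin_J by (intro mult_le_mono2 card_mono) auto
  ultimately show "card M' \<le> card D' + (4 * b + 5) * card (J \<inter> D') + c * Suc q" using InvD(4)[OF i] unfolding mult_Suc_right by linarith
  show "degree B' v \<le> D0 + b * (4 * b + 5) + b * c * Suc q" if "v \<in> live \<phi>' D' A'" for v
  proof -
    have v: "v \<in> live \<phi> D A" using that s by (auto simp: shrinks_def)
    have "b * l \<le> b * c" using a(2) by (rule mult_le_mono2)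
    then have "degree B' v \<le> degree B v + b * c" using adv_degree[OF a(1), of v] by linarith
    then show ?thesis using InvD(5)[OF i v] by simp
  qed
  have s': "Fr \<phi>' D' A' \<subseteq> Fr \<phi> D A" "Fr \<phi>' D' A' \<union> SA \<phi>' A' \<subseteq> Fr \<phi> D A \<union> SA \<phi> A" "live \<phi>' D' A' \<subseteq> live \<phi> D A"
    using s by (auto simp: shrinks_def)
  have "retired \<phi> D A B
    < retired \<phi>' D' A' B'"
    using out
  proof (elim disjE conjE)
    assume "v \<in> Fr \<phi> D A" "v \<notin> Fr \<phi>' D' A'"
    then show ?thesis using stage_less[OF a(1) s'(1) v] stage_mono[OF a(1) s'(2)] stage_mono[OF a(1) s'(3)] by linarith
  next
    assume "v \<in> Fr \<phi> D A \<union> SA \<phi> A" "v \<notin> Fr \<phi>' D' A' \<union> SA \<phi>' A'"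
    then show ?thesis using stage_mono[OF a(1) s'(1)] stage_less[OF a(1) s'(2) v] stage_mono[OF a(1) s'(3)] by linarith
  next
    assume "v \<in> live \<phi> D A" "v \<notin> live \<phi>' D' A'"
    then show ?thesis using stage_mono[OF a(1) s'(1)] stage_mono[OF a(1) s'(2)] stage_less[OF a(1) s'(3) v] by linarith
  qed
  then show "Suc q \<le> retired \<phi>' D' A' B'"
    using InvD(6)[OF i] by linarith
qed

text \<open>The factor 2 makes the measure drop also when a new gadget enters \<open>A\<close>,
  since its roles leave \<open>V - D\<close> at the same time. Filling lowers the second term
  alone.\<close>

definition progress :: "nat set \<Rightarrow> nat set \<Rightarrow> nat set set \<Rightarrow> nat set set \<Rightarrow> bool" where
  "progress D A M B \<longleftrightarrow> (\<exists>q \<phi> D' A'. Inv q \<phi> D' A' M B \<and> 2 * card (V - D') + card A' < 2 * card (V - D) + card A)"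

section \<open>Responses to heavy vertices\<close>

lemma c_ge_2: "2 \<le> c"
  using c_ge by simp

text \<open>Two dangers are met by the same move: a heavy free vertex \<open>w\<close> leaves
  \<open>Fr\<close>, and a heavy vertex of the gadget leaves \<open>Fr \<union> SA\<close>. The
  latter may still be open and call for another response.\<close>

lemma step_fill:
  assumes i: "Inv q \<phi> D A M B" and j: "j \<in> A" and w: "w \<in> Fr \<phi> D A"
    and free: "\<And>x. x \<in> S \<phi> j \<Longrightarrow> {w, x} \<notin> B" and v: "v \<in> heavy B" "v = w \<or> v \<in> S \<phi> j"
  shows "force (progress D A) M B"
proof -
  note e = InvD(2)[OF i]
  have wn: "w < n" "w \<notin> S \<phi> j" using w S_sub_n[OF e j] by (auto simp: Fr_def)
  have "force (\<lambda>M' B'. adv 2 M B M' B' \<and> (\<exists>f. completion k (\<lambda>t. \<phi> (ro j t)) w M' f)) M B"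
    using InvD(1)[OF i] EmbD(9)[OF e j] S_sub_lt[OF e j] wn free
    by (intro fill_gadget) (auto simp: S_def)
  then show ?thesis
  proof (rule force_mono)
    fix M' B' assume "adv 2 M B M' B' \<and> (\<exists>f. completion k (\<lambda>t. \<phi> (ro j t)) w M' f)"
    then obtain f where a: "adv 2 M B M' B'" and f: "completion k (\<lambda>t. \<phi> (ro j t)) w M' f" by blast
    obtain \<phi>' where \<phi>': "Emb \<phi>' D (A - {j}) M'" "Fr \<phi>' D (A - {j}) = Fr \<phi> D A - {w}"
      "SA \<phi>' (A - {j}) \<subseteq> SA \<phi> A - S \<phi> j" "shrinks \<phi> D A \<phi>' D (A - {j})"
      using Emb_fill[OF Emb_mono[OF e adv_subset[OF a]] j w f] by blast
    have finA: "finite A" using finD[OF e] by simp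
    have "Inv (Suc q) \<phi>' D (A - {j}) M' B'"
    proof (rule Inv_danger[OF i v(1) a c_ge_2 \<phi>'(1,4)])
      have "card (A - (A - {j})) \<le> 1" using j by (simp add: double_diff)
      then show "card (D - D) + card (A - (A - {j})) \<le> c" using c_ge by simp
      have "v \<in> S \<phi> j \<Longrightarrow> v \<notin> Fr \<phi> D A" using S_sub_n[OF e j] by (auto simp: Fr_def)
      then show "v \<in> Fr \<phi> D A \<and> v \<notin> Fr \<phi>' D (A - {j}) \<or>
        v \<in> Fr \<phi> D A \<union> SA \<phi> A \<and> v \<notin> Fr \<phi>' D (A - {j}) \<union> SA \<phi>' (A - {j}) \<or>
        v \<in> live \<phi> D A \<and> v \<notin> live \<phi>' D (A - {j})"
        using v(2) w \<phi>'(2,3) j unfolding SA_def by blast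
    qed simp
    moreover have "card (A - {j}) < card A" using j finA by (rule card_Diff1_less[rotated])
    ultimately show "progress D A M' B'" unfolding progress_def by fastforce
  qed
qed

lemma measure_less:
  assumes "D \<subseteq> D'" "D' \<subseteq> V" "x \<in> D'" "x \<notin> D"
  shows "2 * card (V - D') + card A < 2 * card (V - D) + card A"
proof -
  have "card (V - D') < card (V - D)" using assms finV by (intro psubset_card_mono) auto
  then show ?thesis by simp
qed

text \<open>The vertex \<open>v\<close> is used for any missing child. If that child is the top of a
  planned gadget, the gadget is given up, a loss charged to this response.\<close>

lemma step_attach:
  assumes i: "Inv q \<phi> D A M B" and v: "v \<in> Fr \<phi> D A" "v \<in> heavy B"
    and r: "r \<in> D" "r' \<in> ch r" "r' \<notin> D" and free: "{v, \<phi> r} \<notin> B"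
  shows "force (progress D A) M B"
proof -
  note e = InvD(2)[OF i]
  have "r \<in> D - hole ` A" using open_not_hole[OF e r(1)] r by blast
  then have \<phi>r: "\<phi> r < n" "\<phi> r \<notin> Fr \<phi> D A" using EmbD(7)[OF e] by (auto simp: Fr_def)
  have vn: "v < n" using v(1) by (simp add: Fr_def)
  have "force (\<lambda>M' B'. adv 1 M B M' B' \<and> {v, \<phi> r} \<in> M') M B"
    using InvD(1)[OF i] free \<phi>r v vn by (intro force_claim) (auto simp: edge_in_complete)
  then show ?thesis
  proof (rule force_mono)
    fix M' B' assume *: "adv 1 M B M' B' \<and> {v, \<phi> r} \<in> M'"
    then have a: "adv 1 M B M' B'" by blast
    have pr: "par r' = r" "r' \<in> V" using r(2) by (auto simp: ch_iff)
    have ed: "{\<phi> (par r'), v} \<in> M'" using * pr by (simp add: insert_commute)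
    note x = Emb_extend[OF Emb_mono[OF e adv_subset[OF a]] pr(2) r(3) _ v(1) ed]
    have x1: "Emb (\<phi>(r' := v)) (insert r' D) A M'" "shrinks \<phi> D A (\<phi>(r' := v)) (insert r' D) A"
      "Fr (\<phi>(r' := v)) (insert r' D) A = Fr \<phi> D A - {v}" using x pr r(1) by auto
    have "Inv (Suc q) (\<phi>(r' := v)) (insert r' D) A M' B'"
    proof (rule Inv_danger[OF i v(2) a _ x1(1,2)])
      show "card (insert r' D - D) + card (A - A) \<le> c" using r(3) c_ge by (simp add: insert_Diff_if)
      show "v \<in> Fr \<phi> D A \<and> v \<notin> Fr (\<phi>(r' := v)) (insert r' D) A \<or>
        v \<in> Fr \<phi> D A \<union> SA \<phi> A \<and> v \<notin> Fr (\<phi>(r' := v)) (insert r' D) A \<union> SA (\<phi>(r' := v)) A \<or>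
        v \<in> live \<phi> D A \<and> v \<notin> live (\<phi>(r' := v)) (insert r' D) A"
        using v(1) x1(3) by blast
    qed (use c_ge in auto)
    then show "progress D A M' B'"
      unfolding progress_def using measure_less[of D "insert r' D" r' A] EmbD(2)[OF x1(1)] r(3) by blast
  qed
qed

text \<open>Breaker may have joined \<open>v\<close> to every open vertex. He cannot also separate a
  fresh neighbour \<open>a\<close> of \<open>\<phi> r\<close> from all \<open>b + 1\<close> leaves
  \<open>z\<close> of a star at \<open>v\<close>, so \<open>v\<close> can play \<open>r3\<close>,
  with \<open>a\<close> and \<open>z\<close> playing the two roles in between. The star takes
  \<open>b + 1\<close> moves and the connection two.\<close>

lemma step_chain:
  assumes i: "Inv q \<phi> D A M B" and v: "v \<in> Fr \<phi> D A" "v \<in> heavy B"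
    and r: "r \<in> D" "r1 \<in> ch r" "r1 \<notin> D" "r2 \<in> ch r1" "r3 \<in> ch r2"
  shows "force (progress D A) M B"
proof -
  note e = InvD(2)[OF i]
  define F where "F = Fr \<phi> D A - {v}"
  have cF: "card (Fr \<phi> D A) = Suc (card F)" unfolding F_def using v fin_Fr by (intro card.remove)
  have big: "(2 * b + 6) * dm + (10 * b + 20) \<le> card F" using Fr_large[OF i] cF by linarith
  have FF: "F \<subseteq> Fr \<phi> D A" by (auto simp: F_def)
  have Fn: "F \<subseteq> {..<n}" "v \<notin> F" "v < n" using v by (auto simp: F_def Fr_def)
  have ronh: "r \<in> D - hole ` A" using open_not_hole[OF e r(1)] r by blast
  then have \<phi>r: "\<phi> r < n" "\<phi> r \<notin> Fr \<phi> D A" using EmbD(7)[OF e] by (auto simp: Fr_def)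
  have \<phi>r_live: "\<phi> r \<in> live \<phi> D A" using r by (auto simp: live_def Op_def)
  have Fr_live: "x \<in> live \<phi> D A" if "x \<in> Fr \<phi> D A" for x using that by (simp add: live_def)
  have dmF: "dm + (10 * b + 20) \<le> card F"
  proof -
    have "1 * dm \<le> (2 * b + 6) * dm" by (intro mult_le_mono1) simp
    then show ?thesis using big by linarith
  qed
  have "degree B v + b * (b + 1) \<le> dm"
    using v by (intro live_degree[OF i Fr_live]) auto
  then have "degree B v + b * (b + 1) + (b + 1) < card F" using dmF by linarith
  then have star: "force (\<lambda>M' B'. adv (b + 1) M B M' B' \<and> (\<exists>Z\<subseteq>F. card Z = b + 1 \<and> (\<forall>z\<in>Z. {v, z} \<in> M'))) M B"
    using InvD(1)[OF i] Fn by (intro claim_star) auto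
  have "force (\<lambda>M' B'. adv (b + 3) M B M' B' \<and>
     (\<exists>a z. a \<in> F \<and> z \<in> F \<and> a \<noteq> z \<and> {\<phi> r, a} \<in> M' \<and> {a, z} \<in> M' \<and> {z, v} \<in> M')) M B"
  proof (rule force_adv_trans[OF star, where j = 2])
    fix M1 B1 assume a1: "adv (b + 1) M B M1 B1" and "\<exists>Z\<subseteq>F. card Z = b + 1 \<and> (\<forall>z\<in>Z. {v, z} \<in> M1)"
    then obtain Z where Z: "Z \<subseteq> F" "card Z = b + 1" "\<forall>z\<in>Z. {v, z} \<in> M1" by blast
    have finZ: "finite Z" using finite_subset[OF Z(1) finite_subset[OF Fn(1)]] by simp
    have d1: "degree B1 x \<le> dm" if "x \<in> live \<phi> D A" for x
      using adv_degree[OF a1, of x] live_degree[OF i that, of "b + 1"] by simp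
    have "(card Z + 1) * dm \<le> (2 * b + 6) * dm" unfolding Z(2) by (intro mult_le_mono1) simp
    then have "(card Z + 1) * dm + card Z < card F" using big Z(2) by linarith
    then have "force (\<lambda>M' B'. adv 2 M1 B1 M' B' \<and> (\<exists>a\<in>F - Z. \<exists>z\<in>Z. {\<phi> r, a} \<in> M' \<and> {a, z} \<in> M')) M1 B1"
      using adv_pos[OF a1] \<phi>r \<phi>r_live Fn FF Z finZ Fr_live d1
      by (intro claim_via[where d = dm]) auto
    then show "force (\<lambda>M' B'. adv 2 M1 B1 M' B' \<and>
     (\<exists>a z. a \<in> F \<and> z \<in> F \<and> a \<noteq> z \<and> {\<phi> r, a} \<in> M' \<and> {a, z} \<in> M' \<and> {z, v} \<in> M')) M1 B1"
    proof (rule force_mono)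
      fix M' B' assume "adv 2 M1 B1 M' B' \<and> (\<exists>a\<in>F - Z. \<exists>z\<in>Z. {\<phi> r, a} \<in> M' \<and> {a, z} \<in> M')"
      then obtain a z where *: "adv 2 M1 B1 M' B'" "a \<in> F - Z" "z \<in> Z" "{\<phi> r, a} \<in> M'" "{a, z} \<in> M'" by blast
      moreover have "{z, v} \<in> M'" using Z(3) *(3) adv_subset[OF *(1)] by (auto simp: insert_commute)
      ultimately show "adv 2 M1 B1 M' B' \<and>
        (\<exists>a z. a \<in> F \<and> z \<in> F \<and> a \<noteq> z \<and> {\<phi> r, a} \<in> M' \<and> {a, z} \<in> M' \<and> {z, v} \<in> M')" using Z(1) by blast
    qed
  qed simp
  then show ?thesis
  proof (rule force_mono)
    fix M' B' assume "adv (b + 3) M B M' B' \<and>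
     (\<exists>a z. a \<in> F \<and> z \<in> F \<and> a \<noteq> z \<and> {\<phi> r, a} \<in> M' \<and> {a, z} \<in> M' \<and> {z, v} \<in> M')"
    then obtain a z where adv: "adv (b + 3) M B M' B'" and az: "a \<in> F" "z \<in> F" "a \<noteq> z"
      and ed: "{\<phi> r, a} \<in> M'" "{a, z} \<in> M'" "{z, v} \<in> M'" by blast
    have p: "par r1 = r" "par r2 = r1" "par r3 = r2" "r1 \<in> V" "r2 \<in> V" "r3 \<in> V" "r1 \<noteq> root" "r2 \<noteq> root" "r3 \<noteq> root"
      using r by (auto simp: ch_iff)
    have r2D: "r2 \<notin> D" using EmbD(3)[OF e, of r2] p r(3) by auto
    then have r3D: "r3 \<notin> D" using EmbD(3)[OF e, of r3] p by auto
    have hh: "h r1 < h r2" "h r2 < h r3" using par_less[of r2] par_less[of r3] p by auto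
    then have ne: "r1 \<noteq> r2" "r2 \<noteq> r3" "r1 \<noteq> r3" by auto
    define \<phi>1 where "\<phi>1 = \<phi>(r1 := a)"
    define \<phi>2 where "\<phi>2 = \<phi>1(r2 := z)"
    define \<phi>3 where "\<phi>3 = \<phi>2(r3 := v)"
    have x1: "Emb \<phi>1 (insert r1 D) A M'" "shrinks \<phi> D A \<phi>1 (insert r1 D) A"
      "Fr \<phi>1 (insert r1 D) A = Fr \<phi> D A - {a}"
      unfolding \<phi>1_def
      using Emb_extend[OF Emb_mono[OF e adv_subset[OF adv]], of r1 a] p r ed az FF by auto
    have zF: "z \<in> Fr \<phi>1 (insert r1 D) A" unfolding x1(3) using az FF by blast
    have pD: "par r2 \<in> insert r1 D" "r2 \<notin> insert r1 D" "{\<phi>1 (par r2), z} \<in> M'"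
      using p ne r2D ed by (simp_all add: \<phi>1_def)
    note x2 = Emb_extend[OF x1(1) p(5) pD(2,1) zF pD(3), folded \<phi>2_def]
    have vF: "v \<in> Fr \<phi>2 (insert r2 (insert r1 D)) A" unfolding x2(3) x1(3) using v az by (auto simp: F_def)
    have qD: "par r3 \<in> insert r2 (insert r1 D)" "r3 \<notin> insert r2 (insert r1 D)" "{\<phi>2 (par r3), v} \<in> M'"
      using p ne r3D ed by (simp_all add: \<phi>2_def)
    note x3 = Emb_extend[OF x2(1) p(6) qD(2,1) vF qD(3), folded \<phi>3_def]
    define D3 where "D3 = insert r3 (insert r2 (insert r1 D))"
    have sh: "shrinks \<phi> D A \<phi>3 D3 A"
      unfolding D3_def using shrinks_trans[OF shrinks_trans[OF x1(2) x2(2)] x3(2)] .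
    have "Inv (Suc q) \<phi>3 D3 A M' B'"
    proof (rule Inv_danger[OF i v(2) adv _ x3(1)[folded D3_def] sh])
      have "card (D3 - D) \<le> card {r1, r2, r3}" by (intro card_mono) (auto simp: D3_def)
      also have "\<dots> = 3" using ne by simp
      finally show "card (D3 - D) + card (A - A) \<le> c" using c_ge by simp
      show "v \<in> Fr \<phi> D A \<and> v \<notin> Fr \<phi>3 D3 A \<or>
        v \<in> Fr \<phi> D A \<union> SA \<phi> A \<and> v \<notin> Fr \<phi>3 D3 A \<union> SA \<phi>3 A \<or> v \<in> live \<phi> D A \<and> v \<notin> live \<phi>3 D3 A"
        using v(1) x3(3) unfolding D3_def by blast
    qed (use c_ge in \<open>auto simp: D3_def\<close>)
    then show "progress D A M' B'"
      unfolding progress_def using measure_less[of D D3 r1 A] EmbD(2)[OF x3(1)] r(3) unfolding D3_def by blast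
  qed
qed

abbreviation extends :: "(nat \<Rightarrow> nat) \<Rightarrow> nat set \<Rightarrow> nat set \<Rightarrow> nat \<Rightarrow> nat set \<Rightarrow> nat set set \<Rightarrow> bool" where
  "extends \<phi> D A r C M \<equiv> \<exists>\<phi>'. Emb \<phi>' (D \<union> C) A M \<and> shrinks \<phi> D A \<phi>' (D \<union> C) A \<and> \<phi>' r = \<phi> r \<and> SA \<phi>' A = SA \<phi> A"

lemma embed_children:
  assumes e: "Emb \<phi> D A M" and p: "pos M B" and r: "r \<in> D - hole ` A"
    and C: "finite C" "C \<subseteq> ch r - D" and d: "degree B (\<phi> r) + b * card C \<le> dm" and F: "dm + card C < card (Fr \<phi> D A)"
  shows "force (\<lambda>M' B'. adv (card C) M B M' B' \<and> extends \<phi> D A r C M') M B"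
  using C d F
proof (induction C rule: finite_induct)
  case empty
  show ?case
  proof (intro force.stop conjI exI)
    show "adv (card {}) M B M B" using p by (rule adv_refl)
    show "Emb \<phi> (D \<union> {}) A M" using e by simp
    show "shrinks \<phi> D A \<phi> (D \<union> {}) A" using shrinks_refl by simp
  qed auto
next
  case (insert x C)
  have cI: "card (insert x C) = Suc (card C)" using insert.hyps by simp
  have IH: "force (\<lambda>M' B'. adv (card C) M B M' B' \<and> extends \<phi> D A r C M') M B"
    using insert.prems cI by (intro insert.IH) auto
  show ?case
  proof (rule force_adv_trans[OF IH, where j = 1])
    fix M1 B1 assume a1: "adv (card C) M B M1 B1" and "\<exists>\<phi>'. Emb \<phi>' (D \<union> C) A M1 \<and> shrinks \<phi> D A \<phi>' (D \<union> C) A \<and>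
      \<phi>' r = \<phi> r \<and> SA \<phi>' A = SA \<phi> A"
    then obtain \<phi>' where \<phi>': "Emb \<phi>' (D \<union> C) A M1" "shrinks \<phi> D A \<phi>' (D \<union> C) A" "\<phi>' r = \<phi> r" "SA \<phi>' A = SA \<phi> A" by blast
    have r': "r \<in> D \<union> C - hole ` A" using r by blast
    then have \<phi>r: "\<phi>' r < n" "\<phi>' r \<notin> Fr \<phi>' (D \<union> C) A" using EmbD(7)[OF \<phi>'(1)] by (auto simp: Fr_def)
    have DC: "D \<inter> C = {}" using insert.prems by blast
    have "card (D \<union> C) = card D + card C" using finD[OF e] insert.hyps DC by (simp add: card_Un_disjoint)
    then have cFr: "card (Fr \<phi>' (D \<union> C) A) + card C = card (Fr \<phi> D A)"
      using card_Fr[OF \<phi>'(1)] card_Fr[OF e] by linarith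
    have "degree B1 (\<phi> r) \<le> degree B (\<phi> r) + b * card C" by (rule adv_degree[OF a1])
    also have "\<dots> \<le> dm" using insert.prems(2) cI by simp
    finally have "degree B1 (\<phi>' r) + card {} < card (Fr \<phi>' (D \<union> C) A)"
      using \<phi>'(3) cFr insert.prems(3) cI by simp
    then have "force (\<lambda>M' B'. adv 1 M1 B1 M' B' \<and> (\<exists>w\<in>Fr \<phi>' (D \<union> C) A - {}. {\<phi>' r, w} \<in> M')) M1 B1"
      using adv_pos[OF a1] \<phi>r Fr_lt by (intro claim_nonadjacent) auto
    then show "force (\<lambda>M' B'. adv 1 M1 B1 M' B' \<and> extends \<phi> D A r (insert x C) M') M1 B1"
    proof (rule force_mono)
      fix M' B' assume "adv 1 M1 B1 M' B' \<and> (\<exists>w\<in>Fr \<phi>' (D \<union> C) A - {}. {\<phi>' r, w} \<in> M')"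
      then obtain w where a2: "adv 1 M1 B1 M' B'" and w: "w \<in> Fr \<phi>' (D \<union> C) A" "{\<phi>' r, w} \<in> M'" by blast
      have x: "x \<in> V" "x \<notin> D \<union> C" "par x = r" using insert.prems(1) insert.hyps by (auto simp: ch_iff)
      have "Emb (\<phi>'(x := w)) (insert x (D \<union> C)) A M'" "shrinks \<phi>' (D \<union> C) A (\<phi>'(x := w)) (insert x (D \<union> C)) A"
        "SA (\<phi>'(x := w)) A = SA \<phi>' A"
        using Emb_extend[OF Emb_mono[OF \<phi>'(1) adv_subset[OF a2]], of x w] x w r by auto
      then have "Emb (\<phi>'(x := w)) (D \<union> insert x C) A M' \<and> shrinks \<phi> D A (\<phi>'(x := w)) (D \<union> insert x C) A \<and>
        (\<phi>'(x := w)) r = \<phi> r \<and> SA (\<phi>'(x := w)) A = SA \<phi> A"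
        using shrinks_trans[OF \<phi>'(2)] \<phi>'(3,4) x r by auto
      then show "adv 1 M1 B1 M' B' \<and> extends \<phi> D A r (insert x C) M'" using a2 by blast
    qed
  qed (simp add: cI)
qed

text \<open>Once all children are placed, Breaker edges at the vertex do no harm, and it leaves
  \<open>live\<close>. A vertex of an unfilled gadget would stay in \<open>SA\<close>, which is why
  such vertices are excluded here and treated by \<open>step_fill\<close> instead.\<close>

lemma step_open:
  assumes i: "Inv q \<phi> D A M B" and r: "r \<in> D" "\<not> ch r \<subseteq> D" and v: "\<phi> r \<in> heavy B" "\<phi> r \<notin> SA \<phi> A"
  shows "force (progress D A) M B"
proof -
  note e = InvD(2)[OF i]
  define C where "C = ch r - D"
  have finC: "finite C" using fin_ch by (simp add: C_def)
  have "card C \<le> card (ch r)" unfolding C_def using fin_ch by (intro card_mono) auto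
  also have "\<dots> \<le> \<Delta>" using r EmbD(2)[OF e] by (intro ch_le) auto
  finally have cC: "card C \<le> c" using c_ge by simp
  have r': "r \<in> D - hole ` A" by (rule open_not_hole[OF e r])
  have lv: "\<phi> r \<in> live \<phi> D A" using r by (auto simp: live_def Op_def)
  have "1 * dm \<le> (2 * b + 6) * dm" by (intro mult_le_mono1) simp
  then have "dm + card C < card (Fr \<phi> D A)" using Fr_large[OF i] cC by linarith
  then have "force (\<lambda>M' B'. adv (card C) M B M' B' \<and> extends \<phi> D A r C M') M B"
    using live_degree[OF i lv, of "card C"] cC finC InvD(1)[OF i] r'
    by (intro embed_children[OF e]) (auto simp: C_def)
  then show ?thesis
  proof (rule force_mono)
    fix M' B' assume "adv (card C) M B M' B' \<and> extends \<phi> D A r C M'"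
    then obtain \<phi>' where a: "adv (card C) M B M' B'" and \<phi>': "Emb \<phi>' (D \<union> C) A M'" "shrinks \<phi> D A \<phi>' (D \<union> C) A"
      "\<phi>' r = \<phi> r" "SA \<phi>' A = SA \<phi> A" by blast
    have "\<phi> r \<notin> live \<phi>' (D \<union> C) A"
    proof -
      have "\<phi> r \<notin> Fr \<phi> D A" using r' by (simp add: Fr_def)
      then have "\<phi> r \<notin> Fr \<phi>' (D \<union> C) A" using \<phi>'(2) by (auto simp: shrinks_def)
      moreover have "\<phi> r \<notin> Op \<phi>' (D \<union> C)"
      proof
        assume "\<phi> r \<in> Op \<phi>' (D \<union> C)"
        then have "\<phi> r \<in> \<phi>' ` {x \<in> D \<union> C. \<not> ch x \<subseteq> D \<union> C}" unfolding Op_def .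
        then obtain x where "x \<in> {x \<in> D \<union> C. \<not> ch x \<subseteq> D \<union> C}" "\<phi> r = \<phi>' x" by (rule imageE)
        then have x: "x \<in> D \<union> C" "\<not> ch x \<subseteq> D \<union> C" "\<phi>' x = \<phi>' r" using \<phi>'(3) by simp_all
        have "r \<in> D \<union> C - hole ` A" using r' by blast
        then have "x = r" by (rule inj_onD[OF EmbD(6)[OF \<phi>'(1)] x(3) open_not_hole[OF \<phi>'(1) x(1,2)]])
        then show False using x(2) by (auto simp: C_def)
      qed
      ultimately show ?thesis using v(2) \<phi>'(4) by (simp add: live_def)
    qed
    then have "Inv (Suc q) \<phi>' (D \<union> C) A M' B'"
    proof (intro Inv_danger[OF i v(1) a cC \<phi>'(1,2)])
      have "D \<union> C - D = C" by (auto simp: C_def)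
      then show "card (D \<union> C - D) + card (A - A) \<le> c" using cC by simp
    qed (use lv in auto)
    moreover obtain x where "x \<in> C" using r(2) by (auto simp: C_def)
    ultimately show "progress D A M' B'"
      unfolding progress_def using measure_less[of D "D \<union> C" x A] EmbD(2)[OF \<phi>'(1)] C_def by blast
  qed
qed

text \<open>Breaker has at most \<open>dm\<close> edges at \<open>v\<close>, so among more than
  \<open>dm\<close> gadgets or more than \<open>dm\<close> open roles one is not cut off from
  \<open>v\<close>. If there are fewer of both, most roles are unplaced although few roles are open,
  so below some open role the tree is still deep enough for \<open>step_chain\<close>.\<close>

lemma step_free:
  assumes i: "Inv q \<phi> D A M B" and v: "v \<in> Fr \<phi> D A" "v \<in> heavy B"
  shows "force (progress D A) M B"
proof -
  note e = InvD(2)[OF i]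
  have finB: "finite B" using pos_finite[OF InvD(1)[OF i]] by simp
  have nb: "finite {u. {u, v} \<in> B}" "card {u. {u, v} \<in> B} \<le> dm"
    using card_nbs_le[OF finB, of v] live_degree[OF i, of v 0] v by (auto simp: live_def)
  define Og where "Og = {r \<in> D. \<not> ch r \<subseteq> D}"
  have finOg: "finite Og" using finD[OF e] by (simp add: Og_def)
  have finA: "finite A" using finD[OF e] by simp
  consider "card A > dm" | "card Og > dm" | "card A \<le> dm" "card Og \<le> dm" by linarith
  then show ?thesis
  proof cases
    case 1
    have "\<exists>j\<in>A. \<forall>x\<in>S \<phi> j. {v, x} \<notin> B"
    proof (rule ccontr)
      assume "\<not> ?thesis"
      then have "\<forall>j\<in>A. \<exists>x. x \<in> S \<phi> j \<and> {x, v} \<in> B" by (auto simp: insert_commute)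
      then obtain x where x: "\<And>j. j \<in> A \<Longrightarrow> x j \<in> S \<phi> j \<and> {x j, v} \<in> B" by metis
      have "inj_on x A" using x S_disjoint[OF e] by (intro inj_onI) (metis IntI empty_iff)
      moreover have "x ` A \<subseteq> {u. {u, v} \<in> B}" using x by blast
      ultimately have "card A \<le> card {u. {u, v} \<in> B}" using nb(1) card_inj_on_le by blast
      then show False using 1 nb(2) by linarith
    qed
    then obtain j where "j \<in> A" "\<And>x. x \<in> S \<phi> j \<Longrightarrow> {v, x} \<notin> B" by blast
    then show ?thesis using v by (intro step_fill[OF i _ v(1), of j v]) auto
  next
    case 2
    have inj: "inj_on \<phi> Og" using open_not_hole[OF e] by (intro inj_on_subset[OF EmbD(6)[OF e]]) (auto simp: Og_def)
    have "\<exists>r\<in>Og. {\<phi> r, v} \<notin> B"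
    proof (rule ccontr)
      assume "\<not> ?thesis"
      then have "\<phi> ` Og \<subseteq> {u. {u, v} \<in> B}" by auto
      then have "card Og \<le> card {u. {u, v} \<in> B}" using nb(1) inj card_inj_on_le by blast
      then show False using 2 nb(2) by linarith
    qed
    then obtain r r' where r: "r \<in> D" "r' \<in> ch r" "r' \<notin> D" "{\<phi> r, v} \<notin> B" by (auto simp: Og_def)
    then show ?thesis by (intro step_attach[OF i v r(1-3)]) (simp add: insert_commute)
  next
    case 3
    have "\<exists>r r1 r2 r3. r \<in> D \<and> r1 \<in> ch r \<and> r1 \<notin> D \<and> r2 \<in> ch r1 \<and> r3 \<in> ch r2"
    proof (rule ccontr)
      assume no: "\<not> ?thesis"
      define U1 where "U1 = (\<Union>r\<in>Og. ch r)"
      define U2 where "U2 = (\<Union>r\<in>U1 - D. ch r)"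
      \<comment> \<open>Without three unplaced generations below an open role, every unplaced role
        is a child or a grandchild of an open one, and there are at most
        \<open>dm * (\<Delta> + \<Delta> * \<Delta>)\<close> of these.\<close>
      have U: "u \<in> U1 \<union> U2" if "u \<in> V - D" for u
        using that
      proof (induction "h u" arbitrary: u rule: less_induct)
        case less
        have nr: "u \<noteq> root" using less.prems EmbD(1)[OF e] by blast
        then have pu: "par u \<in> V" "h (par u) < h u" "u \<in> ch (par u)"
          using less.prems parV par_less by (auto simp: ch_iff)
        show ?case
        proof (cases "par u \<in> D")
          case True
          then have "par u \<in> Og" using pu(3) less.prems by (auto simp: Og_def)
          then show ?thesis using pu(3) by (auto simp: U1_def)
        next
          case False
          then have "par u \<in> U1 \<union> U2" using less.hyps pu by blast
          moreover have "par u \<notin> U2"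
          proof
            assume "par u \<in> U2"
            then obtain r1 where r1: "r1 \<in> U1" "r1 \<notin> D" "par u \<in> ch r1" by (auto simp: U2_def)
            then obtain r where "r \<in> Og" "r1 \<in> ch r" by (auto simp: U1_def)
            then show False using no r1 pu(3) by (auto simp: Og_def)
          qed
          ultimately show ?thesis using False pu(3) by (auto simp: U2_def)
        qed
      qed
      have U1V: "U1 \<subseteq> V" using ch_subset by (auto simp: U1_def)
      then have finU1: "finite U1" using finV finite_subset by blast
      have c1: "card U1 \<le> dm * \<Delta>"
      proof -
        have "card U1 \<le> (\<Sum>r\<in>Og. card (ch r))" unfolding U1_def using finOg by (rule card_UN_le)
        also have "\<dots> \<le> card Og * \<Delta>"
          using sum_bounded_above[of Og "\<lambda>r. card (ch r)" \<Delta>] ch_le EmbD(2)[OF e] by (auto simp: Og_def)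
        also have "\<dots> \<le> dm * \<Delta>" using 3(2) by (rule mult_le_mono1)
        finally show ?thesis .
      qed
      have c2: "card U2 \<le> dm * \<Delta> * \<Delta>"
      proof -
        have "card U2 \<le> (\<Sum>r\<in>U1 - D. card (ch r))" unfolding U2_def using finU1 by (intro card_UN_le) auto
        also have "\<dots> \<le> card (U1 - D) * \<Delta>"
          using sum_bounded_above[of "U1 - D" "\<lambda>r. card (ch r)" \<Delta>] ch_le U1V by auto
        also have "\<dots> \<le> card U1 * \<Delta>" using finU1 by (intro mult_le_mono1 card_mono) auto
        also have "\<dots> \<le> dm * \<Delta> * \<Delta>" using c1 by (rule mult_le_mono1)
        finally show ?thesis .
      qed
      have "finite U2" using finV ch_subset by (intro finite_subset[of U2 V]) (auto simp: U2_def)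
      then have "card (V - D) \<le> card (U1 \<union> U2)" using U finU1 by (intro card_mono) auto
      also have "\<dots> \<le> card U1 + card U2" by (rule card_Un_le)
      finally have "card (V - D) \<le> dm * \<Delta> + dm * \<Delta> * \<Delta>" using c1 c2 by linarith
      also have "\<dots> = dm * (\<Delta> + \<Delta> * \<Delta>)" by (simp add: algebra_simps)
      finally have vd: "card (V - D) \<le> dm * (\<Delta> + \<Delta> * \<Delta>)" .
      have "1 * dm \<le> (2 * b + 6) * dm" by (intro mult_le_mono1) simp
      then show False using vd card_J_le(1)[OF i] J_large 3(1) by linarith
    qed
    then obtain r r1 r2 r3 where "r \<in> D" "r1 \<in> ch r" "r1 \<notin> D" "r2 \<in> ch r1" "r3 \<in> ch r2" by blast
    then show ?thesis by (rule step_chain[OF i v])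
  qed
qed

section \<open>Placing roles when no live vertex is heavy\<close>

lemma step_regular:
  assumes i: "Inv q \<phi> D A M B" and light: "live \<phi> D A \<inter> heavy B = {}" and DV: "D \<noteq> V"
  shows "force (progress D A) M B"
proof -
  note e = InvD(2)[OF i]
  \<comment> \<open>An unplaced role of least rank has a placed parent.\<close>
  have "\<exists>r. r \<in> V - D" using DV EmbD(2)[OF e] by blast
  then obtain r where r: "r \<in> V - D" "\<And>x. h x < h r \<Longrightarrow> x \<notin> V - D"
    using ex_has_least_nat[of "\<lambda>r. r \<in> V - D" _ h] by (metis linorder_not_le)
  have nr: "r \<noteq> root" using r EmbD(1)[OF e] by blast
  have pr: "par r \<in> D" using r(2)[of "par r"] par_less[of r] parV[of r] r nr by blast
  have rc: "r \<in> ch (par r)" using r(1) nr by (auto simp: ch_iff)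
  define u where "u = \<phi> (par r)"
  have po: "par r \<in> D - hole ` A" using open_not_hole[OF e pr] rc r by blast
  then have u: "u < n" "u \<notin> Fr \<phi> D A" using EmbD(7)[OF e] by (auto simp: Fr_def u_def)
  have lu: "u \<in> live \<phi> D A" using pr rc r by (auto simp: live_def Op_def u_def)
  have F_live: "x \<in> live \<phi> D A" if "x \<in> insert u (Fr \<phi> D A)" for x using that lu by (auto simp: live_def)
  show ?thesis
  proof (cases "r \<in> J")
    case True
    have "(2 * b + 2) * dm \<le> (2 * b + 6) * dm" by (intro mult_le_mono1) simp
    then have big: "(2 * b + 2) * dm + (4 * b + 6) < card (Fr \<phi> D A)" using Fr_large[OF i] by linarith
    have "force (\<lambda>M' B'. adv (4 * b + 5) M B M' B' \<and> (\<exists>g. inj_on g ({..<k} - {1}) \<and> g ` ({..<k} - {1}) \<subseteq> Fr \<phi> D A \<and>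
       {u, g 0} \<in> M' \<and> gadget k g M')) M B"
      using k InvD(1)[OF i] u Fr_lt live_degree[OF i F_live] big
      by (intro build_gadget[where d = dm]) auto
    then show ?thesis
    proof (rule force_mono)
      fix M' B' assume "adv (4 * b + 5) M B M' B' \<and> (\<exists>g. inj_on g ({..<k} - {1}) \<and> g ` ({..<k} - {1}) \<subseteq> Fr \<phi> D A \<and>
        {u, g 0} \<in> M' \<and> gadget k g M')"
      then obtain g where a: "adv (4 * b + 5) M B M' B'" and g: "inj_on g ({..<k} - {1})" "g ` ({..<k} - {1}) \<subseteq> Fr \<phi> D A"
        "{u, g 0} \<in> M'" "gadget k g M'" by blast
      obtain \<phi>' where \<phi>': "Emb \<phi>' (D \<union> R r) (insert r A) M'" "shrinks \<phi> D A \<phi>' (D \<union> R r) (insert r A)"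
        using Emb_gadget[OF Emb_mono[OF e adv_subset[OF a]] True _ pr g(1,2) g(3)[unfolded u_def] g(4)] r by blast
      have finR: "finite (R r)" by (simp add: R_def)
      have JR: "J \<inter> (D \<union> R r) = insert r (J \<inter> D)"
        using R_disjoint[OF True] top_in_R True by blast
      have rA: "r \<notin> A" using EmbD(5)[OF e] top_in_R[OF True] r by blast
      have card_JR: "card (J \<inter> (D \<union> R r)) = Suc (card (J \<inter> D))"
        unfolding JR using fin_J r by simp
      have hR: "hole r \<notin> D \<and> hole r \<in> D \<union> R r"
      proof -
        have "hole r \<notin> D"
          using EmbD(3)[OF e, of "hole r"] par_ro[OF True, of 0] ro_0[OF True] k_ge r by (auto simp: hole_def)
        then show ?thesis using hole_in_R[OF True] by blast
      qed
      have D2: "card D + 2 \<le> card (D \<union> R r)"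
      proof -
        have "card (insert r (insert (hole r) D)) \<le> card (D \<union> R r)"
          using finD[OF e] finR top_in_R[OF True] hR by (intro card_mono) auto
        then show ?thesis using finD[OF e] hR r hole_neq_top[OF True] by auto
      qed
      have "Inv q \<phi>' (D \<union> R r) (insert r A) M' B'"
      proof (rule Inv_regular[OF i light a _ \<phi>'])
        show "{j \<in> J. j \<in> D \<union> R r \<and> j \<notin> insert r A} \<subseteq> {j \<in> J. j \<in> D \<and> j \<notin> A}" using JR by blast
        show "4 * b + 5 + card D + (4 * b + 5) * card (J \<inter> D)
          \<le> card (D \<union> R r) + (4 * b + 5) * card (J \<inter> (D \<union> R r))"
          unfolding card_JR using D2 by simp
      qed simp
      moreover have "2 * card (V - (D \<union> R r)) + card (insert r A) < 2 * card (V - D) + card A"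
      proof -
        have "card (V - (D \<union> R r)) < card (V - D)"
          using r top_in_R[OF True] finV by (intro psubset_card_mono) auto
        then show ?thesis using rA finD[OF e] by simp
      qed
      ultimately show "progress D A M' B'" unfolding progress_def by blast
    qed
  next
    case False
    have "1 * dm \<le> (2 * b + 6) * dm" by (intro mult_le_mono1) simp
    moreover have "degree B u + b * 0 \<le> dm" by (rule live_degree[OF i lu]) simp
    ultimately have "degree B u + card {} < card (Fr \<phi> D A)"
      unfolding card.empty using Fr_large[OF i] by linarith
    then have "force (\<lambda>M' B'. adv 1 M B M' B' \<and> (\<exists>w\<in>Fr \<phi> D A - {}. {u, w} \<in> M')) M B"
      using InvD(1)[OF i] u Fr_lt by (intro claim_nonadjacent) auto
    then show ?thesis
    proof (rule force_mono)
      fix M' B' assume "adv 1 M B M' B' \<and> (\<exists>w\<in>Fr \<phi> D A - {}. {u, w} \<in> M')"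
      then obtain w where a: "adv 1 M B M' B'" and w: "w \<in> Fr \<phi> D A" "{u, w} \<in> M'" by blast
      have x: "Emb (\<phi>(r := w)) (insert r D) A M'" "shrinks \<phi> D A (\<phi>(r := w)) (insert r D) A"
        using Emb_extend[OF Emb_mono[OF e adv_subset[OF a]], of r w] r pr w by (auto simp: u_def)
      have "Inv q (\<phi>(r := w)) (insert r D) A M' B'"
      proof (rule Inv_regular[OF i light a _ x])
        show "{j \<in> J. j \<in> insert r D \<and> j \<notin> A} \<subseteq> {j \<in> J. j \<in> D \<and> j \<notin> A}" using False by blast
        have "J \<inter> insert r D = J \<inter> D" using False by blast
        then show "1 + card D + (4 * b + 5) * card (J \<inter> D) \<le> card (insert r D) + (4 * b + 5) * card (J \<inter> insert r D)"
          using r finD[OF e] by simp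
      qed simp
      then show "progress D A M' B'"
        unfolding progress_def using measure_less[of D "insert r D" r A] EmbD(2)[OF x(1)] r by blast
    qed
  qed
qed

lemma step:
  assumes i: "Inv q \<phi> D A M B" and DV: "D \<noteq> V"
  shows "force (progress D A) M B"
proof -
  note e = InvD(2)[OF i]
  have finB: "finite B" using pos_finite[OF InvD(1)[OF i]] by simp
  consider "live \<phi> D A \<inter> heavy B = {}"
    | v j where "v \<in> heavy B" "j \<in> A" "v \<in> S \<phi> j"
    | v where "v \<in> heavy B" "v \<in> Fr \<phi> D A"
    | v where "v \<in> heavy B" "v \<in> Op \<phi> D" "v \<notin> SA \<phi> A"
    unfolding live_def SA_def by blast
  then show ?thesis
  proof cases
    case 1
    then show ?thesis by (rule step_regular[OF i _ DV])
  next
    case 2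
    have lS: "degree B x \<le> dm" if "x \<in> S \<phi> j" for x
      using live_degree[OF i, of x 0] that 2(2) by (auto simp: live_def SA_def)
    have "card (S \<phi> j) * dm \<le> (2 * b + 6) * dm" using card_S_le[of \<phi> j] k by (intro mult_le_mono1) auto
    then have "card (S \<phi> j) * dm + card {} < card (Fr \<phi> D A)"
      unfolding card.empty using Fr_large[OF i] by linarith
    then have "\<exists>w\<in>Fr \<phi> D A - {}. \<forall>x\<in>S \<phi> j. {w, x} \<notin> B"
      using finB lS by (intro exists_nonadjacent[where d = dm]) (auto simp: S_def)
    then obtain w where "w \<in> Fr \<phi> D A" "\<And>x. x \<in> S \<phi> j \<Longrightarrow> {w, x} \<notin> B" by blast
    then show ?thesis using 2 by (intro step_fill[OF i 2(2), of w v]) auto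
  next
    case 3
    then show ?thesis by (intro step_free[OF i])
  next
    case 4
    then obtain r where "r \<in> D" "\<not> ch r \<subseteq> D" "v = \<phi> r" by (auto simp: Op_def)
    then show ?thesis using 4 by (intro step_open[OF i, of r]) auto
  qed
qed

lemma place_all:
  "Inv q \<phi> D A M B \<Longrightarrow> force (\<lambda>M' B'. \<exists>q \<phi> A. Inv q \<phi> V A M' B') M B"
proof (induction "2 * card (V - D) + card A" arbitrary: q \<phi> D A M B rule: less_induct)
  case less
  show ?case
  proof (cases "D = V")
    case True
    then show ?thesis using less.prems by (intro force.stop) blast
  next
    case False
    show ?thesis
    proof (rule force_trans[OF step[OF less.prems False]])
      fix M' B' assume "progress D A M' B'"
      then obtain q' \<phi>' D' A' where "Inv q' \<phi>' D' A' M' B'" "2 * card (V - D') + card A' < 2 * card (V - D) + card A"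
        unfolding progress_def by blast
      then show "force (\<lambda>M' B'. \<exists>q \<phi> A. Inv q \<phi> V A M' B') M' B'" using less.hyps by blast
    qed
  qed
qed

lemma Inv_start:
  assumes B: "B \<subseteq> complete_edges {..<n}" "card B \<le> b"
  shows "Inv 0 (\<lambda>_. 0) {root} {} {} B"
proof -
  have n0: "0 < n" using n finV rootV card_gt_0_iff by blast
  have rJ: "root \<notin> J" using J_sub by blast
  have finB: "finite B" using B(1) fin_K finite_subset by blast
  have dB: "degree B v \<le> b" for v
  proof -
    have "degree B v \<le> card B" unfolding degree_def using finB by (intro card_mono) auto
    then show ?thesis using B(2) by linarith
  qed
  have p: "pos {} B" using B by (simp add: pos_def)
  have e: "Emb (\<lambda>_. 0) {root} {} {}" using n0 rootV by (auto simp: Emb_def)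
  have l: "degree B v \<le> D0 + b * (4 * b + 5) + b * c * 0" for v
  proof -
    have "b * 1 \<le> b * (4 * b + 5)" by (intro mult_le_mono2) simp
    then show ?thesis using dB[of v] by linarith
  qed
  have "{j \<in> J. j \<in> {root} \<and> j \<notin> {}} = {}" using rJ by auto
  then show ?thesis unfolding Inv_def using p e l by (simp del: Collect_empty_eq)
qed

end

section \<open>Filling all gadgets\<close>

text \<open>\<open>blocks_large\<close> serves to spread the free vertices over the blocks,
  \<open>weight_small\<close> bounds the total weight of the obstructions in at most
  \<open>n\<close> blocks, and \<open>m_weight\<close> is the smallness needed for each block size.
  The exponents contain \<open>4 * b\<close> because the bias is \<open>2 * b\<close>.\<close>

locale completing = placement V E root par h n b k J ro \<Delta> c D0 Q dm
  for V :: "nat set" and E root par h n b k J ro \<Delta> c D0 Q dm +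
  fixes m :: nat
  assumes b_pos: "0 < b" and m_pos: "0 < m"
    and blocks_large: "c * Q + m + 4 * m * (2 * b + 5) * dm < card J"
    and weight_small: "8 * real n * real m ^ 3 * 2 powr (- real m / (4 * real b)) < 1"
    and m_weight: "\<And>\<mu>. m \<le> \<mu> \<Longrightarrow> \<mu> < 2 * m \<Longrightarrow> real \<mu> ^ 2 * 2 powr (- real \<mu> / (4 * real b)) \<le> 1"
begin

definition fillable :: "(nat \<Rightarrow> nat) \<Rightarrow> nat set set \<Rightarrow> nat \<Rightarrow> nat \<Rightarrow> bool" where
  "fillable \<phi> M w j \<longleftrightarrow> (\<exists>f. completion k (\<lambda>t. \<phi> (ro j t)) w M f)"

text \<open>No move is made here: all edges are present in \<open>M\<close> and only the placement
  is rewritten. Filling one gadget does not touch the vertices of the others, so the remaining pairs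
  stay fillable.\<close>

lemma fill_all:
  assumes "Emb \<phi> V A M" "bij_betw g (Fr \<phi> V A) A" "\<And>w. w \<in> Fr \<phi> V A \<Longrightarrow> fillable \<phi> M w (g w)"
  shows "\<exists>\<phi>'. Emb \<phi>' V {} M"
  using assms
proof (induction "card A" arbitrary: \<phi> A)
  case 0
  then have "A = {}" using finD[OF 0(2)] by simp
  then show ?case using 0 by blast
next
  case (Suc a)
  note e = Suc.prems(1)
  have finA: "finite A" using finD[OF e] by simp
  obtain j where j: "j \<in> A" using Suc.hyps(2) by (metis card.empty ex_in_conv nat.distinct(1))
  then have "j \<in> g ` Fr \<phi> V A" using Suc.prems(2) by (simp add: bij_betw_def)
  then obtain w where w: "w \<in> Fr \<phi> V A" "g w = j" by (metis imageE)
  then obtain f where "completion k (\<lambda>t. \<phi> (ro j t)) w M f" using Suc.prems(3) by (auto simp: fillable_def)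
  then obtain \<phi>' where \<phi>': "Emb \<phi>' V (A - {j}) M" "Fr \<phi>' V (A - {j}) = Fr \<phi> V A - {w}"
    "\<forall>j'\<in>A - {j}. \<forall>t<k. \<phi>' (ro j' t) = \<phi> (ro j' t)"
    using Emb_fill[OF e j w(1)] by blast
  have "g ` (Fr \<phi> V A - {w}) = A - {j}"
    using Suc.prems(2) w unfolding bij_betw_def by (simp add: inj_on_image_set_diff[of g "Fr \<phi> V A"])
  then have bij: "bij_betw g (Fr \<phi>' V (A - {j})) (A - {j})"
    unfolding \<phi>'(2) using Suc.prems(2) by (auto simp: bij_betw_def intro: inj_on_subset)
  have "fillable \<phi>' M x (g x)" if x: "x \<in> Fr \<phi>' V (A - {j})" for x
  proof -
    have gx: "g x \<in> A - {j}" using bij x by (auto simp: bij_betw_def)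
    have "fillable \<phi> M x (g x)" using x \<phi>'(2) Suc.prems(3) by blast
    moreover have "completion k (\<lambda>t. \<phi> (ro (g x) t)) x M f = completion k (\<lambda>t. \<phi>' (ro (g x) t)) x M f" for f
      using \<phi>'(3) gx k_ge by (intro completion_cong) auto
    ultimately show ?thesis by (simp add: fillable_def)
  qed
  moreover have "a = card (A - {j})" using Suc.hyps(2) j finA by simp
  ultimately show ?case using Suc.hyps(1) \<phi>'(1) bij by blast
qed

lemma copy_of_Emb:
  assumes e: "Emb \<phi> V {} M"
  shows "\<exists>W\<in>copies {..<n} V E. W \<subseteq> M"
proof
  have ed: "\<phi> ` e' \<in> M" if "e' \<in> E" for e'
  proof -
    obtain r where "r \<in> V - {root}" "e' = {r, par r}" using \<open>e' \<in> E\<close> E_eq by blast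
    then show ?thesis using EmbD(8)[OF e, of r] by simp
  qed
  then show "(\<lambda>e'. \<phi> ` e') ` E \<subseteq> M" by blast
  show "(\<lambda>e'. \<phi> ` e') ` E \<in> copies {..<n} V E"
    unfolding copies_def using EmbD(6,7)[OF e] by auto
qed

section \<open>The hitting game on pairs of free vertices and gadgets\<close>

definition blocked :: "(nat \<Rightarrow> nat) \<Rightarrow> (nat \<times> nat) set \<Rightarrow> nat set set \<Rightarrow> (nat \<times> nat) set" where
  "blocked \<phi> \<Gamma> B = {(w, j) \<in> \<Gamma>. \<exists>x\<in>S \<phi> j. {w, x} \<in> B}"

text \<open>A blocking edge has exactly one free end, and its other end lies in only one gadget, so
  it blocks a single pair.\<close>

lemma card_blocked:
  assumes e: "Emb \<phi> V A M" and \<Gamma>: "\<Gamma> \<subseteq> Fr \<phi> V A \<times> A" and a: "adv 2 M1 B1 M2 B2"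
  shows "finite (blocked \<phi> \<Gamma> B2 - blocked \<phi> \<Gamma> B1)" "card (blocked \<phi> \<Gamma> B2 - blocked \<phi> \<Gamma> B1) \<le> 2 * b"
proof -
  define P where "P = blocked \<phi> \<Gamma> B2 - blocked \<phi> \<Gamma> B1"
  have "\<forall>p\<in>P. \<exists>x. x \<in> S \<phi> (snd p) \<and> {fst p, x} \<in> B2 - B1"
    unfolding P_def blocked_def by fastforce
  then obtain x where x: "\<And>p. p \<in> P \<Longrightarrow> x p \<in> S \<phi> (snd p) \<and> {fst p, x p} \<in> B2 - B1" by metis
  have PG: "fst p \<in> Fr \<phi> V A \<and> snd p \<in> A" if "p \<in> P" for p
    using that \<Gamma> unfolding P_def blocked_def by auto
  have FS: "y \<notin> Fr \<phi> V A" if "j \<in> A" "y \<in> S \<phi> j" for y j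
    using S_sub_n[OF e that(1)] that(2) by (auto simp: Fr_def)
  have inj: "inj_on (\<lambda>p. {fst p, x p}) P"
  proof (rule inj_onI)
    fix p p' assume p: "p \<in> P" "p' \<in> P" and eq: "{fst p, x p} = {fst p', x p'}"
    have "x p' \<notin> Fr \<phi> V A" using FS[of "snd p'" "x p'"] PG[OF p(2)] x[OF p(2)] by blast
    then have "fst p \<noteq> x p'" using PG[OF p(1)] by auto
    then have 1: "fst p = fst p'" "x p = x p'" using eq by (auto simp: doubleton_eq_iff)
    have "snd p = snd p'"
    proof (rule ccontr)
      assume "snd p \<noteq> snd p'"
      then have "S \<phi> (snd p) \<inter> S \<phi> (snd p') = {}"
        using PG[OF p(1)] PG[OF p(2)] by (intro S_disjoint[OF e]) auto
      then show False using x[OF p(1)] x[OF p(2)] 1 by auto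
    qed
    then show "p = p'" using 1 by (simp add: prod_eq_iff)
  qed
  have im: "(\<lambda>p. {fst p, x p}) ` P \<subseteq> B2 - B1" using x by blast
  have fin: "finite (B2 - B1)" using pos_finite[OF adv_pos[OF a]] by simp
  have "finite P" using inj im fin by (rule inj_on_finite)
  moreover have "card P \<le> card (B2 - B1)" using inj im fin by (rule card_inj_on_le)
  moreover have "card (B2 - B1) \<le> b * 2" using a by (simp add: adv_def)
  ultimately show "finite (blocked \<phi> \<Gamma> B2 - blocked \<phi> \<Gamma> B1)" "card (blocked \<phi> \<Gamma> B2 - blocked \<phi> \<Gamma> B1) \<le> 2 * b"
    unfolding P_def by simp_all
qed

abbreviation hits :: "(nat \<Rightarrow> nat) \<Rightarrow> (nat \<times> nat) set \<Rightarrow> 'i set \<Rightarrow> ('i \<Rightarrow> (nat \<times> nat) set) \<Rightarrow> nat set set \<Rightarrow> bool" where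
  "hits \<phi> \<Gamma> I G M \<equiv> \<exists>Mk\<subseteq>\<Gamma>. (\<forall>(w, j)\<in>Mk. fillable \<phi> M w j) \<and> (\<forall>i\<in>I. G i \<inter> Mk \<noteq> {})"

text \<open>The hitting game is simulated with two real moves per pair. No gadget is used up: many
  vertices may become fillable into the same one, and a fillable pair stays so as \<open>M\<close>
  grows. Which pairs are used is decided by the final matching.\<close>

lemma hit_all:
  fixes I :: "'i set" and G :: "'i \<Rightarrow> (nat \<times> nat) set"
  assumes e: "Emb \<phi> V A M0" and \<Gamma>: "\<Gamma> \<subseteq> Fr \<phi> V A \<times> A" and finI: "finite I" and G: "\<And>i. i \<in> I \<Longrightarrow> G i \<subseteq> \<Gamma>"
    and "pos M B" "M0 \<subseteq> M" "Mk \<subseteq> \<Gamma>" "\<And>w j. (w, j) \<in> Mk \<Longrightarrow> fillable \<phi> M w j"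
    and "potential (2 * b) I G Mk (blocked \<phi> \<Gamma> B) < 1"
  shows "force (\<lambda>M' B'. M \<subseteq> M' \<and> card M' + 2 * card Mk \<le> card M + 2 * card \<Gamma> \<and>
    hits \<phi> \<Gamma> I G M') M B"
  using assms(5-)
proof (induction "card \<Gamma> - card Mk" arbitrary: M B Mk rule: less_induct)
  case less
  have fin\<Gamma>: "finite \<Gamma>" by (rule finite_subset[OF \<Gamma>]) (use fin_Fr finD[OF e] in simp)
  have finMk: "finite Mk" using finite_subset[OF less.prems(3) fin\<Gamma>] .
  have cMk: "card Mk \<le> card \<Gamma>" using card_mono[OF fin\<Gamma> less.prems(3)] .
  show ?case
  proof (cases "\<forall>i\<in>I. G i \<inter> Mk \<noteq> {}")
    case True
    show ?thesis
    proof (intro force.stop conjI exI[of _ Mk])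
      show "card M + 2 * card Mk \<le> card M + 2 * card \<Gamma>" using cMk by simp
      show "\<forall>(w, j)\<in>Mk. fillable \<phi> M w j" using less.prems(4) by (auto split: prod.splits)
    qed (use True less.prems(3) in auto)
  next
    case False
    then obtain i0 where i0: "i0 \<in> I" "G i0 \<inter> Mk = {}" by blast
    have "\<exists>p. p \<in> (\<Union>i\<in>I. G i) - Mk - blocked \<phi> \<Gamma> B \<and>
      (\<forall>Bk'. blocked \<phi> \<Gamma> B \<subseteq> Bk' \<longrightarrow> finite (Bk' - blocked \<phi> \<Gamma> B) \<longrightarrow> card (Bk' - blocked \<phi> \<Gamma> B) \<le> 2 * b \<longrightarrow>
        potential (2 * b) I G (insert p Mk) Bk' \<le> potential (2 * b) I G Mk (blocked \<phi> \<Gamma> B))"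
      using finI finite_subset[OF G fin\<Gamma>] b_pos less.prems(5) i0 by (intro potential_step) auto
    then obtain w j where wj: "(w, j) \<in> (\<Union>i\<in>I. G i) - Mk - blocked \<phi> \<Gamma> B"
      and pot: "\<And>Bk'. blocked \<phi> \<Gamma> B \<subseteq> Bk' \<Longrightarrow> finite (Bk' - blocked \<phi> \<Gamma> B) \<Longrightarrow> card (Bk' - blocked \<phi> \<Gamma> B) \<le> 2 * b \<Longrightarrow>
        potential (2 * b) I G (insert (w, j) Mk) Bk' \<le> potential (2 * b) I G Mk (blocked \<phi> \<Gamma> B)" by auto
    have wj\<Gamma>: "(w, j) \<in> \<Gamma>" "(w, j) \<notin> Mk" using wj G by auto
    then have w: "w \<in> Fr \<phi> V A" and j: "j \<in> A" using \<Gamma> by auto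
    have free: "\<And>x. x \<in> S \<phi> j \<Longrightarrow> {w, x} \<notin> B" using wj wj\<Gamma>(1) by (auto simp: blocked_def)
    have wn: "w < n" "w \<notin> S \<phi> j" using w S_sub_n[OF e j] by (auto simp: Fr_def)
    have "force (\<lambda>M' B'. adv 2 M B M' B' \<and> (\<exists>f. completion k (\<lambda>t. \<phi> (ro j t)) w M' f)) M B"
      using less.prems(1) gadget_mono[OF EmbD(9)[OF e j] less.prems(2)] S_sub_lt[OF e j] wn free
      by (intro fill_gadget) (auto simp: S_def)
    then show ?thesis
    proof (rule force_trans)
      fix M1 B1 assume "adv 2 M B M1 B1 \<and> (\<exists>f. completion k (\<lambda>t. \<phi> (ro j t)) w M1 f)"
      then have a: "adv 2 M B M1 B1" and f: "fillable \<phi> M1 w j" by (auto simp: fillable_def)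
      have cI: "card (insert (w, j) Mk) = Suc (card Mk)" using finMk wj\<Gamma> by simp
      have sub: "insert (w, j) Mk \<subseteq> \<Gamma>" using less.prems(3) wj\<Gamma> by simp
      have cle: "Suc (card Mk) \<le> card \<Gamma>" using card_mono[OF fin\<Gamma> sub] cI by simp
      have bl: "blocked \<phi> \<Gamma> B \<subseteq> blocked \<phi> \<Gamma> B1" using a unfolding blocked_def adv_def by blast
      have "force (\<lambda>M' B'. M1 \<subseteq> M' \<and> card M' + 2 * card (insert (w, j) Mk) \<le> card M1 + 2 * card \<Gamma> \<and>
        hits \<phi> \<Gamma> I G M') M1 B1"
      proof (rule less.hyps)
        show "card \<Gamma> - card (insert (w, j) Mk) < card \<Gamma> - card Mk" using cI cle by simp
        show "pos M1 B1" by (rule adv_pos[OF a])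
        show "M0 \<subseteq> M1" using less.prems(2) adv_subset[OF a] by (rule subset_trans)
        show "insert (w, j) Mk \<subseteq> \<Gamma>" by (rule sub)
        show "fillable \<phi> M1 w' j'" if "(w', j') \<in> insert (w, j) Mk" for w' j'
          using that f less.prems(4) completion_mono[OF _ adv_subset[OF a]] unfolding fillable_def by blast
        show "potential (2 * b) I G (insert (w, j) Mk) (blocked \<phi> \<Gamma> B1) < 1"
          using pot[OF bl card_blocked[OF e \<Gamma> a]] less.prems(5) by linarith
      qed
      then show "force (\<lambda>M' B'. M \<subseteq> M' \<and> card M' + 2 * card Mk \<le> card M + 2 * card \<Gamma> \<and>
        hits \<phi> \<Gamma> I G M') M1 B1"
      proof (rule force_mono)
        fix M' B'
        assume *: "M1 \<subseteq> M' \<and> card M' + 2 * card (insert (w, j) Mk) \<le> card M1 + 2 * card \<Gamma> \<and>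
          hits \<phi> \<Gamma> I G M'"
        have "card M1 \<le> card M + 2" "M \<subseteq> M1" using a by (auto simp: adv_def)
        then show "M \<subseteq> M' \<and> card M' + 2 * card Mk \<le> card M + 2 * card \<Gamma> \<and>
          hits \<phi> \<Gamma> I G M'"
          using * cI by auto
      qed
    qed
  qed
qed

text \<open>
  The gadgets are split into blocks of size about \<open>m\<close>, and the free vertices are distributed over the
  blocks in such a way that no Breaker edge lies inside a block. Maker then plays for Hall's condition
  in all blocks simultaneously.
\<close>

lemma block_assignment:
  assumes i: "Inv q \<phi> V A M B"
  shows "\<exists>(blk :: nat \<Rightarrow> nat) f. bij_betw f (Fr \<phi> V A) A \<and>
    (\<forall>a\<in>A. m \<le> card {x \<in> A. blk x = blk a} \<and> card {x \<in> A. blk x = blk a} < 2 * m) \<and>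
    (\<forall>w\<in>Fr \<phi> V A. \<forall>j\<in>A. blk j = blk (f w) \<longrightarrow> (\<forall>x\<in>S \<phi> j. {w, x} \<notin> B))"
proof -
  note e = InvD(2)[OF i]
  have finA: "finite A" using finD[OF e] by simp
  have finB: "finite B" using pos_finite[OF InvD(1)[OF i]] by simp
  have cA: "card (Fr \<phi> V A) = card A" using card_J_le(2)[OF i] by simp
  have big: "m + 4 * m * (2 * b + 5) * dm < card A" using card_J_le(1)[OF i] blocks_large by simp
  then obtain blk :: "nat \<Rightarrow> nat" where blk: "\<forall>a\<in>A. m \<le> card {x \<in> A. blk x = blk a} \<and> card {x \<in> A. blk x = blk a} < 2 * m"
    using partition_blocks[OF finA m_pos] by auto
  have blk': "card {x \<in> A. blk x = blk a} \<le> 2 * m" if "a \<in> A" for a using blk that by fastforce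
  define Rl where "Rl w j \<longleftrightarrow> (\<forall>j'\<in>A. blk j' = blk j \<longrightarrow> (\<forall>x\<in>S \<phi> j'. {w, x} \<notin> B))" for w j
  have live: "degree B v \<le> dm" if "v \<in> Fr \<phi> V A \<or> (\<exists>j\<in>A. v \<in> S \<phi> j)" for v
    using live_degree[OF i, of v 0] that by (auto simp: live_def SA_def)
  \<comment> \<open>Gadgets are disjoint, so each of the at most \<open>dm\<close> Breaker edges at
    \<open>w\<close> spoils at most one block, that is, fewer than \<open>2 * m\<close>
    gadgets.\<close>
  have W: "2 * card {j \<in> A. \<not> Rl w j} \<le> card A" if w: "w \<in> Fr \<phi> V A" for w
  proof -
    define Nb where "Nb = {u. {u, w} \<in> B}"
    define T where "T u = {j \<in> A. \<exists>j'\<in>A. u \<in> S \<phi> j' \<and> blk j' = blk j}" for u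
    have Nb: "finite Nb" "card Nb \<le> dm" using card_nbs_le[OF finB, of w] live[of w] w by (auto simp: Nb_def)
    have cT: "card (T u) \<le> 2 * m" for u
    proof (cases "\<exists>j'\<in>A. u \<in> S \<phi> j'")
      case True
      then obtain j' where j': "j' \<in> A" "u \<in> S \<phi> j'" by blast
      have "T u \<subseteq> {x \<in> A. blk x = blk j'}" using S_disjoint[OF e] j' by (auto simp: T_def) (metis IntI empty_iff)
      then have "card (T u) \<le> card {x \<in> A. blk x = blk j'}" using finA by (intro card_mono) auto
      then show ?thesis using blk'[OF j'(1)] by linarith
    next
      case False
      then have "T u = {}" by (auto simp: T_def)
      then show ?thesis by simp
    qed
    have "{j \<in> A. \<not> Rl w j} \<subseteq> (\<Union>u\<in>Nb. T u)"
      unfolding Rl_def Nb_def T_def by (auto simp: insert_commute)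
    then have "card {j \<in> A. \<not> Rl w j} \<le> card (\<Union>u\<in>Nb. T u)" using Nb finA by (intro card_mono) (auto simp: T_def)
    also have "\<dots> \<le> (\<Sum>u\<in>Nb. card (T u))" using Nb(1) by (rule card_UN_le)
    also have "\<dots> \<le> (\<Sum>u\<in>Nb. 2 * m)" using cT by (rule sum_mono)
    also have "\<dots> = card Nb * (2 * m)" by simp
    also have "\<dots> \<le> dm * (2 * m)" using Nb(2) by (rule mult_le_mono1)
    finally have "2 * card {j \<in> A. \<not> Rl w j} \<le> (4 * m * 1) * dm" by simp
    also have "\<dots> \<le> 4 * m * (2 * b + 5) * dm" by (intro mult_le_mono1 mult_le_mono2) simp
    finally show ?thesis using big by linarith
  qed
  \<comment> \<open>The block of \<open>j\<close> has fewer than \<open>2 * m\<close> gadgets of at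
    most \<open>2 * b + 5\<close> vertices, each with at most \<open>dm\<close> Breaker
    edges.\<close>
  have AA: "2 * card {w \<in> Fr \<phi> V A. \<not> Rl w j} < card A" if j: "j \<in> A" for j
  proof -
    define C where "C = {x \<in> A. blk x = blk j}"
    define SC where "SC = (\<Union>j'\<in>C. S \<phi> j')"
    have finC: "finite C" "C \<subseteq> A" using finA by (auto simp: C_def)
    have kle: "k \<le> 2 * b + 5" using k by auto
    have finSC: "finite SC" using finC by (auto simp: SC_def S_def)
    have "card SC \<le> (\<Sum>j'\<in>C. card (S \<phi> j'))" unfolding SC_def using finC(1) by (rule card_UN_le)
    also have "\<dots> \<le> (\<Sum>j'\<in>C. 2 * b + 5)" using le_trans[OF card_S_le kle] by (rule sum_mono)
    also have "\<dots> \<le> (2 * m) * (2 * b + 5)" using blk'[OF j] by (simp only: C_def sum_constant of_nat_id) (rule mult_le_mono1)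
    finally have cSC: "card SC \<le> (2 * m) * (2 * b + 5)" .
    have "{w \<in> Fr \<phi> V A. \<not> Rl w j} \<subseteq> (\<Union>x\<in>SC. {u. {u, x} \<in> B})"
      unfolding Rl_def SC_def C_def by blast
    moreover have fN: "finite {u. {u, x} \<in> B}" "card {u. {u, x} \<in> B} \<le> degree B x" for x
      using card_nbs_le[OF finB, of x] by auto
    ultimately have "card {w \<in> Fr \<phi> V A. \<not> Rl w j} \<le> card (\<Union>x\<in>SC. {u. {u, x} \<in> B})"
      using finSC by (intro card_mono) auto
    also have "\<dots> \<le> (\<Sum>x\<in>SC. card {u. {u, x} \<in> B})" using finSC by (rule card_UN_le)
    also have "\<dots> \<le> (\<Sum>x\<in>SC. dm)"
    proof (rule sum_mono)
      fix x assume "x \<in> SC"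
      then have "degree B x \<le> dm" using finC(2) by (intro live) (auto simp: SC_def)
      then show "card {u. {u, x} \<in> B} \<le> dm" using fN(2)[of x] by (rule le_trans[rotated])
    qed
    also have "\<dots> \<le> (2 * m) * (2 * b + 5) * dm" using cSC by (simp only: sum_constant of_nat_id) (rule mult_le_mono1)
    finally have "2 * card {w \<in> Fr \<phi> V A. \<not> Rl w j} \<le> 2 * ((2 * m) * (2 * b + 5) * dm)" by (rule mult_le_mono2)
    also have "\<dots> = 4 * m * (2 * b + 5) * dm" by (simp add: algebra_simps)
    finally have "2 * card {w \<in> Fr \<phi> V A. \<not> Rl w j} \<le> 4 * m * (2 * b + 5) * dm" .
    then show ?thesis using big m_pos by linarith
  qed
  obtain f where f: "bij_betw f (Fr \<phi> V A) A" "\<forall>w\<in>Fr \<phi> V A. Rl w (f w)"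
    using perfect_matching_of_degrees[OF fin_Fr finA cA W AA] by blast
  then show ?thesis using blk unfolding Rl_def by blast
qed

text \<open>At most \<open>2 * m * card J\<close> pairs lie inside the blocks, and each costs two
  moves.\<close>

lemma complete_all:
  assumes i: "Inv q \<phi> V A M B"
  shows "force (\<lambda>M' B'. (\<exists>W\<in>copies {..<n} V E. W \<subseteq> M') \<and> card M' \<le> card M + 4 * m * card J) M B"
proof -
  note e = InvD(2)[OF i]
  have finA: "finite A" using finD[OF e] by simp
  have AJ: "card A \<le> card J" using EmbD(4)[OF e] fin_J by (rule card_mono[rotated])
  define W where "W = Fr \<phi> V A"
  obtain blk :: "nat \<Rightarrow> nat" and f where f: "bij_betw f W A"
    and blk: "\<And>a. a \<in> A \<Longrightarrow> m \<le> card {x \<in> A. blk x = blk a} \<and> card {x \<in> A. blk x = blk a} < 2 * m"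
    and free: "\<And>w j x. w \<in> W \<Longrightarrow> j \<in> A \<Longrightarrow> blk j = blk (f w) \<Longrightarrow> x \<in> S \<phi> j \<Longrightarrow> {w, x} \<notin> B"
    using block_assignment[OF i] unfolding W_def by blast
  define Wt where "Wt t = {w \<in> W. blk (f w) = t}" for t
  define At where "At t = {j \<in> A. blk j = t}" for t
  define \<Gamma> where "\<Gamma> = {(w, j). w \<in> W \<and> j \<in> A \<and> blk j = blk (f w)}"
  have finW: "finite W" unfolding W_def by (rule fin_Fr)
  have finWt: "finite (Wt t)" and finAt: "finite (At t)" for t using finW finA by (auto simp: Wt_def At_def)
  have cWt: "card (Wt t) = card (At t)" for t
  proof -
    have "f ` Wt t = At t" using f by (auto simp: bij_betw_def Wt_def At_def)
    moreover have "inj_on f (Wt t)" using f by (auto simp: bij_betw_def Wt_def intro: inj_on_subset)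
    ultimately show ?thesis by (metis card_image)
  qed
  have c\<Gamma>: "card \<Gamma> \<le> 2 * m * card J"
  proof -
    have "\<Gamma> = (SIGMA w:W. At (blk (f w)))" by (auto simp: \<Gamma>_def At_def)
    then have "card \<Gamma> = (\<Sum>w\<in>W. card (At (blk (f w))))" using finW finAt by simp
    also have "\<dots> \<le> (\<Sum>w\<in>W. 2 * m)"
    proof (rule sum_mono)
      fix w assume "w \<in> W"
      then have "f w \<in> A" using f by (auto simp: bij_betw_def)
      then show "card (At (blk (f w))) \<le> 2 * m" using blk unfolding At_def by fastforce
    qed
    also have "\<dots> = 2 * m * card A" using bij_betw_same_card[OF f] by simp
    also have "\<dots> \<le> 2 * m * card J" using AJ by (rule mult_le_mono2)
    finally show ?thesis .
  qed
  define I where "I = (SIGMA t:blk ` A. obstructions (Wt t) (At t))"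
  define G where "G p = (case p of (t :: nat, X :: nat set, Z :: nat set) \<Rightarrow> X \<times> Z)" for p
  have finI: "finite I" unfolding I_def using finA finite_obstructions[OF finWt finAt] by auto
  have GG: "G p \<subseteq> \<Gamma>" if "p \<in> I" for p
    using that unfolding I_def G_def \<Gamma>_def obstructions_def Wt_def At_def by fastforce
  \<comment> \<open>Thanks to the choice of \<open>f\<close>, each obstruction enters the potential
    with its full size.\<close>
  have nob: "blocked \<phi> \<Gamma> B = {}" using free by (auto simp: blocked_def \<Gamma>_def)
  have "potential (2 * b) I G {} (blocked \<phi> \<Gamma> B) < 1"
  proof -
    have "potential (2 * b) I G {} (blocked \<phi> \<Gamma> B) = (\<Sum>p\<in>I. 2 powr (- real (card (G p)) / real (2 * b)))"
      by (simp add: potential_def nob)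
    also have "\<dots> = (\<Sum>(t, p)\<in>I. 2 powr (- real (card (fst p \<times> snd p)) / real (2 * b)))"
      by (intro sum.cong) (auto simp: G_def)
    also have "\<dots> = (\<Sum>t\<in>blk ` A. \<Sum>p\<in>obstructions (Wt t) (At t). 2 powr (- real (card (fst p \<times> snd p)) / real (2 * b)))"
      unfolding I_def by (rule sum.Sigma[symmetric]) (use finA finite_obstructions finWt finAt in auto)
    also have "\<dots> = (\<Sum>t\<in>blk ` A. \<Sum>(X, Z)\<in>obstructions (Wt t) (At t). 2 powr (- real (card (X \<times> Z)) / real (2 * b)))"
      by (simp only: case_prod_unfold)
    also have "\<dots> \<le> (\<Sum>t\<in>blk ` A. 8 * real m ^ 3 * 2 powr (- real m / (4 * real b)))"
    proof (rule sum_mono)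
      fix t assume "t \<in> blk ` A"
      then obtain a where a: "a \<in> A" "t = blk a" by blast
      define \<mu> where "\<mu> = card (At t)"
      have \<mu>: "m \<le> \<mu>" "\<mu> < 2 * m" using blk[OF a(1)] a(2) by (auto simp: \<mu>_def At_def)
      have "(\<Sum>(X, Z)\<in>obstructions (Wt t) (At t). 2 powr (- real (card (X \<times> Z)) / real (2 * b)))
        \<le> real \<mu> * (real \<mu> ^ 2 * 2 powr (- real \<mu> / (2 * real (2 * b))))"
        using cWt b_pos m_weight[OF \<mu>] by (intro obstructions_weight_le finWt finAt) (auto simp: \<mu>_def)
      also have "\<dots> = real \<mu> ^ 3 * 2 powr (- real \<mu> / (4 * real b))"
        by (simp add: power3_eq_cube power2_eq_square)
      also have "\<dots> \<le> (2 * real m) ^ 3 * 2 powr (- real m / (4 * real b))"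
      proof (intro mult_mono power_mono)
        show "2 powr (- real \<mu> / (4 * real b)) \<le> 2 powr (- real m / (4 * real b))"
          using \<mu>(1) b_pos by (simp add: divide_right_mono)
      qed (use \<mu> in auto)
      also have "\<dots> = 8 * real m ^ 3 * 2 powr (- real m / (4 * real b))" by (simp add: power_mult_distrib)
      finally show "(\<Sum>(X, Z)\<in>obstructions (Wt t) (At t). 2 powr (- real (card (X \<times> Z)) / real (2 * b)))
        \<le> 8 * real m ^ 3 * 2 powr (- real m / (4 * real b))" .
    qed
    also have "\<dots> = real (card (blk ` A)) * (8 * real m ^ 3 * 2 powr (- real m / (4 * real b)))" by simp
    also have "\<dots> \<le> real n * (8 * real m ^ 3 * 2 powr (- real m / (4 * real b)))"
    proof (intro mult_right_mono)
      have "card (blk ` A) \<le> card A" using finA by (rule card_image_le)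
      also have "\<dots> \<le> card V" using EmbD(4)[OF e] J_sub finV by (intro card_mono) auto
      finally show "real (card (blk ` A)) \<le> real n" using n by simp
    qed simp
    also have "\<dots> < 1" using weight_small by (simp add: mult.assoc mult.left_commute)
    finally show ?thesis .
  qed
  then have "force (\<lambda>M' B'. M \<subseteq> M' \<and> card M' + 2 * card ({} :: (nat \<times> nat) set) \<le> card M + 2 * card \<Gamma> \<and>
    hits \<phi> \<Gamma> I G M') M B"
    using InvD(1)[OF i] finI GG by (intro hit_all[OF e]) (auto simp: \<Gamma>_def W_def)
  then show ?thesis
  proof (rule force_mono)
    fix M' B'
    assume "M \<subseteq> M' \<and> card M' + 2 * card ({} :: (nat \<times> nat) set) \<le> card M + 2 * card \<Gamma> \<and>
      hits \<phi> \<Gamma> I G M'"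
    then obtain Mk where MM: "M \<subseteq> M'" "card M' \<le> card M + 2 * card \<Gamma>" and Mk_sub: "Mk \<subseteq> \<Gamma>"
      and fb: "\<forall>(w, j)\<in>Mk. fillable \<phi> M' w j" and hit: "\<forall>i\<in>I. G i \<inter> Mk \<noteq> {}" by auto
    have Mk: "Mk \<subseteq> \<Gamma>" "\<And>w j. (w, j) \<in> Mk \<Longrightarrow> fillable \<phi> M' w j" "\<And>i. i \<in> I \<Longrightarrow> G i \<inter> Mk \<noteq> {}"
      using Mk_sub fb hit by blast+
    define N where "N w = {j. (w, j) \<in> Mk}" for w
    have NA: "N w \<subseteq> At (blk (f w))" for w using Mk(1) by (auto simp: N_def \<Gamma>_def At_def)
    have finN: "finite (N w)" for w using finite_subset[OF NA finAt] .
    \<comment> \<open>If \<open>X\<close> had too few partners, the other gadgets of its block would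
      contain a \<open>Z\<close> forming an obstruction with \<open>X\<close> that has not been
      hit.\<close>
    have local_hall: "card X \<le> card (\<Union>w\<in>X. N w)" if X: "X \<subseteq> Wt t" and t: "t \<in> blk ` A" for X t
    proof (rule ccontr)
      assume no: "\<not> ?thesis"
      have finX: "finite X" using finite_subset[OF X finWt] .
      define U where "U = (\<Union>w\<in>X. N w)"
      have UA: "U \<subseteq> At t" using NA X unfolding U_def Wt_def by blast
      have finU: "finite U" using finite_subset[OF UA finAt] .
      have cX: "card X \<le> card (At t)" using card_mono[OF finWt X] cWt by simp
      have "card (At t - U) = card (At t) - card U" using UA finU by (intro card_Diff_subset)
      then have "card (At t) + 1 - card X \<le> card (At t - U)" using no cX unfolding U_def by linarith
      then obtain Z where Z: "Z \<subseteq> At t - U" "card Z = card (At t) + 1 - card X"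
        by (meson obtain_subset_with_card_n)
      have "X \<noteq> {}" using no by auto
      then have "(X, Z) \<in> obstructions (Wt t) (At t)" using X Z cX by (auto simp: obstructions_def)
      then have "(t, X, Z) \<in> I" using t by (simp add: I_def)
      then have "G (t, X, Z) \<inter> Mk \<noteq> {}" by (rule Mk(3))
      then obtain w j where "w \<in> X" "j \<in> Z" "(w, j) \<in> Mk" by (auto simp: G_def)
      then show False using Z(1) by (auto simp: U_def N_def)
    qed
    \<comment> \<open>Partners of vertices in different blocks are disjoint, so Hall's condition
      adds up over the blocks.\<close>
    have hallc: "card X \<le> card (\<Union>w\<in>X. N w)" if X: "X \<subseteq> W" for X
    proof -
      define T where "T = blk ` A"
      have finT: "finite T" using finA by (simp add: T_def)
      have Xd: "X = (\<Union>t\<in>T. X \<inter> Wt t)" using X f by (auto simp: T_def Wt_def bij_betw_def)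
      have finX: "finite X" using finite_subset[OF X finW] .
      have "card X = card (\<Union>t\<in>T. X \<inter> Wt t)" using Xd by simp
      also have "\<dots> \<le> (\<Sum>t\<in>T. card (X \<inter> Wt t))" using finT by (rule card_UN_le)
      also have "\<dots> \<le> (\<Sum>t\<in>T. card (\<Union>w\<in>X \<inter> Wt t. N w))" by (intro sum_mono local_hall) (auto simp: T_def)
      also have "\<dots> = card (\<Union>t\<in>T. \<Union>w\<in>X \<inter> Wt t. N w)"
      proof (rule card_UN_disjoint[symmetric])
        have sub: "(\<Union>w\<in>X \<inter> Wt t. N w) \<subseteq> At t" for t using NA unfolding Wt_def by blast
        show "\<forall>i\<in>T. \<forall>j\<in>T. i \<noteq> j \<longrightarrow> (\<Union>w\<in>X \<inter> Wt i. N w) \<inter> (\<Union>w\<in>X \<inter> Wt j. N w) = {}"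
        proof (intro ballI impI)
          fix i j :: nat assume "i \<noteq> j"
          then have "At i \<inter> At j = {}" by (auto simp: At_def)
          then show "(\<Union>w\<in>X \<inter> Wt i. N w) \<inter> (\<Union>w\<in>X \<inter> Wt j. N w) = {}" using sub by blast
        qed
      qed (use finT finX finN in auto)
      also have "(\<Union>t\<in>T. \<Union>w\<in>X \<inter> Wt t. N w) = (\<Union>w\<in>X. N w)"
        by (subst (2) Xd) blast
      finally show ?thesis .
    qed
    obtain g where g: "inj_on g W" "\<forall>w\<in>W. g w \<in> N w"
      using hall[OF finW finN hallc] by blast
    have gA: "g ` W \<subseteq> A" using g(2) NA by (auto simp: At_def)
    have "g ` W = A"
      using gA finA g(1) bij_betw_same_card[OF f] by (intro card_subset_eq) (auto simp: card_image)
    then have bij: "bij_betw g (Fr \<phi> V A) A" using g(1) by (simp add: bij_betw_def W_def)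
    have "fillable \<phi> M' w (g w)" if "w \<in> Fr \<phi> V A" for w
      using g(2) that Mk(2) by (auto simp: N_def W_def)
    then obtain \<phi>' where "Emb \<phi>' V {} M'" using fill_all[OF Emb_mono[OF e MM(1)] bij] by blast
    then show "(\<exists>W\<in>copies {..<n} V E. W \<subseteq> M') \<and> card M' \<le> card M + 4 * m * card J"
      using copy_of_Emb MM(2) c\<Gamma> by fastforce
  qed
qed

theorem tree_game_win:
  "\<exists>\<sigma>. tree_game_wins_within 1 b V E first \<sigma> (n + (4 * b + 5) * card J + c * Q + 4 * m * card J)"
  unfolding tree_game_wins_within_def n[symmetric]
proof (rule strategy_of_force)
  fix B assume B: "B \<subseteq> complete_edges {..<n}" "card B \<le> b"
  show "force (\<lambda>M B. (\<exists>W\<in>copies {..<n} V E. W \<subseteq> M) \<and> card M \<le> n + (4 * b + 5) * card J + c * Q + 4 * m * card J) {} B"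
  proof (rule force_trans[OF place_all[OF Inv_start[OF B]]])
    fix M1 B1 assume "\<exists>q \<phi> A. Inv q \<phi> V A M1 B1"
    then obtain q \<phi> A where i: "Inv q \<phi> V A M1 B1" by blast
    have "card (J \<inter> V) \<le> card J" using fin_J by (simp add: card_mono)
    then have "(4 * b + 5) * card (J \<inter> V) \<le> (4 * b + 5) * card J" by (rule mult_le_mono2)
    moreover have "c * q \<le> c * Q" using Inv_le_Q[OF i] by (rule mult_le_mono2)
    ultimately have c1: "card M1 \<le> n + (4 * b + 5) * card J + c * Q" using InvD(4)[OF i] n by linarith
    show "force (\<lambda>M B. (\<exists>W\<in>copies {..<n} V E. W \<subseteq> M) \<and> card M \<le> n + (4 * b + 5) * card J + c * Q + 4 * m * card J) M1 B1"
      using complete_all[OF i] by (rule force_mono) (use c1 in auto)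
  qed
qed

end

section \<open>Choice of the parameters\<close>

text \<open>If leaves yield fewer than \<open>N\<close> gadgets, there are at most
  \<open>\<Delta> * N + 1\<close> leaves, and \<open>path_gadgets\<close> supplies enough chains.
  Any subfamily will do, so exactly \<open>N\<close> can be kept.\<close>

lemma (in rooted_tree) gadgets_exist:
  assumes \<Delta>: "\<And>r. r \<in> V \<Longrightarrow> card (ch r) \<le> \<Delta>" and N: "(2 * b + 5) * (N + 3 + 2 * \<Delta> * N) < card V"
  shows "\<exists>k J ro. (k = 2 \<or> k = 2 * b + 5) \<and> card J = N \<and> gadget_chains k J ro \<and>
    (\<forall>j\<in>J. \<forall>t. 0 < t \<longrightarrow> t < k \<longrightarrow> t < k - 1 \<or> t = 1 \<longrightarrow> ch (ro j t) \<subseteq> ro j ` {..<k})"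
proof -
  have sub: "gadget_chains k J' ro" if "gadget_chains k J ro" "J' \<subseteq> J" for k J J' ro
    using that unfolding gadget_chains_def by blast
  obtain J ro where J: "gadget_chains 2 J ro" "\<forall>j\<in>J. ch (ro j 1) = {}"
    "card {r \<in> V. ch r = {}} \<le> \<Delta> * (card J + 1) + 1"
    using leaf_gadgets[OF \<Delta>] by blast
  show ?thesis
  proof (cases "N \<le> card J")
    case True
    then obtain J' where J': "J' \<subseteq> J" "card J' = N" by (meson obtain_subset_with_card_n)
    have "\<forall>j\<in>J'. \<forall>t. 0 < t \<longrightarrow> t < 2 \<longrightarrow> ch (ro j t) \<subseteq> ro j ` {..<2}"
    proof (intro ballI allI impI)
      fix j and t :: nat assume "j \<in> J'" "0 < t" "t < 2"
      then have "t = 1" "j \<in> J" using J'(1) by auto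
      then show "ch (ro j t) \<subseteq> ro j ` {..<2}" using J(2) by simp
    qed
    then show ?thesis
      using J'(2) sub[OF J(1) J'(1)] by (intro exI[of _ 2] exI[of _ J'] exI[of _ ro] conjI) simp_all
  next
    case False
    define k where "k = 2 * b + 5"
    have "\<Delta> * (card J + 1) \<le> \<Delta> * N" using False by (intro mult_le_mono2) simp
    then have leaves: "card {r \<in> V. ch r = {}} \<le> \<Delta> * N + 1" using J(3) by linarith
    obtain J2 ro2 where J2: "gadget_chains k J2 ro2" "\<forall>j\<in>J2. \<forall>i. Suc i < k \<longrightarrow> ch (ro2 j i) = {ro2 j (Suc i)}"
      "card V \<le> k * (card J2 + 1 + 2 * card {r \<in> V. ch r = {}})"
      using path_gadgets[of k] by (auto simp: k_def)
    have "N \<le> card J2"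
    proof (rule ccontr)
      assume "\<not> ?thesis"
      then have "card J2 + 1 + 2 * card {r \<in> V. ch r = {}} \<le> N + 3 + 2 * \<Delta> * N" using leaves by simp
      then have "k * (card J2 + 1 + 2 * card {r \<in> V. ch r = {}}) \<le> k * (N + 3 + 2 * \<Delta> * N)" by (rule mult_le_mono2)
      then show False using J2(3) N unfolding k_def by linarith
    qed
    then obtain J' where J': "J' \<subseteq> J2" "card J' = N" by (meson obtain_subset_with_card_n)
    have "\<forall>j\<in>J'. \<forall>t. 0 < t \<longrightarrow> t < k \<longrightarrow> t < k - 1 \<or> t = 1 \<longrightarrow> ch (ro2 j t) \<subseteq> ro2 j ` {..<k}"
    proof (intro ballI allI impI)
      fix j t assume *: "j \<in> J'" "0 < t" "t < k" "t < k - 1 \<or> t = 1"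
      then have "Suc t < k" by (auto simp: k_def)
      then show "ch (ro2 j t) \<subseteq> ro2 j ` {..<k}" using J2(2) J'(1) *(1) by auto
    qed
    then show ?thesis
      using J'(2) sub[OF J2(1) J'(1)]
      by (intro exI[of _ k] exI[of _ J'] exI[of _ ro2] conjI) (simp_all add: k_def)
  qed
qed

text \<open>\<open>B\<close> and \<open>T\<close> bound \<open>b\<close> and \<Delta>,
  \<open>G\<close> is the threshold of heaviness, \<open>L\<close> the number of gadgets,
  \<open>P\<close> the number of responses and \<open>C\<close> the cost of one. Breaker owns about
  \<open>x powr 1.005\<close> edges, which gives about \<open>x powr 0.305\<close> responses, hence
  the exponent 0.32; together they add about \<open>x powr 0.375\<close> to a degree, far less than
  \<open>G\<close>. \<open>L\<close> must exceed \<open>DM * T * T\<close>, of order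
  \<open>x powr 0.8\<close>, whereas \<open>B * T * L\<close> has to stay below \<open>x\<close>.
  The extra moves are dominated by \<open>T * L\<close>, of order
  \<open>x powr 0.95\<close>.\<close>

definition large :: "nat \<Rightarrow> bool" where
  "large n \<longleftrightarrow> (let x = real n; B = x powr 0.005; T = x powr 0.05; G = x powr 0.7; L = x powr 0.9;
     C = T + B + 3; P = x powr 0.32 + 1; DM = 2 * (G + 1) in
     n \<ge> 1 \<and>
     12 * B * C \<le> G \<and>
     12 * B * (x + (4 * B + 5) * L + 1) < G * x powr 0.32 \<and>
     B * (4 * B + 5) + B * C * P + B * (C + (4 * B + 5)) \<le> G \<and>
     C * P + (2 * B + 6) * DM + (10 * B + 20) + C + DM * (T + T * T) < L - 1 \<and>
     C * P + (T + 1) + 4 * (T + 1) * (2 * B + 5) * DM < L - 1 \<and>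
     8 * x * (T + 1) ^ 3 * 2 powr (- T / (4 * B)) < 1 \<and>
     (2 * B + 5) * (L + 3 + 2 * T * L) < x \<and>
     (4 * B + 5) * L + C * P + 4 * (T + 1) * L \<le> x powr 0.97)"

lemma eventually_large: "eventually large sequentially"
  unfolding large_def Let_def by (intro eventually_conj; real_asymp)

lemma tree_game_win_large:
  fixes V :: "nat set"
  assumes tree: "tree_graph V E" and n: "card V = n" and large: "large n"
    and deg: "real (max_degree V E) \<le> real n powr 0.05" and b: "1 \<le> b" "real b \<le> real n powr 0.005"
  shows "\<exists>\<sigma> m. real m \<le> real n + real n powr 0.97 \<and> tree_game_wins_within 1 b V E first \<sigma> m"
proof -
  define B where "B = real n powr 0.005"
  define T where "T = real n powr 0.05"
  define G where "G = real n powr 0.7"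
  define L where "L = real n powr 0.9"
  define C where "C = T + B + 3"
  define P where "P = real n powr 0.32 + 1"
  define DM where "DM = 2 * (G + 1)"
  have l: "n \<ge> 1" "12 * B * C \<le> G" "12 * B * (real n + (4 * B + 5) * L + 1) < G * real n powr 0.32"
    "B * (4 * B + 5) + B * C * P + B * (C + (4 * B + 5)) \<le> G"
    "C * P + (2 * B + 6) * DM + (10 * B + 20) + C + DM * (T + T * T) < L - 1"
    "C * P + (T + 1) + 4 * (T + 1) * (2 * B + 5) * DM < L - 1"
    "8 * real n * (T + 1) ^ 3 * 2 powr (- T / (4 * B)) < 1"
    "(2 * B + 5) * (L + 3 + 2 * T * L) < real n"
    "(4 * B + 5) * L + C * P + 4 * (T + 1) * L \<le> real n powr 0.97"
    using large unfolding large_def Let_def C_def P_def DM_def unfolding B_def T_def G_def L_def by blast+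
  define \<Delta> where "\<Delta> = max_degree V E"
  define N where "N = nat \<lfloor>L\<rfloor>"
  \<comment> \<open>Enough both for placing all children of a role and for the \<open>b + 3\<close>
    moves of \<open>step_chain\<close>.\<close>
  define c where "c = \<Delta> + b + 3"
  define D0 where "D0 = nat \<lceil>G\<rceil>"
  define Q where "Q = nat \<lceil>real n powr 0.32\<rceil>"
  \<comment> \<open>One \<open>D0\<close> is the threshold itself, the other covers everything
    Breaker adds before the next response is complete.\<close>
  define dm where "dm = 2 * D0"
  define m where "m = nat \<lceil>T\<rceil>"
  have pos: "B > 0" "T > 0" "G > 0" "L > 0" "C > 0" "P > 0" "DM > 0"
    using l(1) by (auto simp: B_def T_def G_def L_def C_def P_def DM_def add_pos_nonneg)
  have hb: "real b \<le> B" and h\<Delta>: "real \<Delta> \<le> T" using b deg by (auto simp: B_def T_def \<Delta>_def)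
  have hN: "L - 1 < real N" "real N \<le> L" unfolding N_def using pos by linarith+
  have hc: "real c \<le> C" unfolding c_def C_def using hb h\<Delta> by simp
  have hD0: "G \<le> real D0" "real D0 \<le> G + 1" unfolding D0_def using pos by linarith+
  have hQ: "real n powr 0.32 \<le> real Q" "real Q \<le> P"
    unfolding Q_def P_def using powr_ge_zero[of "real n" "0.32"] by linarith+
  have hdm: "real dm \<le> DM" unfolding dm_def DM_def using hD0 by simp
  have hm: "T \<le> real m" "real m \<le> T + 1" unfolding m_def using pos by linarith+
  have h0: "0 \<le> real x" for x :: nat by simp
  note bounds = hb h\<Delta> hN(2) hc hD0(2) hQ(2) hdm hm(2)
  obtain root par and h :: "nat \<Rightarrow> nat" where rt: "rooted_tree V E root par h"
    using rooted_treeI_tree_graph[OF tree] by blast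
  interpret rooted_tree V E root par h by (rule rt)
  have ch\<Delta>: "card (ch r) \<le> \<Delta>" if "r \<in> V" for r
  proof -
    have "degree E r \<le> \<Delta>" unfolding \<Delta>_def max_degree_def using finV that by (intro Max_ge) auto
    then show ?thesis using card_ch_le[of r] by linarith
  qed
  have "real ((2 * b + 5) * (N + 3 + 2 * \<Delta> * N)) \<le> (2 * B + 5) * (L + 3 + 2 * T * L)"
    unfolding of_nat_mult of_nat_add of_nat_numeral
    using pos by (intro mult_mono add_mono order_refl bounds add_nonneg_nonneg mult_nonneg_nonneg) auto
  then have few: "(2 * b + 5) * (N + 3 + 2 * \<Delta> * N) < card V" using l(8) n by linarith
  have "\<exists>k J ro. (k = 2 \<or> k = 2 * b + 5) \<and> card J = N \<and> gadget_chains k J ro \<and>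
    (\<forall>j\<in>J. \<forall>t. 0 < t \<longrightarrow> t < k \<longrightarrow> t < k - 1 \<or> t = 1 \<longrightarrow> ch (ro j t) \<subseteq> ro j ` {..<k})"
    by (rule gadgets_exist[OF _ few]) (rule ch\<Delta>)
  then obtain k J ro where k: "k = 2 \<or> k = 2 * b + 5" and J: "card J = N" "gadget_chains k J ro"
    and inner: "\<forall>j\<in>J. \<forall>t. 0 < t \<longrightarrow> t < k \<longrightarrow> t < k - 1 \<or> t = 1 \<longrightarrow> ch (ro j t) \<subseteq> ro j ` {..<k}"
    by (elim exE conjE) (rule that; assumption)
  have ws: "8 * real n * real m ^ 3 * 2 powr (- real m / (4 * real b)) < 1"
  proof -
    have "T / (4 * B) \<le> real m / (4 * real b)" using hm(1) hb b(1) pos by (intro frac_le) auto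
    then have "2 powr (- real m / (4 * real b)) \<le> 2 powr (- T / (4 * B))" by simp
    then have "8 * real n * real m ^ 3 * 2 powr (- real m / (4 * real b))
      \<le> 8 * real n * (T + 1) ^ 3 * 2 powr (- T / (4 * B))"
      using hm(2) by (intro mult_mono power_mono order_refl) auto
    then show ?thesis using l(7) by linarith
  qed
  interpret completing V E root par h n b k J ro \<Delta> c D0 Q dm m
  proof (intro completing.intro placement.intro embedding.intro rt)
    show "clique_game n" by unfold_locales (simp add: finite_complete_edges)
    show "embedding_axioms V root par n b k J ro"
    proof
      show "n = card V" using n by simp
      show "k = 2 \<or> k = 2 * b + 5" by (rule k)
      show "gadget_chains k J ro" by (rule J(2))
      show "ch (ro j t) \<subseteq> ro j ` {..<k}" if "j \<in> J" "0 < t" "t < k" "t < k - 1 \<or> t = 1" for j t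
        using inner[rule_format, OF that] .
    qed
    show "placement_axioms V root par n b J \<Delta> c D0 Q dm"
    proof
      show "card (ch r) \<le> \<Delta>" if "r \<in> V" for r using that by (rule ch\<Delta>)
      show "\<Delta> \<le> c" "b + 3 \<le> c" by (auto simp: c_def)
      have "real (12 * b * c) \<le> 12 * B * C"
        unfolding of_nat_mult of_nat_numeral using pos by (intro mult_mono order_refl bounds) auto
      then show "12 * b * c \<le> D0" using l(2) hD0(1) by linarith
      have "real (12 * b * (n + (4 * b + 5) * card J + 1)) \<le> 12 * B * (real n + (4 * B + 5) * L + 1)"
        unfolding of_nat_mult of_nat_add of_nat_numeral of_nat_1 J(1)
        using pos by (intro mult_mono add_mono order_refl bounds add_nonneg_nonneg mult_nonneg_nonneg) auto
      also have "\<dots> < G * real n powr 0.32" by (rule l(3))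
      also have "\<dots> \<le> real D0 * real (Q + 1)"
        using hD0(1) hQ(1) by (intro mult_mono) auto
      finally show "12 * b * (n + (4 * b + 5) * card J + 1) < D0 * (Q + 1)"
        unfolding of_nat_mult[symmetric] by (simp only: of_nat_less_iff)
      have "real (b * (4 * b + 5) + b * c * Q + b * (c + (4 * b + 5)))
        \<le> B * (4 * B + 5) + B * C * P + B * (C + (4 * B + 5))"
        unfolding of_nat_mult of_nat_add of_nat_numeral
        using pos by (intro mult_mono add_mono order_refl bounds add_nonneg_nonneg mult_nonneg_nonneg) auto
      then have "b * (4 * b + 5) + b * c * Q + b * (c + (4 * b + 5)) \<le> D0" using l(4) hD0(1) by linarith
      then show "D0 + b * (4 * b + 5) + b * c * Q + b * (c + (4 * b + 5)) \<le> dm" unfolding dm_def by linarith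
      have "real (c * Q + (2 * b + 6) * dm + (10 * b + 20) + c + dm * (\<Delta> + \<Delta> * \<Delta>))
        \<le> C * P + (2 * B + 6) * DM + (10 * B + 20) + C + DM * (T + T * T)"
        unfolding of_nat_mult of_nat_add of_nat_numeral
        using pos by (intro mult_mono add_mono order_refl bounds add_nonneg_nonneg mult_nonneg_nonneg) auto
      then show "c * Q + (2 * b + 6) * dm + (10 * b + 20) + c + dm * (\<Delta> + \<Delta> * \<Delta>) < card J"
        unfolding J(1) using l(5) hN(1) by linarith
    qed
    show "completing_axioms n b J c Q dm m"
    proof
      show "0 < b" using b by simp
      show "0 < m" using hm(1) pos by simp
      have "real (c * Q + m + 4 * m * (2 * b + 5) * dm) \<le> C * P + (T + 1) + 4 * (T + 1) * (2 * B + 5) * DM"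
        unfolding of_nat_mult of_nat_add of_nat_numeral
        using pos by (intro mult_mono add_mono order_refl bounds add_nonneg_nonneg mult_nonneg_nonneg) auto
      then show "c * Q + m + 4 * m * (2 * b + 5) * dm < card J" unfolding J(1) using l(6) hN(1) by linarith
      show "8 * real n * real m ^ 3 * 2 powr (- real m / (4 * real b)) < 1" by (rule ws)
      fix \<mu> assume \<mu>: "m \<le> \<mu>" "\<mu> < 2 * m"
      have m1: "1 \<le> real m" using \<open>0 < m\<close> by simp
      \<comment> \<open>The bound for one block follows from the one for all blocks, as
        \<open>(2 * m) ^ 2 \<le> 8 * n * m ^ 3\<close>.\<close>
      have "real \<mu> ^ 2 * 2 powr (- real \<mu> / (4 * real b)) \<le> (2 * real m) ^ 2 * 2 powr (- real m / (4 * real b))"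
        using \<mu> b(1) by (intro mult_mono power_mono) (auto simp: divide_right_mono)
      also have "\<dots> \<le> 8 * real n * real m ^ 3 * 2 powr (- real m / (4 * real b))"
      proof (intro mult_right_mono)
        have "(2 * real m) ^ 2 = 4 * 1 * real m ^ 2" by (simp add: power_mult_distrib)
        also have "\<dots> \<le> 8 * real n * real m ^ 3"
          using l(1) m1 by (intro mult_mono power_increasing) auto
        finally show "(2 * real m) ^ 2 \<le> 8 * real n * real m ^ 3" .
      qed simp
      finally show "real \<mu> ^ 2 * 2 powr (- real \<mu> / (4 * real b)) \<le> 1" using ws by linarith
    qed
  qed
  obtain \<sigma> where \<sigma>: "tree_game_wins_within 1 b V E first \<sigma> (n + (4 * b + 5) * card J + c * Q + 4 * m * card J)"
    using tree_game_win by blast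
  have "real ((4 * b + 5) * card J + c * Q + 4 * m * card J) \<le> (4 * B + 5) * L + C * P + 4 * (T + 1) * L"
    unfolding of_nat_mult of_nat_add of_nat_numeral J(1)
    using pos by (intro mult_mono add_mono order_refl bounds add_nonneg_nonneg mult_nonneg_nonneg) auto
  then have "real (n + (4 * b + 5) * card J + c * Q + 4 * m * card J) \<le> real n + real n powr 0.97"
    using l(9) by simp
  then show ?thesis using \<sigma> by blast
qed

theorem theorem1p1:
  fixes \<alpha> \<epsilon> :: real
  assumes "0 < \<alpha>" and "\<alpha> < 0.005" and "0 < \<epsilon>" and "\<epsilon> < 0.05"
  shows "\<exists>r :: nat \<Rightarrow> real. r \<in> o(\<lambda>n. real n) \<and>
    (\<exists>n0 :: nat. \<forall>n\<ge>n0. \<forall>(V :: nat set) E.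
       tree_graph V E \<and> card V = n \<and> real (max_degree V E) \<le> real n powr \<epsilon> \<longrightarrow>
       (\<forall>b :: nat. 1 \<le> b \<and> real b \<le> real n powr \<alpha> \<longrightarrow>
         (\<forall>first. \<exists>\<sigma> m. real m \<le> real n + r n \<and> tree_game_wins_within 1 b V E first \<sigma> m)))"
proof -
  obtain n0 where n0: "\<And>n. n \<ge> n0 \<Longrightarrow> large n"
    using eventually_large unfolding eventually_sequentially by blast
  show ?thesis
  proof (intro exI conjI)
    \<comment> \<open>The error term and \<open>n0\<close> can be chosen independently of \<alpha>
      and \<epsilon>, since both exponents are replaced by their upper limits.\<close>
    show "(\<lambda>n. real n powr 0.97) \<in> o(\<lambda>n. real n)" by real_asymp
    show "\<forall>n\<ge>n0. \<forall>(V :: nat set) E.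
         tree_graph V E \<and> card V = n \<and> real (max_degree V E) \<le> real n powr \<epsilon> \<longrightarrow>
         (\<forall>b :: nat. 1 \<le> b \<and> real b \<le> real n powr \<alpha> \<longrightarrow>
           (\<forall>first. \<exists>\<sigma> m. real m \<le> real n + real n powr 0.97 \<and> tree_game_wins_within 1 b V E first \<sigma> m))"
    proof (intro allI impI)
      fix n :: nat and V :: "nat set" and E and b :: nat and first
      assume n: "n0 \<le> n" and V: "tree_graph V E \<and> card V = n \<and> real (max_degree V E) \<le> real n powr \<epsilon>"
        and b: "1 \<le> b \<and> real b \<le> real n powr \<alpha>"
      have lg: "large n" using n by (rule n0)
      then have n1: "real n \<ge> 1" by (simp add: large_def Let_def)
      have "real n powr \<epsilon> \<le> real n powr 0.05" "real n powr \<alpha> \<le> real n powr 0.005"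
        using assms n1 by (auto intro!: powr_mono)
      then show "\<exists>\<sigma> m. real m \<le> real n + real n powr 0.97 \<and> tree_game_wins_within 1 b V E first \<sigma> m"
        using V b by (intro tree_game_win_large[OF _ _ lg]) auto
    qed
  qed
qed

end
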